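(* Let $G$ be a non-abelian connected compact group. Then $\mathrm{ZL}^1(G)$ is not amenable.
   Context: For a locally compact group $G$, $\mathrm{L}^1(G)$ is the group algebra (with respect to a left Haar measure, normalised to total mass $1$ when $G$ is compact) under convolution, and $\mathrm{ZL}^1(G)=\{f\in \mathrm{L}^1(G): f*g=g*f \text{ for all } g\in \mathrm{L}^1(G)\}$ is its centre, a commutative Banach algebra. A Banach algebra $\mathfrak{A}$ is amenable if it has a bounded approximate diagonal: a bounded net $(\mu_\alpha)$ in the projective tensor product $\mathfrak{A}\hat{\otimes}\mathfrak{A}$ with $m(\mu_\alpha)a\to a$, $a\,m(\mu_\alpha)\to a$ and $a\cdot\mu_\alpha-\mu_\alpha\cdot a\to 0$ for all $a\in\mathfrak{A}$, where $m$ is the multiplication map and $a\cdot(b\otimes c)=ab\otimes c$, $(b\otimes c)\cdot a=b\otimes ca$. *)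

theory Defs
  imports "HOL-Analysis.Analysis" "HOL-Probability.Probability"
begin

(* The group is a type 'g of class topological_group_add: a (not        *)
(* necessarily commutative!) group, written additively, with jointly    *)
(* continuous multiplication and continuous inversion.                  *)

definition normalised_left_haar :: "'g::{topological_group_add,t2_space} measure \<Rightarrow> bool" where
  "normalised_left_haar M \<longleftrightarrow>
     sets M = sets borel \<and> space M = UNIV \<and> prob_space M \<and>
     (\<forall>g A. A \<in> sets borel \<longrightarrow> emeasure M ((\<lambda>x. g + x) ` A) = emeasure M A) \<and>
     (\<forall>A \<in> sets borel. emeasure M A = (INF U \<in> {U. open U \<and> A \<subseteq> U}. emeasure M U)) \<and>
     (\<forall>U. open U \<longrightarrow> emeasure M U = (SUP K \<in> {K. compact K \<and> K \<subseteq> U}. emeasure M K))"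

definition L1norm :: "'g measure \<Rightarrow> ('g \<Rightarrow> complex) \<Rightarrow> real" where
  "L1norm M f = (\<integral>x. cmod (f x) \<partial>M)"

definition conv :: "'g::group_add measure \<Rightarrow> ('g \<Rightarrow> complex) \<Rightarrow> ('g \<Rightarrow> complex) \<Rightarrow> 'g \<Rightarrow> complex" where
  "conv M f g = (\<lambda>x. \<integral>y. f y * g (- y + x) \<partial>M)"

definition ZL1 :: "'g::group_add measure \<Rightarrow> ('g \<Rightarrow> complex) set" where
  "ZL1 M = {f. integrable M f \<and>
              (\<forall>g. integrable M g \<longrightarrow> (AE x in M. conv M f g x = conv M g f x))}"

(* Projective tensor product A \<hat>\<otimes> A of A = ZL^1(G).                *)
(* An element is represented by a pair of sequences (c,d) in A with     *)
(* sum_n ||c_n|| ||d_n|| < \<infinity>, standing for sum_n c_n \<otimes> d_n.   *)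
(* Two representations give the same element iff every bounded         *)
(* bilinear form (= element of the dual) agrees on them; the norm is    *)
(* the projective norm, the infimum over all representations.           *)

type_synonym 'g rep = "(nat \<Rightarrow> 'g \<Rightarrow> complex) \<times> (nat \<Rightarrow> 'g \<Rightarrow> complex)"

definition is_rep :: "'g::group_add measure \<Rightarrow> 'g rep \<Rightarrow> bool" where
  "is_rep M r \<longleftrightarrow> (\<forall>n. fst r n \<in> ZL1 M \<and> snd r n \<in> ZL1 M) \<and>
      summable (\<lambda>n. L1norm M (fst r n) * L1norm M (snd r n))"

definition bdd_bilinear :: "'g::group_add measure \<Rightarrow> (('g \<Rightarrow> complex) \<Rightarrow> ('g \<Rightarrow> complex) \<Rightarrow> complex) \<Rightarrow> bool" where
  "bdd_bilinear M \<phi> \<longleftrightarrow>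
     (\<forall>f\<in>ZL1 M. \<forall>f'\<in>ZL1 M. \<forall>g\<in>ZL1 M. \<forall>c::complex.
        \<phi> (\<lambda>x. f x + f' x) g = \<phi> f g + \<phi> f' g \<and>
        \<phi> g (\<lambda>x. f x + f' x) = \<phi> g f + \<phi> g f' \<and>
        \<phi> (\<lambda>x. c * f x) g = c * \<phi> f g \<and>
        \<phi> g (\<lambda>x. c * f x) = c * \<phi> g f) \<and>
     (\<exists>C. \<forall>f\<in>ZL1 M. \<forall>g\<in>ZL1 M. cmod (\<phi> f g) \<le> C * L1norm M f * L1norm M g)"

definition same_tensor :: "'g::group_add measure \<Rightarrow> 'g rep \<Rightarrow> 'g rep \<Rightarrow> bool" where
  "same_tensor M r s \<longleftrightarrow>
     (\<forall>\<phi>. bdd_bilinear M \<phi> \<longrightarrow>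
        (\<Sum>n. \<phi> (fst r n) (snd r n)) = (\<Sum>n. \<phi> (fst s n) (snd s n)))"

definition proj_norm :: "'g::group_add measure \<Rightarrow> 'g rep \<Rightarrow> real" where
  "proj_norm M r = Inf {(\<Sum>n. L1norm M (fst s n) * L1norm M (snd s n)) | s.
                           is_rep M s \<and> same_tensor M r s}"

(* the multiplication map m : A \<hat>\<otimes> A \<rightarrow> A, m(sum c_n \<otimes> d_n) = sum c_n * d_n
   (the series converges absolutely in L^1, hence also pointwise a.e.) *)
definition mult_map :: "'g::group_add measure \<Rightarrow> 'g rep \<Rightarrow> 'g \<Rightarrow> complex" where
  "mult_map M r = (\<lambda>x. \<Sum>n. conv M (fst r n) (snd r n) x)"

(* representation of  a\<cdot>r - r\<cdot>a :  interleave  (a*c_n) \<otimes> d_n  and  (-c_n) \<otimes> (d_n*a) *)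
definition commutator_rep :: "'g::group_add measure \<Rightarrow> ('g \<Rightarrow> complex) \<Rightarrow> 'g rep \<Rightarrow> 'g rep" where
  "commutator_rep M a r =
     ((\<lambda>n. if even n then conv M a (fst r (n div 2)) else (\<lambda>x. - fst r (n div 2) x)),
      (\<lambda>n. if even n then snd r (n div 2) else conv M (snd r (n div 2)) a))"

(* A bounded approximate diagonal for ZL^1(G), as a net indexed by a
   proper filter F (nets on directed sets = proper filters). *)
definition bounded_approx_diagonal :: "'g::group_add measure \<Rightarrow> 'i filter \<Rightarrow> ('i \<Rightarrow> 'g rep) \<Rightarrow> bool" where
  "bounded_approx_diagonal M F \<mu> \<longleftrightarrow>
     F \<noteq> bot \<and> (\<forall>i. is_rep M (\<mu> i)) \<and> (\<exists>C. \<forall>i. proj_norm M (\<mu> i) \<le> C) \<and>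
     (\<forall>a\<in>ZL1 M.
        ((\<lambda>i. L1norm M (\<lambda>x. conv M (mult_map M (\<mu> i)) a x - a x)) \<longlongrightarrow> 0) F \<and>
        ((\<lambda>i. L1norm M (\<lambda>x. conv M a (mult_map M (\<mu> i)) x - a x)) \<longlongrightarrow> 0) F \<and>
        ((\<lambda>i. proj_norm M (commutator_rep M a (\<mu> i))) \<longlongrightarrow> 0) F)"

(* ZL^1(G) is amenable iff it has a bounded approximate diagonal; the index
   type of the net is a type parameter, so non-amenability is stated as:
   for every index type, no net is a bounded approximate diagonal. *)

end

theory Submission
  imports Defs
begin

text \<open>
  Let \<open>e = d \<chi>\<close> run through the minimal idempotents of \<open>ZL\<^sup>1(G)\<close> and put \<open>\<psi>\<^sub>e = \<chi>/d\<close>.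
  A bounded approximate diagonal tested against \<open>\<psi>\<^sub>e \<otimes> h\<close> converges to the coefficient \<open>\<integral> e h\<close>.
  We choose \<open>h = \<psi>\<^sub>e (1 - \<psi>\<^sub>t)\<close>, up to conjugation, for a minimal \<open>t\<close> with \<open>\<psi>\<^sub>t = 1\<close> on the centre
  and \<open>\<psi>\<^sub>t \<noteq> 1\<close>; it exists because \<open>G\<close> is not abelian. The number
  \<open>d\<^sub>t\<^sup>2 \<integral> |\<chi>|\<^sup>2 \<psi>\<^sub>t\<close> is the trace of a projection, hence an integer, and connectedness makes
  it smaller than \<open>d\<^sub>t\<^sup>2\<close>; so these limits are bounded below by some \<open>c > 0\<close> independent of \<open>e\<close>.
  On the other hand, for \<open>P = u * u\<^sup>*\<close> supported near the identity, with expansion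
  \<open>P = \<Sum> w\<^sub>e \<psi>\<^sub>e\<close> and \<open>\<Sum> w\<^sub>e = 1\<close>, one has \<open>\<Sum> w\<^sub>e |\<psi>\<^sub>e(y)|\<^sup>2 = \<integral> P(y t y\<^sup>-\<^sup>1 t\<^sup>-\<^sup>1) dt\<close>,
  which is uniformly small on compact sets of noncentral \<open>y\<close>, since centralisers of noncentral
  elements are null sets in a connected group. Hence the \<open>w\<close>-average of the test forms
  has arbitrarily small norm, against the lower bound \<open>c\<close>.
\<close>

section \<open>Integration of continuous functions\<close>

text \<open>The factor \<open>1 - nch t\<close> in the test function is forced by the centre: every
  \<open>nch e\<close> has modulus 1 there, so no average of the \<open>|nch e|\<close> is small at
  central points. A \<open>t\<close> that is trivial on the centre cancels these points. The price
  is a lower bound for the test coefficients that must be uniform in \<open>e\<close>; integrality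
  supplies it, since otherwise the coefficients could tend to 0 along the minimal idempotents.

  The limit arises from two properties of the diagonal. Testing its commutator with \<open>e\<close>
  yields the test value minus the integral of \<open>e * h\<close> times the
  \<open>e\<close>-coefficient of the product, and the approximate unit property sends that
  coefficient to 1.

  Representations never appear. Minimal idempotents among the continuous class functions replace
  irreducible characters; one-dimensionality of the corner cut out by \<open>e\<close> gives the
  functional equation, the main tool afterwards.

  No countable base is assumed, so Borel sets of the square may escape the product
  \<open>\<sigma>\<close>-algebra. Hence Fubini is used for continuous kernels, possibly weighted by
  an integrable function of one variable, or for Baire functions.\<close>

lemmas group_normalise = diff_conv_add_uminus add.assoc minus_add

lemma continuous_on_comp_UNIV:
  "continuous_on UNIV f \<Longrightarrow> continuous_on A g \<Longrightarrow> continuous_on A (\<lambda>x. f (g x))"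
  by (rule continuous_on_compose2[where t=UNIV]) auto

text \<open>Finite unions of open boxes always belong to the product
  \<open>\<sigma>\<close>-algebra, while a general open subset of the square need not. Inserting
  such a union between a compact and an open set turns topology into product measurability.\<close>

lemma box_open_compact_cover:
  fixes W :: "('a::topological_space \<times> 'b::topological_space) set"
  assumes "compact K" "open W" "K \<subseteq> W"
  obtains \<C> where "finite \<C>" "K \<subseteq> (\<Union>(A,B)\<in>\<C>. A \<times> B)" "(\<Union>(A,B)\<in>\<C>. A \<times> B) \<subseteq> W"
    "\<And>A B. (A,B) \<in> \<C> \<Longrightarrow> open A \<and> open B"
proof -
  define \<D> where "\<D> = {(A,B). open A \<and> open B \<and> A \<times> B \<subseteq> W}"
  have "K \<subseteq> (\<Union>p\<in>\<D>. fst p \<times> snd p)"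
  proof
    fix x assume "x \<in> K"
    then have "x \<in> W" using assms by auto
    then obtain A B where "open A" "open B" "x \<in> A \<times> B" "A \<times> B \<subseteq> W"
      using \<open>open W\<close> open_prod_elim by metis
    then have "(A,B) \<in> \<D>" "x \<in> fst (A,B) \<times> snd (A,B)" by (auto simp: \<D>_def)
    then show "x \<in> (\<Union>p\<in>\<D>. fst p \<times> snd p)" by blast
  qed
  moreover have "open (fst p \<times> snd p)" if "p \<in> \<D>" for p
    using that by (auto simp: \<D>_def intro: open_Times)
  ultimately obtain \<C> where "\<C> \<subseteq> \<D>" "finite \<C>" "K \<subseteq> (\<Union>p\<in>\<C>. fst p \<times> snd p)"
    by (elim compactE_image[OF assms(1)])
  then show thesis
    by (intro that[of \<C>]) (auto simp: \<D>_def split_beta subset_iff)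
qed

locale compact_haar =
  fixes M :: "'g::{topological_group_add,t2_space} measure"
  assumes compact_group: "compact (UNIV :: 'g set)"
    and haar: "normalised_left_haar M"
begin

sublocale prob_space M
  using haar by (simp add: normalised_left_haar_def)

lemma sets_M [simp, measurable_cong]: "sets M = sets borel"
  and space_M [simp]: "space M = UNIV"
  using haar by (simp_all add: normalised_left_haar_def)

lemma prob_UNIV [simp]: "prob UNIV = 1"
  using prob_space by simp

sublocale PM: pair_prob_space M M ..

lemma measurable_M_iff [simp]: "borel_measurable M = borel_measurable borel"
  by (intro measurable_cong_sets) auto

lemma cont_measurable: "continuous_on UNIV f \<Longrightarrow> f \<in> borel_measurable M"
  by (simp add: borel_measurable_continuous_onI)

lemma cont_bounded:
  fixes f :: "'g \<Rightarrow> 'b::real_normed_vector"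
  assumes "continuous_on UNIV f"
  obtains B where "B > 0" "\<And>x. norm (f x) \<le> B"
proof -
  have "bounded (range f)"
    using compact_continuous_image[OF assms compact_group] compact_imp_bounded by auto
  then obtain B where "B > 0" "\<And>x. norm (f x) \<le> B" unfolding bounded_pos by auto
  then show thesis using that by auto
qed

lemma cont_bounded_pair:
  fixes f :: "'g \<times> 'g \<Rightarrow> 'b::real_normed_vector"
  assumes "continuous_on UNIV f"
  obtains B where "B > 0" "\<And>x. norm (f x) \<le> B"
proof -
  have "compact (UNIV :: ('g \<times> 'g) set)"
    using compact_Times[OF compact_group compact_group] by (simp add: UNIV_Times_UNIV)
  then have "bounded (range f)"
    using compact_continuous_image[OF assms] compact_imp_bounded by auto
  then obtain B where "B > 0" "\<And>x. norm (f x) \<le> B" unfolding bounded_pos by auto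
  then show thesis using that by auto
qed

lemma cont_integrable [intro]:
  fixes f :: "'g \<Rightarrow> 'b::{banach,second_countable_topology}"
  assumes "continuous_on UNIV f"
  shows "integrable M f"
proof -
  obtain B where B: "\<And>x. norm (f x) \<le> B" using cont_bounded[OF assms] by auto
  show ?thesis
    by (rule integrable_const_bound[of _ B]) (use B cont_measurable[OF assms] in auto)
qed

text \<open>The set where \<open>f > a\<close> is exhausted by the compact sets where
  \<open>f \<ge> a + 1 / Suc n\<close>. A finite union of boxes \<open>R n\<close> fits between each
  of these and the whole, which is therefore the countable union of the \<open>R n\<close>.\<close>

lemma cont_pair_measurable_real:
  fixes f :: "'g \<times> 'g \<Rightarrow> real"
  assumes f: "continuous_on UNIV f"
  shows "f \<in> borel_measurable (M \<Otimes>\<^sub>M M)"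
proof (rule borel_measurable_iff_greater[THEN iffD2, rule_format])
  fix a :: real
  have cpt: "compact (UNIV :: ('g \<times> 'g) set)"
    using compact_Times[OF compact_group compact_group] by (simp add: UNIV_Times_UNIV)
  have "\<exists>R. R \<in> sets (M \<Otimes>\<^sub>M M) \<and> {p. f p \<ge> a + 1 / Suc n} \<subseteq> R \<and> R \<subseteq> {p. f p > a}" for n
  proof -
    have "closed {p. f p \<ge> a + 1 / Suc n}" "open {p. f p > a}"
      using f by (auto intro!: closed_Collect_le open_Collect_less continuous_intros)
    then have "compact {p. f p \<ge> a + 1 / Suc n}"
      using compact_Int_closed[OF cpt] by (simp add: Int_UNIV_left)
    moreover have "{p. f p \<ge> a + 1 / Suc n} \<subseteq> {p. f p > a}"
      by (auto intro: less_le_trans[rotated])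
    ultimately obtain \<C> where C: "finite \<C>" "{p. f p \<ge> a + 1 / Suc n} \<subseteq> (\<Union>(A,B)\<in>\<C>. A \<times> B)"
      "(\<Union>(A,B)\<in>\<C>. A \<times> B) \<subseteq> {p. f p > a}" "\<And>A B. (A,B) \<in> \<C> \<Longrightarrow> open A \<and> open B"
      using box_open_compact_cover \<open>open {p. f p > a}\<close> by metis
    have "(\<Union>(A,B)\<in>\<C>. A \<times> B) \<in> sets (M \<Otimes>\<^sub>M M)"
      using C by (intro sets.finite_UN) (auto intro!: pair_measureI)
    then show ?thesis using C by blast
  qed
  then obtain R where R: "\<And>n. R n \<in> sets (M \<Otimes>\<^sub>M M)"
    "\<And>n. {p. f p \<ge> a + 1 / Suc n} \<subseteq> R n" "\<And>n. R n \<subseteq> {p. f p > a}" by metis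
  have "{p. f p > a} \<subseteq> (\<Union>n. R n)"
  proof
    fix p assume "p \<in> {p. f p > a}"
    then obtain n where "1 / Suc n < f p - a"
      using reals_Archimedean[of "f p - a"] by (auto simp: inverse_eq_divide)
    then show "p \<in> (\<Union>n. R n)" using R(2)[of n] by (auto intro!: exI[of _ n])
  qed
  then have "{p. f p > a} = (\<Union>n. R n)" using R(3) by auto
  moreover have "(\<Union>n. R n) \<in> sets (M \<Otimes>\<^sub>M M)" using R(1) by auto
  ultimately show "{w \<in> space (M \<Otimes>\<^sub>M M). a < f w} \<in> sets (M \<Otimes>\<^sub>M M)"
    by (simp add: space_pair_measure)
qed

lemma cont_pair_measurable:
  fixes f :: "'g \<times> 'g \<Rightarrow> complex"
  assumes "continuous_on UNIV f"
  shows "f \<in> borel_measurable (M \<Otimes>\<^sub>M M)"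
  unfolding borel_measurable_complex_iff
  using assms by (intro conjI cont_pair_measurable_real continuous_intros)

lemma weighted_integrable_pair:
  fixes f :: "'g \<Rightarrow> complex" and F :: "'g \<times> 'g \<Rightarrow> complex"
  assumes "integrable M f" "continuous_on UNIV F"
  shows "integrable (M \<Otimes>\<^sub>M M) (\<lambda>(x,y). f x * F (x,y))"
proof -
  obtain B where B: "\<And>p. norm (F p) \<le> B" using cont_bounded_pair[OF assms(2)] by blast
  have m: "F \<in> borel_measurable (M \<Otimes>\<^sub>M M)" by (rule cont_pair_measurable[OF assms(2)])
  have mf: "f \<in> borel_measurable M" using assms(1) by auto
  have mm: "(\<lambda>(x,y). f x) \<in> borel_measurable (M \<Otimes>\<^sub>M M)"
    using measurable_compose[OF measurable_fst mf, of M] by (simp add: split_beta)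
  have i: "integrable (M \<Otimes>\<^sub>M M) (\<lambda>(x,y). f x)"
    by (rule PM.Fubini_integrable[OF mm]) (use assms(1) in \<open>auto simp: prob_space\<close>)
  show ?thesis
  proof (rule Bochner_Integration.integrable_bound[of _ "\<lambda>p. B * norm (case p of (x,y) \<Rightarrow> f x)"])
    show "integrable (M \<Otimes>\<^sub>M M) (\<lambda>p. B * norm (case p of (x, y) \<Rightarrow> f x))"
      using i by auto
    show "(\<lambda>(x, y). f x * F (x, y)) \<in> borel_measurable (M \<Otimes>\<^sub>M M)"
      using borel_measurable_times[OF borel_measurable_integrable[OF i] m] by (simp add: case_prod_unfold)
    show "AE p in M \<Otimes>\<^sub>M M. norm (case p of (x, y) \<Rightarrow> f x * F (x, y)) \<le> norm (B * norm (case p of (x, y) \<Rightarrow> f x))"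
    proof (rule AE_I2, clarify)
      fix x y
      have "cmod (f x) * cmod (F (x,y)) \<le> cmod (f x) * \<bar>B\<bar>"
        by (rule mult_left_mono) (use B[of "(x,y)"] in auto)
      then show "norm (f x * F (x, y)) \<le> norm (B * norm (f x))"
        by (simp add: norm_mult abs_mult mult.commute)
    qed
  qed
qed

lemma weighted_fubini:
  fixes f :: "'g \<Rightarrow> complex" and F :: "'g \<times> 'g \<Rightarrow> complex"
  assumes "integrable M f" "continuous_on UNIV F"
  shows "(\<integral>x. f x * (\<integral>y. F (x,y) \<partial>M) \<partial>M) = (\<integral>y. (\<integral>x. f x * F (x,y) \<partial>M) \<partial>M)"
  using PM.Fubini_integral[of "\<lambda>x y. f x * F (x,y)"] weighted_integrable_pair[OF assms]
  by simp

lemma cont_fubini: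
  fixes F :: "'g \<times> 'g \<Rightarrow> complex"
  assumes "continuous_on UNIV F"
  shows "(\<integral>x. (\<integral>y. F (x,y) \<partial>M) \<partial>M) = (\<integral>y. (\<integral>x. F (x,y) \<partial>M) \<partial>M)"
  using weighted_fubini[of "\<lambda>_. 1" F] assms by simp

text \<open>The tube lemma along the compact coordinate makes continuity at \<open>y0\<close>
  uniform in \<open>x\<close>. This stands in for dominated convergence, which treats only
  sequences, when parameter integrals are shown to be continuous.\<close>

lemma cont_uniform_nbhd:
  fixes F :: "'g \<times> 'c::topological_space \<Rightarrow> 'b::metric_space"
  assumes "continuous_on UNIV F" "e > 0"
  obtains U where "open U" "y0 \<in> U" "\<And>x y. y \<in> U \<Longrightarrow> dist (F (x,y)) (F (x,y0)) < e"
proof -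
  define W where "W = {p. dist (F (snd p, fst p)) (F (snd p, y0)) < e}"
  have "open W"
    unfolding W_def by (intro open_Collect_less continuous_intros continuous_on_comp_UNIV[OF assms(1)])
  moreover have "{y0} \<times> UNIV \<subseteq> W" using assms(2) by (auto simp: W_def)
  ultimately have "\<exists>U. y0 \<in> U \<and> open U \<and> U \<times> UNIV \<subseteq> W"
    by (rule Elementary_Topology.tube_lemma[OF compact_group])
  then obtain U where "y0 \<in> U" "open U" "U \<times> UNIV \<subseteq> W" by blast
  then have "dist (F (x,y)) (F (x,y0)) < e" if "y \<in> U" for x y
  proof -
    have "(y,x) \<in> W" using that \<open>U \<times> UNIV \<subseteq> W\<close> by blast
    then show ?thesis by (simp add: W_def)
  qed
  then show thesis using \<open>y0 \<in> U\<close> \<open>open U\<close> that by blast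
qed

lemma cont_section1: "continuous_on UNIV F \<Longrightarrow> continuous_on A (\<lambda>x. F (x,y))"
  by (erule continuous_on_comp_UNIV) (intro continuous_intros)

lemma cont_section2: "continuous_on UNIV F \<Longrightarrow> continuous_on A (\<lambda>y. F (x,y))"
  by (erule continuous_on_comp_UNIV) (intro continuous_intros)

lemma weighted_integrable:
  fixes f F :: "'g \<Rightarrow> complex"
  assumes "integrable M f" "continuous_on UNIV F"
  shows "integrable M (\<lambda>x. f x * F x)"
proof -
  obtain B where B: "\<And>p. norm (F p) \<le> B" using cont_bounded[OF assms(2)] by auto
  show ?thesis
  proof (rule Bochner_Integration.integrable_bound[of _ "\<lambda>p. B * norm (f p)"])
    show "(\<lambda>x. f x * F x) \<in> borel_measurable M"
      using assms cont_measurable[OF assms(2)] by (intro borel_measurable_times) auto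
    show "AE p in M. norm (f p * F p) \<le> norm (B * norm (f p))"
    proof (rule AE_I2)
      fix x
      have "cmod (f x) * cmod (F x) \<le> cmod (f x) * \<bar>B\<bar>"
        by (rule mult_left_mono) (use B[of x] in auto)
      then show "norm (f x * F x) \<le> norm (B * norm (f x))"
        by (simp add: norm_mult abs_mult mult.commute)
    qed
  qed (use assms in auto)
qed

lemma weighted_norm_le:
  fixes f F :: "'g \<Rightarrow> complex"
  assumes "integrable M f" "continuous_on UNIV F" "\<And>x. norm (F x) \<le> B"
  shows "norm (\<integral>x. f x * F x \<partial>M) \<le> B * (\<integral>x. norm (f x) \<partial>M)"
proof -
  have "norm (\<integral>x. f x * F x \<partial>M) \<le> (\<integral>x. norm (f x * F x) \<partial>M)"
    by (rule integral_norm_bound)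
  also have "\<dots> \<le> (\<integral>x. B * norm (f x) \<partial>M)"
  proof (rule integral_mono)
    show "integrable M (\<lambda>x. norm (f x * F x))"
      using weighted_integrable[OF assms(1,2)] by auto
    fix x show "norm (f x * F x) \<le> B * norm (f x)"
      using mult_right_mono[OF assms(3)[of x], of "norm (f x)"] by (simp add: norm_mult mult.commute)
  qed (use assms in auto)
  finally show ?thesis by simp
qed

lemma weighted_param_cont:
  fixes f :: "'g \<Rightarrow> complex" and F :: "'g \<times> 'c::t2_space \<Rightarrow> complex"
  assumes f: "integrable M f" and F: "continuous_on UNIV F"
  shows "continuous_on UNIV (\<lambda>y. \<integral>x. f x * F (x,y) \<partial>M)"
  unfolding continuous_on_eq_continuous_within
proof (intro ballI, simp, unfold continuous_at tendsto_iff, intro allI impI)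
  fix y0 and e :: real assume "e > 0"
  define N where "N = (\<integral>x. norm (f x) \<partial>M)"
  have N: "N \<ge> 0" by (simp add: N_def)
  define d where "d = e / (N + 1)"
  have d: "d > 0" using \<open>e > 0\<close> N by (simp add: d_def)
  obtain U where U: "open U" "y0 \<in> U" "\<And>x y. y \<in> U \<Longrightarrow> dist (F (x,y)) (F (x,y0)) < d"
    using cont_uniform_nbhd[OF F d] by blast
  have "dist (\<integral>x. f x * F (x,y) \<partial>M) (\<integral>x. f x * F (x,y0) \<partial>M) < e" if "y \<in> U" for y
  proof -
    have "(\<integral>x. f x * F (x,y) \<partial>M) - (\<integral>x. f x * F (x,y0) \<partial>M) = (\<integral>x. f x * (F (x,y) - F (x,y0)) \<partial>M)"
      by (subst Bochner_Integration.integral_diff[symmetric])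
         (auto intro!: weighted_integrable f cont_section1[OF F] simp: algebra_simps)
    also have "norm \<dots> \<le> d * N"
      unfolding N_def using U(3)[OF that]
      by (intro weighted_norm_le f continuous_intros cont_section1[OF F])
         (simp add: dist_norm less_imp_le)
    also have "d * N < e" using N \<open>e > 0\<close> by (simp add: d_def field_simps)
    finally show ?thesis by (simp add: dist_norm)
  qed
  then show "\<forall>\<^sub>F y in at y0. dist (\<integral>x. f x * F (x,y) \<partial>M) (\<integral>x. f x * F (x,y0) \<partial>M) < e"
    using U(1,2) by (auto simp: eventually_at_topological)
qed

lemma cont_param:
  fixes F :: "'g \<times> 'c::t2_space \<Rightarrow> complex"
  assumes F: "continuous_on UNIV F"
  shows "continuous_on UNIV (\<lambda>y. \<integral>x. F (x,y) \<partial>M)"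
  using weighted_param_cont[of "\<lambda>_. 1" F] assms by simp

section \<open>Translation invariance and full support of the Haar measure\<close>

lemma cont_translate: "continuous_on A (\<lambda>x::'g. g + x)"
  by (intro continuous_intros)

lemma open_borel [simp]: "open A \<Longrightarrow> A \<in> sets borel"
  by auto

lemma translate_distr: "distr M M (\<lambda>x. g + x) = M"
proof (rule measure_eqI)
  fix A assume "A \<in> sets (distr M M (\<lambda>x. g + x))"
  then have A: "A \<in> sets borel" by simp
  have m: "(\<lambda>x. g + x) \<in> measurable M M"
    by (simp cong: measurable_cong_sets add: borel_measurable_continuous_onI cont_translate)
  have "(\<lambda>x. g + x) -` A = (\<lambda>x. - g + x) ` A"
    by (force simp: image_iff intro!: bexI[of _ "g + _"] simp flip: add.assoc)
  then show "emeasure (distr M M (\<lambda>x. g + x)) A = emeasure M A"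
    using haar A m by (simp add: emeasure_distr normalised_left_haar_def)
qed simp

lemma translate_measurable: "(\<lambda>x. g + x) \<in> measurable M M"
    by (simp cong: measurable_cong_sets add: borel_measurable_continuous_onI cont_translate)

lemma integral_left:
  fixes f :: "'g \<Rightarrow> 'b::{banach,second_countable_topology}"
  assumes "f \<in> borel_measurable borel"
  shows "(\<integral>x. f (g + x) \<partial>M) = (\<integral>x. f x \<partial>M)"
  using integral_distr[OF translate_measurable[of g], of f] assms by (simp add: translate_distr)

text \<open>Finitely many left translates of \<open>U\<close> cover the compact group, so a null
  \<open>U\<close> would make the whole space null. Almost-everywhere identities between continuous
  functions thereby become pointwise ones.\<close>

lemma open_pos:
  assumes "open U" "U \<noteq> {}"
  shows "emeasure M U > 0"
proof (rule ccontr)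
  assume "\<not> emeasure M U > 0"
  then have z: "emeasure M U = 0" by auto
  obtain u where u: "u \<in> U" using assms by auto
  have tr: "(\<lambda>x. g + x) ` U = (\<lambda>x. - g + x) -` U" for g
    by (force simp: image_iff intro!: bexI[of _ "- g + _"] simp flip: add.assoc)
  have op: "open ((\<lambda>x. g + x) ` U)" for g
    unfolding tr by (rule open_vimage[OF assms(1) cont_translate])
  have "UNIV \<subseteq> (\<Union>g. (\<lambda>x. g + x) ` U)"
  proof
    fix x have "x = (x - u) + u" by simp
    then show "x \<in> (\<Union>g. (\<lambda>x. g + x) ` U)" using u by blast
  qed
  then obtain C where C: "finite C" "UNIV \<subseteq> (\<Union>g\<in>C. (\<lambda>x. g + x) ` U)"
    using compactE_image[OF compact_group, of UNIV "\<lambda>g. (\<lambda>x. g + x) ` U"] op by auto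
  have "emeasure M UNIV \<le> emeasure M (\<Union>g\<in>C. (\<lambda>x. g + x) ` U)"
    using C op by (intro emeasure_mono sets.finite_UN) auto
  also have "\<dots> \<le> (\<Sum>g\<in>C. emeasure M ((\<lambda>x. g + x) ` U))"
    using C op by (intro emeasure_subadditive_finite) auto
  also have "\<dots> = 0"
    using haar z assms by (simp add: normalised_left_haar_def)
  finally show False using emeasure_space_1 by simp
qed

lemma cont_AE_zero:
  fixes f :: "'g \<Rightarrow> 'b::real_normed_vector"
  assumes "continuous_on UNIV f" "AE x in M. f x = 0"
  shows "f x = 0"
proof (rule ccontr)
  assume n: "f x \<noteq> 0"
  have "open {x. f x \<noteq> 0}" by (intro open_Collect_neq assms(1) continuous_intros)
  then have "emeasure M {x. f x \<noteq> 0} > 0" using open_pos n by auto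
  moreover have "emeasure M {x. f x \<noteq> 0} = 0"
    using assms(2) \<open>open {x. f x \<noteq> 0}\<close> by (subst (asm) AE_iff_measurable[OF _ refl]) auto
  ultimately show False by simp
qed

lemma cont_AE_eq:
  fixes f :: "'g \<Rightarrow> 'b::real_normed_vector"
  assumes "continuous_on UNIV f" "continuous_on UNIV g" "AE x in M. f x = g x"
  shows "f x = g x"
  using cont_AE_zero[of "\<lambda>x. f x - g x" x] assms by (auto intro!: continuous_intros)

lemma cont_integral_zero:
  fixes f :: "'g \<Rightarrow> real"
  assumes "continuous_on UNIV f" "\<And>x. f x \<ge> 0" "(\<integral>x. f x \<partial>M) = 0"
  shows "f x = 0"
proof -
  have "AE x in M. f x = 0"
    using assms integral_nonneg_eq_0_iff_AE[OF cont_integrable[OF assms(1)]] by auto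
  then show ?thesis using cont_AE_zero assms by blast
qed

text \<open>Averaging over left translations turns \<open>f (- x)\<close> into
  \<open>f (- x + y)\<close> integrated over both variables; after exchanging the integrals, left
  invariance in \<open>y\<close> removes \<open>x\<close>. Continuity of \<open>f\<close> justifies
  the exchange at this stage.\<close>

lemma integral_inverse_cont:
  fixes f :: "'g \<Rightarrow> complex"
  assumes f: "continuous_on UNIV f"
  shows "(\<integral>x. f (- x) \<partial>M) = (\<integral>x. f x \<partial>M)"
proof -
  have c: "continuous_on UNIV (\<lambda>p::'g \<times> 'g. f (- fst p + snd p))"
    by (intro continuous_on_comp_UNIV[OF f] continuous_intros)
  have "(\<integral>x. f (- x) \<partial>M) = (\<integral>y. (\<integral>x. f (- (- y + x)) \<partial>M) \<partial>M)"
    using integral_left[of "\<lambda>x. f (- x)"] borel_measurable_continuous_onI[of "\<lambda>x. f (- x)"]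
    by (simp add: prob_space continuous_on_comp_UNIV[OF f] continuous_intros)
  also have "\<dots> = (\<integral>y. (\<integral>x. f (- x + y) \<partial>M) \<partial>M)"
    by (simp add: minus_add)
  also have "\<dots> = (\<integral>x. (\<integral>y. f (- x + y) \<partial>M) \<partial>M)"
    using cont_fubini[OF c] by simp
  also have "\<dots> = (\<integral>x. f x \<partial>M)"
    using integral_left[of f] borel_measurable_continuous_onI[OF f] by (simp add: prob_space)
  finally show ?thesis .
qed

lemma urysohn:
  assumes "closed K" "open U" "K \<subseteq> U"
  obtains \<phi> :: "'g \<Rightarrow> real" where "continuous_on UNIV \<phi>" "\<And>x. 0 \<le> \<phi> x" "\<And>x. \<phi> x \<le> 1"
    "\<And>x. x \<in> K \<Longrightarrow> \<phi> x = 1" "\<And>x. x \<notin> U \<Longrightarrow> \<phi> x = 0"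
proof -
  have "Hausdorff_space (euclidean :: 'g topology)"
    unfolding Hausdorff_space_def by (simp add: disjnt_def) (meson hausdorff)
  then have "normal_space (euclidean :: 'g topology)"
    using compact_group by (intro compact_Hausdorff_or_regular_imp_normal_space)
      (auto simp: compact_space_def)
  moreover have "disjnt (- U) K" using assms by (auto simp: disjnt_def)
  ultimately obtain \<phi> where "continuous_map euclidean (top_of_set {0..1::real}) \<phi>"
    "\<phi> ` (- U) \<subseteq> {0}" "\<phi> ` K \<subseteq> {1}"
    using Urysohn_lemma[of "euclidean :: 'g topology" "- U" K 0 1] assms
    by (metis closed_closedin closed_Compl zero_le_one)
  then show thesis
    by (intro that[of \<phi>]) (auto simp: continuous_map_in_subtopology image_subset_iff)
qed

end

section \<open>Inversion invariance and Baire versions\<close>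

lemma le_zero_if_le_inverse_Suc:
  fixes x :: real
  assumes "\<And>n. x \<le> 1 / Suc n"
  shows "x \<le> 0"
proof (rule ccontr)
  assume "\<not> x \<le> 0"
  then obtain n where "inverse (real (Suc n)) < x" using reals_Archimedean[of x] by auto
  then show False using assms[of n] by (simp add: inverse_eq_divide)
qed

context compact_haar
begin

lemma emeasure_outer:
  "A \<in> sets borel \<Longrightarrow> emeasure M A = (INF U \<in> {U. open U \<and> A \<subseteq> U}. emeasure M U)"
  using haar unfolding normalised_left_haar_def by blast

lemma emeasure_inner:
  "open U \<Longrightarrow> emeasure M U = (SUP K \<in> {K. compact K \<and> K \<subseteq> U}. emeasure M K)"
  using haar unfolding normalised_left_haar_def by blast

lemma uminus_measurable: "uminus \<in> measurable M M"
  by (simp cong: measurable_cong_sets add: borel_measurable_continuous_onI continuous_intros)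

lemma open_uminus: "open U \<Longrightarrow> open (uminus -` U :: 'g set)"
  by (rule open_vimage) (auto intro: continuous_intros)

text \<open>A Urysohn function between a compact \<open>K\<close> and \<open>U\<close> carries the
  invariance from continuous functions to open sets through inner regularity; outer regularity then
  carries it to Borel sets.\<close>

lemma emeasure_le_inverse_open:
  assumes U: "open U"
  shows "emeasure M U \<le> emeasure M (uminus -` U)"
proof (subst emeasure_inner[OF U], rule SUP_least, clarify)
  fix K :: "'g set" assume K: "compact K" "K \<subseteq> U"
  have cK: "closed K" using K compact_imp_closed by auto
  obtain \<phi> :: "'g \<Rightarrow> real" where \<phi>: "continuous_on UNIV \<phi>" "\<And>x. 0 \<le> \<phi> x" "\<And>x. \<phi> x \<le> 1"
    "\<And>x. x \<in> K \<Longrightarrow> \<phi> x = 1" "\<And>x. x \<notin> U \<Longrightarrow> \<phi> x = 0"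
    using urysohn[OF cK U K(2)] by blast
  have c2: "continuous_on UNIV (\<lambda>x. \<phi> (- x))"
    by (intro continuous_on_comp_UNIV[OF \<phi>(1)] continuous_intros)
  have oU: "open (uminus -` U)" using open_uminus U by blast
  have "measure M K = (\<integral>x. indicator K x \<partial>M)" by simp
  also have "\<dots> \<le> (\<integral>x. \<phi> x \<partial>M)"
    by (rule integral_mono)
       (use \<phi> cK in \<open>auto simp: emeasure_eq_measure split: split_indicator\<close>)
  also have "\<dots> = (\<integral>x. \<phi> (- x) \<partial>M)"
  proof -
    have "complex_of_real (\<integral>x. \<phi> (- x) \<partial>M) = complex_of_real (\<integral>x. \<phi> x \<partial>M)"
      using integral_inverse_cont[of "\<lambda>x. of_real (\<phi> x)"] \<phi>(1)
      by (simp add: continuous_intros)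
    then show ?thesis by (simp only: of_real_eq_iff)
  qed
  also have "\<dots> \<le> (\<integral>x. indicator (uminus -` U) x \<partial>M)"
    by (rule integral_mono)
       (use \<phi> oU c2 in \<open>auto simp: emeasure_eq_measure split: split_indicator\<close>)
  also have "\<dots> = measure M (uminus -` U)" by simp
  finally show "emeasure M K \<le> emeasure M (uminus -` U)" by (simp add: emeasure_eq_measure)
qed

lemma emeasure_inverse_open:
  assumes U: "open U"
  shows "emeasure M (uminus -` U) = emeasure M U"
  using emeasure_le_inverse_open[OF U] emeasure_le_inverse_open[OF open_uminus[OF U]]
  by (simp add: vimage_comp o_def)

lemma emeasure_inverse_le:
  assumes A: "A \<in> sets borel"
  shows "emeasure M (uminus -` A) \<le> emeasure M A"
proof (subst emeasure_outer[OF A], rule INF_greatest, clarify)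
  fix U :: "'g set" assume "open U" "A \<subseteq> U"
  then show "emeasure M (uminus -` A) \<le> emeasure M U"
    using emeasure_mono[of "uminus -` A" "uminus -` U" M] emeasure_inverse_open open_uminus
    by (auto simp: vimage_mono)
qed

lemma inverse_distr: "distr M M uminus = M"
proof (rule measure_eqI)
  fix A assume "A \<in> sets (distr M M uminus)"
  then have A: "A \<in> sets borel" by simp
  have A': "uminus -` A \<in> sets borel"
    using measurable_sets[OF uminus_measurable, of A] A by simp
  show "emeasure (distr M M uminus) A = emeasure M A"
    using emeasure_inverse_le[OF A] emeasure_inverse_le[OF A'] A uminus_measurable
    by (simp add: emeasure_distr vimage_comp o_def)
qed simp

lemma integral_inverse:
  fixes f :: "'g \<Rightarrow> 'b::{banach,second_countable_topology}"
  assumes "f \<in> borel_measurable borel"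
  shows "(\<integral>x. f (- x) \<partial>M) = (\<integral>x. f x \<partial>M)"
  using integral_distr[OF uminus_measurable, of f] assms by (simp add: inverse_distr)

lemma reflect_distr: "distr M M (\<lambda>y. x - y) = M"
proof -
  have "distr M M (\<lambda>y. x - y) = distr (distr M M uminus) M (\<lambda>y. x + y)"
    by (subst distr_distr) (auto intro: translate_measurable uminus_measurable simp: o_def)
  then show ?thesis by (simp add: inverse_distr translate_distr)
qed

lemma reflect_measurable: "(\<lambda>y. x - y) \<in> measurable M M"
  by (simp cong: measurable_cong_sets add: borel_measurable_continuous_onI continuous_intros)

lemma integral_reflect:
  fixes f :: "'g \<Rightarrow> 'b::{banach,second_countable_topology}"
  assumes "f \<in> borel_measurable borel"
  shows "(\<integral>y. f (x - y) \<partial>M) = (\<integral>x. f x \<partial>M)"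
  using integral_distr[OF reflect_measurable, of f] assms by (simp add: reflect_distr)

lemma measurable_cont_comp:
  fixes f :: "'g \<Rightarrow> 'b::topological_space"
  shows "f \<in> borel_measurable borel \<Longrightarrow> continuous_on UNIV g \<Longrightarrow> (\<lambda>x. f (g x)) \<in> borel_measurable (borel :: 'g measure)"
  using measurable_compose[of g borel borel f borel] borel_measurable_continuous_onI by blast

lemma integral_right:
  fixes f :: "'g \<Rightarrow> 'b::{banach,second_countable_topology}"
  assumes "f \<in> borel_measurable borel"
  shows "(\<integral>x. f (x + g) \<partial>M) = (\<integral>x. f x \<partial>M)"
proof -
  have m: "(\<lambda>x. f (x + g)) \<in> borel_measurable borel" "(\<lambda>x. f (- x)) \<in> borel_measurable borel"
    by (intro measurable_cont_comp[OF assms] continuous_intros)+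
  have "(\<integral>x. f (x + g) \<partial>M) = (\<integral>x. f (- (- g + x)) \<partial>M)"
    using integral_inverse[OF m(1)] by (simp add: minus_add)
  then show ?thesis
    using integral_left[OF m(2), of "- g"] integral_inverse[OF assms] by simp
qed

text \<open>
  If \<open>G\<close> is not second countable, then \<open>f (- y + x)\<close> need not be measurable for the product
  \<open>\<sigma>\<close>-algebra when \<open>f\<close> is Borel. It is when \<open>f\<close> is Baire, so Fubini is applied to Baire versions.
\<close>

definition baire :: "'g measure" where
  "baire = sigma UNIV {f -` V | (f :: 'g \<Rightarrow> real) V. continuous_on UNIV f \<and> open V}"

lemma space_baire [simp]: "space baire = UNIV"
  by (simp add: baire_def space_measure_of_conv)

lemma sets_baire_gen: "continuous_on UNIV (f::'g \<Rightarrow> real) \<Longrightarrow> open V \<Longrightarrow> f -` V \<in> sets baire"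
  unfolding baire_def by (subst sets_measure_of) auto

lemma baire_le: "A \<in> sets baire \<Longrightarrow> A \<in> sets borel"
proof -
  have "sets baire \<subseteq> sets borel"
    unfolding baire_def
    by (subst sets_measure_of, simp, rule sets.sigma_sets_subset'[of _ borel, simplified])
       (auto simp: open_vimage)
  then show "A \<in> sets baire \<Longrightarrow> A \<in> sets borel" by auto
qed

text \<open>The generators of the Baire sets are preimages under real continuous functions, and
  composing such a function with \<open>F\<close> gives one covered by
  \<open>cont_pair_measurable_real\<close>.\<close>

lemma baire_measurable_comp:
  assumes F: "continuous_on UNIV (F :: 'g \<times> 'g \<Rightarrow> 'g)"
  shows "F \<in> measurable (M \<Otimes>\<^sub>M M) baire"
  unfolding baire_def
proof (rule measurable_sigma_sets)
  fix A assume "A \<in> {f -` V | (f :: 'g \<Rightarrow> real) V. continuous_on UNIV f \<and> open V}"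
  then obtain f :: "'g \<Rightarrow> real" and V where f: "continuous_on UNIV f" "open V" "A = f -` V" by blast
  have "(\<lambda>p. f (F p)) \<in> borel_measurable (M \<Otimes>\<^sub>M M)"
    by (intro cont_pair_measurable_real continuous_on_comp_UNIV[OF f(1)] F)
  then have "(\<lambda>p. f (F p)) -` V \<inter> space (M \<Otimes>\<^sub>M M) \<in> sets (M \<Otimes>\<^sub>M M)"
    using f by (intro measurable_sets) auto
  then show "F -` A \<inter> space (M \<Otimes>\<^sub>M M) \<in> sets (M \<Otimes>\<^sub>M M)"
    using f(3) by (simp add: vimage_def)
qed (auto simp: baire_def)

text \<open>Inner regularity gives a compact \<open>K\<close> of nearly full measure in
  \<open>U\<close>. The set where a Urysohn function for \<open>K\<close> and \<open>U\<close> is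
  positive is a Baire set between the two; the union over the errors \<open>1 / Suc n\<close> misses
  only a null set.\<close>

lemma open_baire_approx:
  assumes U: "open U"
  obtains B where "B \<in> sets baire" "B \<subseteq> U" "emeasure M (U - B) = 0"
proof -
  have "\<exists>B. B \<in> sets baire \<and> B \<subseteq> U \<and> measure M (U - B) \<le> 1 / Suc n" for n
  proof (cases "measure M U = 0")
    case True
    then show ?thesis by (intro exI[of _ "{}"]) auto
  next
    case False
    then have "measure M U > 0" by (simp add: zero_less_measure_iff)
    then have "ennreal (measure M U - 1 / Suc n) < emeasure M U"
      unfolding emeasure_eq_measure by (rule ennreal_lessI) simp
    then obtain K where K: "compact K" "K \<subseteq> U" "ennreal (measure M U - 1 / Suc n) < emeasure M K"
      unfolding emeasure_inner[OF U] less_SUP_iff by blast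
    have K3: "measure M U - 1 / Suc n \<le> measure M K"
      using K(3) by (metis emeasure_eq_measure ennreal_le_iff less_imp_le measure_nonneg)
    have cK: "closed K" using K compact_imp_closed by auto
    obtain \<phi> :: "'g \<Rightarrow> real" where \<phi>: "continuous_on UNIV \<phi>" "\<And>x. 0 \<le> \<phi> x" "\<And>x. \<phi> x \<le> 1"
      "\<And>x. x \<in> K \<Longrightarrow> \<phi> x = 1" "\<And>x. x \<notin> U \<Longrightarrow> \<phi> x = 0"
      using urysohn[OF cK U K(2)] by blast
    define B where "B = \<phi> -` {0<..}"
    have B: "B \<in> sets baire" "B \<subseteq> U" "K \<subseteq> B"
      using \<phi>(1,4) by (auto simp: B_def intro!: sets_baire_gen) (metis \<phi>(5) less_irrefl)
    have "measure M (U - B) = measure M U - measure M B"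
      using B U baire_le by (intro finite_measure_Diff) auto
    also have "\<dots> \<le> measure M U - measure M K"
      using B cK baire_le by (simp add: finite_measure_mono)
    also have "\<dots> \<le> 1 / Suc n"
      using K3 by simp
    finally show ?thesis using B by blast
  qed
  then obtain B where B: "\<And>n. B n \<in> sets baire" "\<And>n. B n \<subseteq> U" "\<And>n. measure M (U - B n) \<le> 1 / Suc n"
    by metis
  define C where "C = (\<Union>n. B n)"
  have C: "C \<in> sets baire" "C \<subseteq> U" using B by (auto simp: C_def)
  have "measure M (U - C) \<le> 1 / Suc n" for n
  proof -
    have "measure M (U - C) \<le> measure M (U - B n)"
      using U B(1) C baire_le by (intro finite_measure_mono) (auto simp: C_def)
    then show ?thesis using B(3)[of n] by simp
  qed
  then have "measure M (U - C) \<le> 0"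
    by (rule le_zero_if_le_inverse_Suc)
  then show thesis using that[OF C] by (simp add: emeasure_eq_measure measure_le_0_iff)
qed

text \<open>Up to null sets, \<open>A\<close> is the intersection of open sets given by outer
  regularity, and each of these is a Baire subset of itself. \<open>N\<close> collects both kinds of
  error.\<close>

lemma borel_baire_approx:
  assumes A: "A \<in> sets borel"
  obtains B N where "B \<in> sets baire" "N \<in> null_sets M" "A - B \<subseteq> N" "B - A \<subseteq> N"
proof -
  have "\<exists>U. open U \<and> A \<subseteq> U \<and> measure M (U - A) \<le> 1 / Suc n" for n
  proof -
    have "\<exists>U\<in>{U. open U \<and> A \<subseteq> U}. emeasure M U < emeasure M A + ennreal (1 / Suc n)"
    proof -
      have "emeasure M A < emeasure M A + ennreal (1 / Suc n)"
        by (simp add: emeasure_eq_measure ennreal_less_iff flip: ennreal_plus)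
      then have "(INF U \<in> {U. open U \<and> A \<subseteq> U}. emeasure M U) < emeasure M A + ennreal (1 / Suc n)"
        by (simp only: emeasure_outer[OF A, symmetric])
      then show ?thesis by (rule INF_less_iff[THEN iffD1])
    qed
    then obtain U where U: "open U" "A \<subseteq> U" "emeasure M U < emeasure M A + ennreal (1 / Suc n)"
      by blast
    have "measure M (U - A) = measure M U - measure M A"
      using U A by (intro finite_measure_Diff) auto
    also have "\<dots> \<le> 1 / Suc n"
      using U(3) by (simp add: emeasure_eq_measure ennreal_less_iff flip: ennreal_plus)
    finally show ?thesis using U by blast
  qed
  then obtain U where U: "\<And>n. open (U n)" "\<And>n. A \<subseteq> U n" "\<And>n. measure M (U n - A) \<le> 1 / Suc n"
    by metis
  have "\<exists>B. B \<in> sets baire \<and> B \<subseteq> U n \<and> emeasure M (U n - B) = 0" for n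
    using open_baire_approx[OF U(1)] by metis
  then obtain B where B: "\<And>n. B n \<in> sets baire" "\<And>n. B n \<subseteq> U n" "\<And>n. emeasure M (U n - B n) = 0"
    by metis
  define N where "N = (\<Union>n. U n - B n) \<union> ((\<Inter>n. U n) - A)"
  have "measure M ((\<Inter>n. U n) - A) \<le> 1 / Suc n" for n
  proof -
    have "measure M ((\<Inter>n. U n) - A) \<le> measure M (U n - A)"
      using U A by (intro finite_measure_mono) auto
    then show ?thesis using U(3)[of n] by simp
  qed
  then have "measure M ((\<Inter>n. U n) - A) \<le> 0"
    by (rule le_zero_if_le_inverse_Suc)
  then have "(\<Inter>n. U n) - A \<in> null_sets M"
    using U A by (auto simp: null_sets_def emeasure_eq_measure measure_le_0_iff intro!: sets.Diff sets.countable_INT)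
  moreover have "(\<Union>n. U n - B n) \<in> null_sets M"
    using U B baire_le by (intro null_sets_UN) (auto simp: null_sets_def)
  ultimately have "N \<in> null_sets M" by (auto simp: N_def)
  moreover have "(\<Inter>n. B n) \<in> sets baire" using B by (intro sets.countable_INT) auto
  moreover have "A - (\<Inter>n. B n) \<subseteq> N" "(\<Inter>n. B n) - A \<subseteq> N"
    unfolding N_def using U(2) B(2) by blast+
  ultimately show thesis using that by blast
qed

lemma baire_version_ennreal:
  fixes f :: "'g \<Rightarrow> ennreal"
  assumes "f \<in> borel_measurable borel"
  shows "\<exists>f' \<in> borel_measurable baire. AE x in M. f x = f' x"
  using assms
proof (induction rule: borel_measurable_induct)
  case (cong f g)
  then show ?case by simp
next
  case (set A)
  then obtain B N where B: "B \<in> sets baire" "N \<in> null_sets M" "A - B \<subseteq> N" "B - A \<subseteq> N"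
    using borel_baire_approx by metis
  have "AE x in M. indicator A x = (indicator B x :: ennreal)"
    using AE_not_in[OF B(2)] by eventually_elim (use B(3,4) in \<open>auto simp: indicator_def\<close>)
  then show ?case using B(1) by (intro bexI[of _ "indicator B"]) auto
next
  case (mult u c)
  then obtain u' where "u' \<in> borel_measurable baire" "AE x in M. u x = u' x" by blast
  then show ?case by (intro bexI[of _ "\<lambda>x. c * u' x"]) auto
next
  case (add u v)
  then obtain u' v' where "u' \<in> borel_measurable baire" "AE x in M. u x = u' x"
    "v' \<in> borel_measurable baire" "AE x in M. v x = v' x" by blast
  then show ?case by (intro bexI[of _ "\<lambda>x. v' x + u' x"]) auto
next
  case (seq U)
  then obtain U' where U': "\<And>i. U' i \<in> borel_measurable baire" "\<And>i. AE x in M. U i x = U' i x"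
    by metis
  have "AE x in M. \<forall>i. U i x = U' i x" using U'(2) by (simp add: AE_all_countable)
  then have "AE x in M. (SUP i. U i) x = (SUP i. U' i x)"
    by eventually_elim (simp add: image_image)
  then show ?case using U'(1) by (intro bexI[of _ "\<lambda>x. SUP i. U' i x"]) auto
qed

lemma baire_version_real:
  fixes f :: "'g \<Rightarrow> real"
  assumes "f \<in> borel_measurable borel"
  obtains f' where "f' \<in> borel_measurable baire" "AE x in M. f x = f' x"
proof -
  obtain p q where pq: "p \<in> borel_measurable baire" "AE x in M. ennreal (f x) = p x"
    "q \<in> borel_measurable baire" "AE x in M. ennreal (- f x) = q x"
    using baire_version_ennreal[of "\<lambda>x. ennreal (f x)"] baire_version_ennreal[of "\<lambda>x. ennreal (- f x)"] assms
    by auto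
  have "AE x in M. f x = enn2real (p x) - enn2real (q x)"
    using pq(2,4)
  proof eventually_elim
    case (elim x)
    show ?case unfolding elim[symmetric] by (cases "f x \<ge> 0") (simp_all add: ennreal_neg)
  qed
  then show thesis using pq(1,3) by (intro that) auto
qed

lemma baire_version:
  fixes f :: "'g \<Rightarrow> complex"
  assumes "f \<in> borel_measurable borel"
  obtains f' where "f' \<in> borel_measurable baire" "AE x in M. f x = f' x"
proof -
  have m: "(\<lambda>x. Re (f x)) \<in> borel_measurable borel" "(\<lambda>x. Im (f x)) \<in> borel_measurable borel"
    using assms by (auto simp: borel_measurable_complex_iff)
  obtain p where p: "p \<in> borel_measurable baire" "AE x in M. Re (f x) = p x"
    by (rule baire_version_real[OF m(1)])
  obtain q where q: "q \<in> borel_measurable baire" "AE x in M. Im (f x) = q x"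
    by (rule baire_version_real[OF m(2)])
  note pq = p q
  have "AE x in M. f x = Complex (p x) (q x)"
    using pq(2,4) by eventually_elim (simp add: complex_eq_iff)
  then show thesis using pq(1,3) by (intro that) (auto simp: borel_measurable_complex_iff)
qed

end

section \<open>Convolution of integrable functions\<close>

context compact_haar
begin

lemma antitranslate_measurable: "(\<lambda>y. - y + x) \<in> measurable M M"
  by (simp cong: measurable_cong_sets add: borel_measurable_continuous_onI continuous_intros)

lemma antitranslate_distr: "distr M M (\<lambda>y. - y + x) = M"
proof -
  have "distr M M (\<lambda>y. - y + x) = distr (distr M M (\<lambda>y. - x + y)) M uminus"
    by (subst distr_distr) (auto intro: translate_measurable uminus_measurable simp: o_def minus_add)
  then show ?thesis by (simp add: inverse_distr translate_distr)
qed

lemma baire_borel_measurable: "f \<in> borel_measurable baire \<Longrightarrow> f \<in> borel_measurable borel"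
  using measurable_from_subalg[of M baire f borel] baire_le by (auto simp: subalgebra_def)

lemma integrable_left:
  fixes f :: "'g \<Rightarrow> 'b::{banach,second_countable_topology}"
  assumes "integrable M f"
  shows "integrable M (\<lambda>x. f (g + x))"
  using integrable_distr[OF translate_measurable[of g], of f] assms by (simp add: translate_distr)

text \<open>Everything is Fubini for \<open>c y * d (- y + x)\<close>, carried out on Baire versions
  \<open>c'\<close> and \<open>d'\<close>. From \<open>conv_pairing\<close> both associativity and
  the multiplicativity of coefficients are read off later.\<close>

lemma
  fixes c d :: "'g \<Rightarrow> complex"
  assumes c: "integrable M c" and d: "integrable M d"
  shows conv_integrable: "integrable M (conv M c d)"
    and conv_norm_le: "L1norm M (conv M c d) \<le> L1norm M c * L1norm M d"
    and conv_pairing: "continuous_on UNIV h \<Longrightarrow>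
      (\<integral>x. conv M c d x * h x \<partial>M) = (\<integral>y. c y * (\<integral>x. d x * h (y + x) \<partial>M) \<partial>M)"
proof -
  have mcd: "c \<in> borel_measurable borel" "d \<in> borel_measurable borel"
    using c d borel_measurable_integrable by fastforce+
  obtain c' where c': "c' \<in> borel_measurable baire" "AE x in M. c x = c' x" using baire_version mcd by blast
  obtain d' where d': "d' \<in> borel_measurable baire" "AE x in M. d x = d' x" using baire_version mcd by blast
  have m': "c' \<in> borel_measurable borel" "d' \<in> borel_measurable borel"
    using c' d' baire_borel_measurable by auto
  have i': "integrable M c'" "integrable M d'"
    using c d c' d' m' mcd by (auto cong: integrable_cong_AE)
  have L: "L1norm M c' = L1norm M c" "L1norm M d' = L1norm M d"
    unfolding L1norm_def using c'(2) d'(2) m' mcd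
    by (auto intro!: integral_cong_AE)
  \<comment> \<open>For each fixed \<open>x\<close> the map \<open>y \<mapsto> - y + x\<close>
    preserves \<open>M\<close>, so the exceptional set stays null; hence \<open>eq\<close> holds at
    every \<open>x\<close>, not just almost everywhere.\<close>
  have ae: "AE y in M. d (- y + x) = d' (- y + x)" for x
  proof -
    have "AE z in distr M M (\<lambda>y. - y + x). d z = d' z"
      unfolding antitranslate_distr by (rule d'(2))
    then show ?thesis
      using AE_distrD[OF antitranslate_measurable] by blast
  qed
  have ccont: "continuous_on UNIV (\<lambda>y. - y + x :: 'g)" for x by (intro continuous_intros)
  have eq: "conv M c d x = (\<integral>y. c' y * d' (- y + x) \<partial>M)" for x
    unfolding conv_def
  proof (rule integral_cong_AE)
    show "AE y in M. c y * d (- y + x) = c' y * d' (- y + x)"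
      using c'(2) ae[of x] by eventually_elim simp
  qed (use m' mcd measurable_cont_comp[OF _ ccont] in \<open>auto intro!: borel_measurable_times\<close>)
  have mp: "(\<lambda>p. c' (fst p) * d' (- fst p + snd p)) \<in> borel_measurable (M \<Otimes>\<^sub>M M)"
    by (intro borel_measurable_times measurable_compose[OF baire_measurable_comp c'(1)]
      measurable_compose[OF baire_measurable_comp d'(1)] continuous_intros)
  have id: "integrable M (\<lambda>x. d' (- y + x))" for y
    using integrable_left[OF i'(2)] by blast
  have nd: "(\<integral>x. norm (d' (- y + x)) \<partial>M) = L1norm M d" for y
    using integral_left[of "\<lambda>x. norm (d' x)" "- y"] m' L by (simp add: L1norm_def)
  have ip: "integrable (M \<Otimes>\<^sub>M M) (\<lambda>p. c' (fst p) * d' (- fst p + snd p))"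
    by (rule PM.Fubini_integrable[OF mp]) (use i' id nd in \<open>auto simp: norm_mult\<close>)
  then have ip': "integrable (M \<Otimes>\<^sub>M M) (\<lambda>(y,x). c' y * d' (- y + x))"
    by (simp add: case_prod_unfold)
  have i1: "integrable M (\<lambda>x. \<integral>y. c' y * d' (- y + x) \<partial>M)"
    using PM.integrable_snd[OF ip'] by simp
  then show "integrable M (conv M c d)" by (simp add: eq[abs_def])
  have ipn: "integrable (M \<Otimes>\<^sub>M M) (\<lambda>(y,x). norm (c' y * d' (- y + x)))"
    using integrable_norm[OF ip'] by (simp add: case_prod_unfold)
  have "L1norm M (conv M c d) \<le> (\<integral>x. (\<integral>y. norm (c' y * d' (- y + x)) \<partial>M) \<partial>M)"
    unfolding L1norm_def eq
    by (rule integral_mono) (use i1 PM.integrable_snd[OF ipn] integral_norm_bound in auto)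
  also have "\<dots> = (\<integral>y. (\<integral>x. norm (c' y * d' (- y + x)) \<partial>M) \<partial>M)"
    using PM.Fubini_integral[OF ipn] by simp
  also have "\<dots> = L1norm M c * L1norm M d"
    using L by (simp add: norm_mult nd) (simp add: L1norm_def)
  finally show "L1norm M (conv M c d) \<le> L1norm M c * L1norm M d" .
  assume h: "continuous_on UNIV h"
  obtain B where B: "\<And>x. norm (h x) \<le> B" using cont_bounded[OF h] by blast
  have iph: "integrable (M \<Otimes>\<^sub>M M) (\<lambda>(y,x). c' y * d' (- y + x) * h x)"
  proof (rule Bochner_Integration.integrable_bound[of _ "\<lambda>p. B * norm (c' (fst p) * d' (- fst p + snd p))"])
    show "integrable (M \<Otimes>\<^sub>M M) (\<lambda>p. B * norm (c' (fst p) * d' (- fst p + snd p)))"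
      using integrable_norm[OF ip] by simp
    have "(\<lambda>p. h (snd p)) \<in> borel_measurable (M \<Otimes>\<^sub>M M)"
      by (intro cont_pair_measurable continuous_on_comp_UNIV[OF h] continuous_intros)
    then show "(\<lambda>(y,x). c' y * d' (- y + x) * h x) \<in> borel_measurable (M \<Otimes>\<^sub>M M)"
      unfolding case_prod_unfold by (intro borel_measurable_times mp)
    show "AE p in M \<Otimes>\<^sub>M M. norm (case p of (y,x) \<Rightarrow> c' y * d' (- y + x) * h x)
        \<le> norm (B * norm (c' (fst p) * d' (- fst p + snd p)))"
    proof (rule AE_I2, clarify)
      fix y x
      have "norm (c' y * d' (- y + x)) * norm (h x) \<le> norm (c' y * d' (- y + x)) * \<bar>B\<bar>"
        by (rule mult_left_mono) (use B[of x] in auto)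
      then show "norm (c' y * d' (- y + x) * h x) \<le> norm (B * norm (c' (fst (y,x)) * d' (- fst (y,x) + snd (y,x))))"
        by (simp add: norm_mult abs_mult algebra_simps)
    qed
  qed
  have "(\<integral>x. conv M c d x * h x \<partial>M) = (\<integral>x. (\<integral>y. c' y * d' (- y + x) * h x \<partial>M) \<partial>M)"
    by (simp add: eq)
  also have "\<dots> = (\<integral>y. (\<integral>x. c' y * d' (- y + x) * h x \<partial>M) \<partial>M)"
    using PM.Fubini_integral[OF iph] by simp
  also have "\<dots> = (\<integral>y. c' y * (\<integral>x. d' (- y + x) * h x \<partial>M) \<partial>M)"
    by (simp add: mult.assoc)
  also have "\<dots> = (\<integral>y. c' y * (\<integral>x. d' x * h (y + x) \<partial>M) \<partial>M)"
  proof (rule Bochner_Integration.integral_cong[OF refl])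
    fix y
    have "(\<lambda>x. d' (- y + x) * h x) \<in> borel_measurable borel"
      using cont_measurable[OF h] measurable_cont_comp[OF m'(2) cont_translate] by simp
    then show "c' y * (\<integral>x. d' (- y + x) * h x \<partial>M) = c' y * (\<integral>x. d' x * h (y + x) \<partial>M)"
      using integral_left[of "\<lambda>x. d' (- y + x) * h x" y] by simp
  qed
  also have "\<dots> = (\<integral>y. c' y * (\<integral>x. d x * h (y + x) \<partial>M) \<partial>M)"
  proof -
    have "(\<integral>x. d' x * h (y + x) \<partial>M) = (\<integral>x. d x * h (y + x) \<partial>M)" for y
    proof (rule integral_cong_AE)
      have "(\<lambda>x. h (y + x)) \<in> borel_measurable borel"
        using cont_measurable[OF h] by (intro measurable_cont_comp[OF _ cont_translate]) simp
      then show "(\<lambda>x. d' x * h (y + x)) \<in> borel_measurable M" "(\<lambda>x. d x * h (y + x)) \<in> borel_measurable M"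
        using m' mcd by auto
      show "AE x in M. d' x * h (y + x) = d x * h (y + x)"
        using d'(2) by eventually_elim simp
    qed
    then show ?thesis by simp
  qed
  also have "\<dots> = (\<integral>y. c y * (\<integral>x. d x * h (y + x) \<partial>M) \<partial>M)"
  proof (rule integral_cong_AE)
    have "continuous_on UNIV (\<lambda>y. \<integral>x. d x * h (y + x) \<partial>M)"
      using weighted_param_cont[OF d, of "\<lambda>(x,y). h (y + x)"]
      by (simp add: case_prod_unfold continuous_on_comp_UNIV[OF h] continuous_intros)
    then have "(\<lambda>y. \<integral>x. d x * h (y + x) \<partial>M) \<in> borel_measurable borel"
      using cont_measurable by simp
    then show "(\<lambda>y. c' y * (\<integral>x. d x * h (y + x) \<partial>M)) \<in> borel_measurable M"
      "(\<lambda>y. c y * (\<integral>x. d x * h (y + x) \<partial>M)) \<in> borel_measurable M"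
      using m' mcd by auto
    show "AE y in M. c' y * (\<integral>x. d x * h (y + x) \<partial>M) = c y * (\<integral>x. d x * h (y + x) \<partial>M)"
      using c'(2) by eventually_elim simp
  qed
  finally show "(\<integral>x. conv M c d x * h x \<partial>M) = (\<integral>y. c y * (\<integral>x. d x * h (y + x) \<partial>M) \<partial>M)" .
qed

text \<open>The identity is conjugation invariance written without inverses. These functions lie in
  \<open>ZL1 M\<close> (see \<open>class_fun_ZL1\<close>) and form the algebra in which idempotents
  are sought.\<close>

definition class_fun :: "('g \<Rightarrow> complex) \<Rightarrow> bool" where
  "class_fun f \<longleftrightarrow> continuous_on UNIV f \<and> (\<forall>x y. f (x + y) = f (y + x))"

lemma class_fun_cont: "class_fun f \<Longrightarrow> continuous_on A f"
  using continuous_on_subset class_fun_def by blast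

lemma class_fun_comm: "class_fun f \<Longrightarrow> f (x + y) = f (y + x)"
  by (simp add: class_fun_def)

lemma class_fun_integrable: "class_fun f \<Longrightarrow> integrable M f"
  by (simp add: class_fun_cont cont_integrable)

lemma integrable_borel_measurable: "integrable M f \<Longrightarrow> f \<in> borel_measurable borel"
  using borel_measurable_integrable[of M f] by simp

lemma conv_cont:
  assumes "integrable M f" "continuous_on UNIV h"
  shows "continuous_on UNIV (conv M f h)"
proof -
  have "continuous_on UNIV (\<lambda>p::'g \<times> 'g. h (- fst p + snd p))"
    by (intro continuous_on_comp_UNIV[OF assms(2)] continuous_intros)
  from weighted_param_cont[OF assms(1) this] show ?thesis by (simp add: conv_def[abs_def])
qed

lemma conv_cont_left:
  assumes f: "integrable M f" and h: "continuous_on UNIV h"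
  shows "conv M h f x = (\<integral>y. f y * h (x - y) \<partial>M)"
proof -
  have "(\<lambda>y. h y * f (- y + x)) \<in> borel_measurable borel"
    using cont_measurable[OF h] measurable_cont_comp[OF integrable_borel_measurable[OF f], of "\<lambda>y. - y + x"]
    by (simp add: continuous_intros)
  from integral_reflect[OF this, of x] show ?thesis
    by (simp add: conv_def mult.commute minus_diff_eq)
qed

lemma conv_class_comm:
  assumes f: "integrable M f" and h: "class_fun h"
  shows "conv M h f = conv M f h"
proof
  fix x
  have "h (x - y) = h (- y + x)" for y
    using class_fun_comm[OF h, of x "- y"] by simp
  then show "conv M h f x = conv M f h x"
    using conv_cont_left[OF f class_fun_cont[OF h]] by (simp add: conv_def)
qed

lemma class_fun_ZL1: "class_fun h \<Longrightarrow> h \<in> ZL1 M"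
  unfolding ZL1_def using class_fun_integrable conv_class_comm by auto

lemma ZL1_integrable: "f \<in> ZL1 M \<Longrightarrow> integrable M f"
  by (simp add: ZL1_def)

text \<open>An element of \<open>ZL1 M\<close> matters only up to null sets, so its conjugation
  invariance is expressed by pairing with a continuous \<open>k\<close>. Both convolutions of
  \<open>f\<close> with \<open>h\<close> are continuous, so their a.e. equality may be evaluated at
  the point \<open>x\<close>.\<close>

lemma ZL1_conj_invariant:
  assumes f: "f \<in> ZL1 M" and k: "continuous_on UNIV k"
  shows "(\<integral>y. f y * k (x + y - x) \<partial>M) = (\<integral>y. f y * k y \<partial>M)"
proof -
  \<comment> \<open>With this choice \<open>conv M f h x\<close> integrates
    \<open>f y * k y\<close>, and \<open>conv M h f x\<close> integrates
    \<open>f y * k (x + y - x)\<close>.\<close>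
  define h where "h = (\<lambda>z. k (x - z))"
  have h: "continuous_on UNIV h"
    unfolding h_def by (intro continuous_on_comp_UNIV[OF k] continuous_intros)
  have fi: "integrable M f" using f ZL1_integrable by blast
  have "continuous_on UNIV (conv M h f)"
  proof -
    have "continuous_on UNIV (\<lambda>p::'g \<times> 'g. h (snd p - fst p))"
      by (intro continuous_on_comp_UNIV[OF h] continuous_intros)
    from weighted_param_cont[OF fi this] show ?thesis
      by (simp add: conv_cont_left[OF fi h, abs_def])
  qed
  moreover have "AE x in M. conv M f h x = conv M h f x"
    using f h unfolding ZL1_def by blast
  ultimately have "conv M f h x = conv M h f x"
    using cont_AE_eq conv_cont[OF fi h] by blast
  then show ?thesis
    unfolding conv_cont_left[OF fi h]
    by (simp add: conv_def h_def diff_conv_add_uminus minus_add add.assoc del: add_uminus_conv_diff)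
qed

lemma ZL1_class_average:
  assumes f: "f \<in> ZL1 M" and k: "continuous_on UNIV k"
  shows "(\<integral>y. f y * (\<integral>t. k (t + y - t) \<partial>M) \<partial>M) = (\<integral>y. f y * k y \<partial>M)"
proof -
  have c: "continuous_on UNIV (\<lambda>p::'g \<times> 'g. k (snd p + fst p - snd p))"
    by (intro continuous_on_comp_UNIV[OF k] continuous_intros)
  show ?thesis
    using weighted_fubini[OF ZL1_integrable[OF f] c] ZL1_conj_invariant[OF f k] by simp
qed

end

section \<open>The convolution algebra of continuous class functions\<close>

context compact_haar
begin

lemma class_fun_const: "class_fun (\<lambda>x. c)" by (simp add: class_fun_def)
lemma class_fun_add: "class_fun f \<Longrightarrow> class_fun g \<Longrightarrow> class_fun (\<lambda>x. f x + g x)"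
  by (auto simp: class_fun_def intro!: continuous_intros)
lemma class_fun_diff: "class_fun f \<Longrightarrow> class_fun g \<Longrightarrow> class_fun (\<lambda>x. f x - g x)"
  by (auto simp: class_fun_def intro!: continuous_intros)
lemma class_fun_scale: "class_fun f \<Longrightarrow> class_fun (\<lambda>x. c * f x)"
  by (auto simp: class_fun_def intro!: continuous_intros)
lemma class_fun_sum: "(\<And>i. i \<in> S \<Longrightarrow> class_fun (f i)) \<Longrightarrow> class_fun (\<lambda>x. \<Sum>i\<in>S. f i x)"
  by (auto simp: class_fun_def intro!: continuous_intros sum.cong)

definition star :: "('g \<Rightarrow> complex) \<Rightarrow> 'g \<Rightarrow> complex" where
  "star f = (\<lambda>x. cnj (f (- x)))"

lemma star_star [simp]: "star (star f) = f" by (simp add: star_def)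

lemma class_fun_star: "class_fun f \<Longrightarrow> class_fun (star f)"
  unfolding star_def class_fun_def
proof (intro conjI allI; elim conjE)
  assume f: "continuous_on UNIV f" "\<forall>x y. f (x + y) = f (y + x)"
  show "continuous_on UNIV (\<lambda>x. cnj (f (- x)))"
    by (intro continuous_intros continuous_on_comp_UNIV[OF f(1)])
  show "cnj (f (- (x + y))) = cnj (f (- (y + x)))" for x y
    using f(2)[rule_format, of "- y" "- x"] by (simp add: minus_add)
qed

lemma class_fun_conj:
  assumes "class_fun f" shows "f (t + x - t) = f x"
  using class_fun_comm[OF assms, of "t + x" "- t"] by (simp flip: add.assoc)

lemma integral_conj:
  fixes f :: "'g \<Rightarrow> 'b::{banach,second_countable_topology}"
  assumes "f \<in> borel_measurable borel"
  shows "(\<integral>x. f (g + x - g) \<partial>M) = (\<integral>x. f x \<partial>M)"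
proof -
  have "(\<lambda>x. f (x - g)) \<in> borel_measurable borel"
    by (intro measurable_cont_comp[OF assms] continuous_intros)
  from integral_left[OF this, of g] integral_right[OF assms, of "- g"] show ?thesis by simp
qed

lemma class_fun_conv:
  assumes f: "class_fun f" and h: "class_fun h"
  shows "class_fun (conv M f h)"
  unfolding class_fun_def
proof (intro conjI allI)
  show "continuous_on UNIV (conv M f h)"
    using conv_cont class_fun_integrable f h class_fun_cont by blast
  fix x z
  have "(\<lambda>y. f y * h (- y + (x + z))) \<in> borel_measurable borel"
    by (intro borel_measurable_continuous_onI continuous_intros continuous_on_comp_UNIV[OF class_fun_cont[OF h]] class_fun_cont[OF f])
  from integral_conj[OF this, of x]
  have "conv M f h (x + z) = (\<integral>y. f (x + y - x) * h (- (x + y - x) + (x + z)) \<partial>M)"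
    by (simp add: conv_def)
  also have "\<dots> = (\<integral>y. f y * h (- y + (z + x)) \<partial>M)"
  proof (rule Bochner_Integration.integral_cong[OF refl])
    fix y
    have "h (- (x + y - x) + (x + z)) = h (x + (- y + z))"
      by (simp add: diff_conv_add_uminus minus_add add.assoc del: add_uminus_conv_diff)
    also have "\<dots> = h (- y + (z + x))"
      using class_fun_comm[OF h, of x "- y + z"] by (simp add: add.assoc)
    finally show "f (x + y - x) * h (- (x + y - x) + (x + z)) = f y * h (- y + (z + x))"
      by (simp add: class_fun_conj[OF f])
  qed
  finally show "conv M f h (x + z) = conv M f h (z + x)" by (simp add: conv_def)
qed

lemma conv_assoc:
  assumes f: "integrable M f" and g: "integrable M g" and h: "continuous_on UNIV h"
  shows "conv M (conv M f g) h = conv M f (conv M g h)"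
proof
  fix x
  have c: "continuous_on UNIV (\<lambda>z. h (- z + x))"
    by (intro continuous_on_comp_UNIV[OF h] continuous_intros)
  have "conv M (conv M f g) h x = (\<integral>y. f y * (\<integral>z. g z * h (- (y + z) + x) \<partial>M) \<partial>M)"
    using conv_pairing[OF f g c] by (simp only: conv_def[of M "conv M f g" h])
  also have "\<dots> = (\<integral>y. f y * conv M g h (- y + x) \<partial>M)"
    by (simp add: conv_def minus_add add.assoc diff_conv_add_uminus del: add_uminus_conv_diff)
  also have "\<dots> = conv M f (conv M g h) x" by (simp only: conv_def[of M f "conv M g h"])
  finally show "conv M (conv M f g) h x = conv M f (conv M g h) x" .
qed

lemma conv_integrand:
  fixes f h :: "'g \<Rightarrow> complex"
  assumes "integrable M f" "continuous_on UNIV h"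
  shows "integrable M (\<lambda>y. f y * h (- y + x))"
proof (rule weighted_integrable[OF assms(1)])
  show "continuous_on UNIV (\<lambda>y. h (- y + x))"
    by (intro continuous_on_comp_UNIV[OF assms(2)] continuous_intros)
qed

lemma conv_add_left:
  assumes "integrable M f" "integrable M g" "continuous_on UNIV h"
  shows "conv M (\<lambda>x. f x + g x) h = (\<lambda>x. conv M f h x + conv M g h x)"
  using conv_integrand[OF assms(1,3)] conv_integrand[OF assms(2,3)]
  by (simp add: conv_def ring_distribs)

lemma conv_diff_left:
  assumes "integrable M f" "integrable M g" "continuous_on UNIV h"
  shows "conv M (\<lambda>x. f x - g x) h = (\<lambda>x. conv M f h x - conv M g h x)"
  using conv_integrand[OF assms(1,3)] conv_integrand[OF assms(2,3)]
  by (simp add: conv_def ring_distribs)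

lemma conv_scale_left: "conv M (\<lambda>x. c * f x) h = (\<lambda>x. c * conv M f h x)"
  by (simp add: conv_def mult.assoc)

lemma conv_scale_right: "conv M f (\<lambda>x. c * h x) = (\<lambda>x. c * conv M f h x)"
  by (simp add: conv_def mult.left_commute)

lemma conv_sum_left:
  assumes "\<And>i. i \<in> S \<Longrightarrow> integrable M (f i)" "continuous_on UNIV h"
  shows "conv M (\<lambda>x. \<Sum>i\<in>S. f i x) h = (\<lambda>x. \<Sum>i\<in>S. conv M (f i) h x)"
  using conv_integrand[OF assms(1) assms(2)]
  by (simp add: conv_def sum_distrib_right Bochner_Integration.integral_sum)

lemma conv_comm: "class_fun f \<Longrightarrow> class_fun h \<Longrightarrow> conv M f h = conv M h f"
  using conv_class_comm class_fun_integrable by metis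

lemma conv_class_assoc: "class_fun f \<Longrightarrow> class_fun g \<Longrightarrow> class_fun h \<Longrightarrow>
  conv M (conv M f g) h = conv M f (conv M g h)"
  using conv_assoc class_fun_integrable class_fun_cont by metis

lemma star_conv:
  assumes f: "class_fun f" and h: "class_fun h"
  shows "star (conv M f h) = conv M (star f) (star h)"
proof
  fix x
  have m: "(\<lambda>y. f y * h (- y - x)) \<in> borel_measurable borel"
    unfolding diff_conv_add_uminus
    by (intro borel_measurable_continuous_onI continuous_intros continuous_on_comp_UNIV[OF class_fun_cont[OF h]] class_fun_cont[OF f])
  have "star (conv M f h) x = cnj (\<integral>y. f y * h (- y - x) \<partial>M)"
    by (simp add: star_def conv_def)
  also have "\<dots> = cnj (\<integral>y. f (- y) * h (y - x) \<partial>M)"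
    using integral_inverse[OF m] by simp
  also have "\<dots> = (\<integral>y. cnj (f (- y)) * cnj (h (- x + y)) \<partial>M)"
    using class_fun_comm[OF h, of _ "- x"] by (simp flip: Bochner_Integration.integral_cnj)
  also have "\<dots> = conv M (star f) (star h) x"
    by (simp add: conv_def star_def minus_add)
  finally show "star (conv M f h) x = conv M (star f) (star h) x" .
qed

definition sqnorm :: "('g \<Rightarrow> complex) \<Rightarrow> real" where
  "sqnorm f = (\<integral>x. (norm (f x))\<^sup>2 \<partial>M)"

lemma sqnorm_nonneg: "sqnorm f \<ge> 0" by (simp add: sqnorm_def)

lemma conv_star_0: "conv M f (star g) 0 = (\<integral>y. f y * cnj (g y) \<partial>M)"
  by (simp add: conv_def star_def)

lemma conv_star_self: "conv M f (star f) 0 = of_real (sqnorm f)"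
  unfolding conv_star_0 sqnorm_def
  by (simp add: complex_norm_square[symmetric] flip: integral_complex_of_real)

lemma sqnorm_eq_0:
  assumes "continuous_on UNIV f" "sqnorm f = 0"
  shows "f x = 0"
proof -
  have "continuous_on UNIV (\<lambda>x. (norm (f x))\<^sup>2)" by (intro continuous_intros assms(1))
  from cont_integral_zero[OF this, of x] show ?thesis using assms(2) by (simp add: sqnorm_def)
qed

lemma cauchy_schwarz:
  assumes u: "continuous_on UNIV u" and v: "continuous_on UNIV v"
  shows "(norm (\<integral>x. u x * v x \<partial>M))\<^sup>2 \<le> sqnorm u * sqnorm v"
proof -
  define B where "B = (\<integral>x. norm (u x) * norm (v x) \<partial>M)"
  have B: "norm (\<integral>x. u x * v x \<partial>M) \<le> B"
    unfolding B_def using integral_norm_bound[of M "\<lambda>x. u x * v x"] by (simp add: norm_mult)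
  have q: "0 \<le> sqnorm u - 2 * t * B + t\<^sup>2 * sqnorm v" for t :: real
  proof -
    have "0 \<le> (\<integral>x. (norm (u x) - t * norm (v x))\<^sup>2 \<partial>M)" by simp
    also have "\<dots> = (\<integral>x. (norm (u x))\<^sup>2 - 2 * t * (norm (u x) * norm (v x)) + t\<^sup>2 * (norm (v x))\<^sup>2 \<partial>M)"
      by (simp add: power2_eq_square algebra_simps)
    also have "\<dots> = sqnorm u - 2 * t * B + t\<^sup>2 * sqnorm v"
    proof -
      have i: "integrable M (\<lambda>x. (norm (u x))\<^sup>2)" "integrable M (\<lambda>x. (norm (v x))\<^sup>2)"
        "integrable M (\<lambda>x. norm (u x) * norm (v x))"
        by (intro cont_integrable continuous_intros u v)+
      show ?thesis unfolding sqnorm_def B_def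
        by (subst Bochner_Integration.integral_add Bochner_Integration.integral_diff; (simp add: i)?)+
    qed
    finally show ?thesis .
  qed
  have "B\<^sup>2 \<le> sqnorm u * sqnorm v"
  proof (cases "sqnorm v = 0")
    case True
    then have "v x = 0" for x using sqnorm_eq_0 v by blast
    then show ?thesis by (simp add: B_def sqnorm_def)
  next
    case False
    then have p: "sqnorm v > 0" using sqnorm_nonneg[of v] by simp
    show ?thesis using q[of "B / sqnorm v"] p by (simp add: field_simps power2_eq_square)
  qed
  moreover have "(norm (\<integral>x. u x * v x \<partial>M))\<^sup>2 \<le> B\<^sup>2" using B by (intro power_mono) auto
  ultimately show ?thesis by simp
qed

text \<open>Cauchy-Schwarz, with invariance of \<open>M\<close> under
  \<open>y \<mapsto> - y + x\<close>. One convolution thus upgrades an L2 estimate to a uniform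
  one.\<close>

lemma conv_sup_bound:
  assumes f: "continuous_on UNIV f" and g: "continuous_on UNIV g"
  shows "(norm (conv M f g x))\<^sup>2 \<le> sqnorm f * sqnorm g"
proof -
  have c: "continuous_on UNIV (\<lambda>y. g (- y + x))"
    by (intro continuous_on_comp_UNIV[OF g] continuous_intros)
  have "(\<lambda>z. (norm (g z))\<^sup>2) \<in> borel_measurable M"
    by (intro cont_measurable continuous_intros g)
  then have "sqnorm (\<lambda>y. g (- y + x)) = sqnorm g"
    using integral_distr[OF antitranslate_measurable[of x], of "\<lambda>z. (norm (g z))\<^sup>2"]
    by (simp add: sqnorm_def antitranslate_distr)
  then show ?thesis using cauchy_schwarz[OF f c] by (simp add: conv_def)
qed

lemma sqnorm_conv_le:
  assumes f: "continuous_on UNIV f" and g: "continuous_on UNIV g"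
  shows "sqnorm (conv M f g) \<le> sqnorm f * sqnorm g"
proof -
  have "sqnorm (conv M f g) \<le> (\<integral>x. sqnorm f * sqnorm g \<partial>M)"
    unfolding sqnorm_def[of "conv M f g"]
    by (intro integral_mono cont_integrable continuous_intros conv_cont f g conv_sup_bound)
  then show ?thesis by simp
qed

lemma conv_tendsto:
  assumes u: "\<And>n. continuous_on UNIV (u n)" and e: "continuous_on UNIV e" and h: "continuous_on UNIV h"
    and lim: "uniform_limit UNIV u e sequentially"
  shows "(\<lambda>n. conv M (u n) h x) \<longlonglongrightarrow> conv M e h x"
proof (rule LIMSEQ_I)
  fix r :: real assume "r > 0"
  obtain B where B: "B > 0" "\<And>x. norm (h x) \<le> B" using cont_bounded[OF h] by blast
  define d where "d = r / (2 * B)"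
  have d: "d > 0" using \<open>r > 0\<close> B by (simp add: d_def)
  obtain N where N: "\<And>n y. n \<ge> N \<Longrightarrow> dist (u n y) (e y) < d"
    using uniform_limitD[OF lim d] by (auto simp: eventually_sequentially)
  have "norm (conv M (u n) h x - conv M e h x) < r" if "n \<ge> N" for n
  proof -
    have c: "continuous_on UNIV (\<lambda>y. h (- y + x))"
      by (intro continuous_on_comp_UNIV[OF h] continuous_intros)
    have "conv M (u n) h x - conv M e h x = conv M (\<lambda>y. u n y - e y) h x"
      by (simp add: conv_diff_left cont_integrable u e h)
    also have "norm \<dots> \<le> B * (\<integral>y. norm (u n y - e y) \<partial>M)"
      unfolding conv_def
      by (intro weighted_norm_le cont_integrable continuous_intros u e c B)
    also have "\<dots> \<le> B * (\<integral>y. d \<partial>M)"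
    proof (intro mult_left_mono integral_mono cont_integrable continuous_intros u e)
      show "norm (u n y - e y) \<le> d" for y using N[OF that, of y] by (simp add: dist_norm)
    qed (use B in auto)
    also have "\<dots> = r / 2" using B by (simp add: d_def)
    also have "\<dots> < r" using \<open>r > 0\<close> by simp
    finally show ?thesis .
  qed
  then show "\<exists>no. \<forall>n\<ge>no. norm (conv M (u n) h x - conv M e h x) < r" by blast
qed

end

section \<open>Spectral theory by power iteration\<close>

text \<open>Log-convexity makes the ratios \<open>t (Suc k) / t k\<close> increase to some
  \<open>\<rho>\<close>, so \<open>t k / \<rho> ^ (k + 1)\<close> decreases; submultiplicativity
  bounds the ratios and keeps the quotients at least 1. The exponent \<open>k + 1\<close> fits the
  indexing of \<open>cpow\<close>.\<close>

lemma log_convex_submultiplicative_limit: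
  fixes t :: "nat \<Rightarrow> real"
  assumes pos: "\<And>k. t k > 0" and lc: "\<And>k. (t (Suc k))\<^sup>2 \<le> t k * t (Suc (Suc k))"
    and sm: "\<And>m n. t (m + n + 1) \<le> t m * t n"
  obtains \<rho> s where "\<rho> > 0" "s \<ge> 1" "(\<lambda>k. t k / \<rho> ^ (k + 1)) \<longlonglongrightarrow> s"
proof -
  define r where "r k = t (Suc k) / t k" for k
  have rinc: "incseq r"
  proof (rule incseq_SucI)
    fix k show "r k \<le> r (Suc k)"
      using lc[of k] pos[of k] pos[of "Suc k"] by (simp add: r_def field_simps power2_eq_square)
  qed
  have rb: "r k \<le> t 0" for k using sm[of k 0] pos[of k] by (simp add: r_def field_simps)
  obtain \<rho> where \<rho>: "r \<longlonglongrightarrow> \<rho>" "\<And>k. r k \<le> \<rho>"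
    using incseq_convergent[OF rinc] rb by metis
  have "r 0 > 0" using pos by (simp add: r_def)
  then have \<rho>0: "\<rho> > 0" using \<rho>(2)[of 0] by linarith
  have step: "t (Suc k) = r k * t k" for k using pos[of k] by (simp add: r_def)
  have low: "t m * r m ^ n \<le> t (m + n)" for m n
  proof (induction n)
    case (Suc n)
    have "t m * r m ^ Suc n = r m * (t m * r m ^ n)" by simp
    also have "\<dots> \<le> r (m + n) * t (m + n)"
      using Suc pos[of m] pos[of "Suc m"] rinc pos[of "m+n"] pos[of "Suc (m+n)"]
      by (intro mult_mono) (auto simp: r_def incseq_def)
    finally show ?case using step[of "m + n"] by simp
  qed simp
  \<comment> \<open>Compare \<open>t m * r m ^ (n + 1) \<le> t (m + n + 1) \<le> t m * t n\<close>
    and cancel \<open>t m\<close>.\<close>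
  have "r m ^ (n + 1) \<le> t n" for m n
  proof -
    have "t m * r m ^ (n + 1) \<le> t m * t n" using low[of m "n + 1"] sm[of m n] by simp
    then show ?thesis using pos[of m] by simp
  qed
  then have lb: "\<rho> ^ (n + 1) \<le> t n" for n
    by (intro LIMSEQ_le_const2[OF tendsto_power[OF \<rho>(1)]]) auto
  define s where "s k = t k / \<rho> ^ (k + 1)" for k
  have s1: "s k \<ge> 1" for k using lb[of k] \<rho>0 by (simp add: s_def)
  have "decseq s"
  proof (rule decseq_SucI)
    fix k
    have "t (Suc k) \<le> \<rho> * t k" using step[of k] \<rho>(2)[of k] pos[of k] by (simp add: mult_right_mono)
    then show "s (Suc k) \<le> s k" using \<rho>0 by (simp add: s_def field_simps)
  qed
  then obtain s' where s': "s \<longlonglongrightarrow> s'" using decseq_convergent[of s 1] s1 by metis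
  have "s' \<ge> 1" using s1 by (intro LIMSEQ_le_const[OF s']) auto
  then show thesis using that[OF \<rho>0 _ s'[unfolded s_def[abs_def]]] by simp
qed

context compact_haar
begin

definition idem :: "('g \<Rightarrow> complex) \<Rightarrow> bool" where
  "idem e \<longleftrightarrow> class_fun e \<and> star e = e \<and> conv M e e = e \<and> e \<noteq> (\<lambda>x. 0)"

text \<open>\<open>cpow f k\<close> is the power with exponent \<open>k + 1\<close>, since the
  algebra need not have a unit to start from. Hence the shift in \<open>cpow_add\<close>.\<close>

primrec cpow :: "('g \<Rightarrow> complex) \<Rightarrow> nat \<Rightarrow> 'g \<Rightarrow> complex" where
  "cpow f 0 = f"
| "cpow f (Suc k) = conv M f (cpow f k)"

lemma class_fun_cpow: "class_fun f \<Longrightarrow> class_fun (cpow f k)"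
  by (induction k) (auto intro: class_fun_conv)

lemma star_cpow: "class_fun f \<Longrightarrow> star f = f \<Longrightarrow> star (cpow f k) = cpow f k"
  by (induction k) (auto simp: star_conv class_fun_cpow)

lemma cpow_add: "class_fun f \<Longrightarrow> conv M (cpow f m) (cpow f n) = cpow f (m + n + 1)"
  by (induction m) (auto simp: conv_class_assoc class_fun_cpow)

lemma conv_self_0: "star f = f \<Longrightarrow> conv M f f 0 = of_real (sqnorm f)"
  using conv_star_self[of f] by simp

lemma conv_lin:
  assumes "class_fun a" "class_fun b" "class_fun c" "class_fun d"
  shows "conv M (\<lambda>x. \<alpha> * a x + \<beta> * b x) (\<lambda>x. \<gamma> * c x + \<delta> * d x) =
    (\<lambda>x. \<alpha> * \<gamma> * conv M a c x + \<alpha> * \<delta> * conv M a d x + \<beta> * \<gamma> * conv M b c x + \<beta> * \<delta> * conv M b d x)"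
proof -
  have lin: "conv M (\<lambda>x. \<alpha> * a x + \<beta> * b x) h = (\<lambda>x. \<alpha> * conv M a h x + \<beta> * conv M b h x)"
    if "class_fun h" "class_fun a" "class_fun b" for a b h \<alpha> \<beta>
    using that by (subst conv_add_left)
      (auto simp: conv_scale_left intro: class_fun_integrable class_fun_scale class_fun_cont)
  have cd: "class_fun (\<lambda>x. \<gamma> * c x + \<delta> * d x)" by (intro class_fun_add class_fun_scale assms)
  have "conv M a' (\<lambda>x. \<gamma> * c x + \<delta> * d x) = (\<lambda>x. \<gamma> * conv M a' c x + \<delta> * conv M a' d x)"
    if "class_fun a'" for a'
    using conv_comm[OF that cd] lin[OF that assms(3,4)] conv_comm[OF that] assms by simp
  then show ?thesis using lin[OF cd assms(1,2)] assms by (auto simp: algebra_simps)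
qed

lemma conv_diff_right:
  assumes "class_fun f" "class_fun g" "class_fun h"
  shows "conv M h (\<lambda>x. f x - g x) = (\<lambda>x. conv M h f x - conv M h g x)"
  using conv_comm[OF assms(3)] class_fun_diff[OF assms(1,2)] assms
  by (simp add: conv_diff_left class_fun_integrable class_fun_cont)

lemma class_fun_uniform_limit:
  assumes "\<And>n. class_fun (u n)" "uniform_limit UNIV u e sequentially"
  shows "class_fun e"
  unfolding class_fun_def
proof (intro conjI allI)
  show "continuous_on UNIV e"
    by (rule uniform_limit_theorem[OF _ assms(2)]) (use assms(1) class_fun_cont in auto)
  fix x y
  have "(\<lambda>n. u n (x + y)) \<longlonglongrightarrow> e (x + y)" "(\<lambda>n. u n (y + x)) \<longlonglongrightarrow> e (y + x)"
    using tendsto_uniform_limitI[OF assms(2)] by auto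
  moreover have "u n (x + y) = u n (y + x)" for n by (rule class_fun_comm[OF assms(1)])
  ultimately have "(\<lambda>n. u n (y + x)) \<longlonglongrightarrow> e (x + y)" "(\<lambda>n. u n (y + x)) \<longlonglongrightarrow> e (y + x)" by simp_all
  then show "e (x + y) = e (y + x)" by (rule LIMSEQ_unique)
qed

lemma sqnorm_pos: "class_fun f \<Longrightarrow> f \<noteq> (\<lambda>x. 0) \<Longrightarrow> sqnorm f > 0"
  using sqnorm_nonneg[of f] sqnorm_eq_0[of f] class_fun_cont by (metis ext order_le_less)

text \<open>Cauchy-Schwarz at 0 bounds the square of each norm by the product of its two neighbours.
  A vanishing power would make its predecessor vanish, so the induction carries two consecutive
  powers.\<close>

lemma sqnorm_cpow_pos:
  assumes f: "class_fun f" "star f = f" "f \<noteq> (\<lambda>x. 0)"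
  shows "sqnorm (cpow f k) > 0 \<and> sqnorm (cpow f (Suc k)) > 0"
proof (induction k)
  case 0
  have 0: "sqnorm f > 0" using sqnorm_pos f by blast
  have "cpow f (Suc 0) 0 \<noteq> 0" using conv_self_0[OF f(2)] 0 by simp
  then have "cpow f (Suc 0) \<noteq> (\<lambda>x. 0)" by metis
  then show ?case using 0 sqnorm_pos class_fun_cpow f(1) by (metis cpow.simps(1))
next
  case (Suc k)
  have "(norm (cpow f (2 * k + 3) 0))\<^sup>2 \<le> sqnorm (cpow f k) * sqnorm (cpow f (Suc (Suc k)))"
    using conv_sup_bound[of "cpow f k" "cpow f (Suc (Suc k))" 0] cpow_add[OF f(1), of k "Suc (Suc k)"]
      class_fun_cont class_fun_cpow f(1) by (simp add: numeral_3_eq_3 mult_2 del: cpow.simps)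
  moreover have "cpow f (2 * k + 3) 0 = of_real (sqnorm (cpow f (Suc k)))"
    using conv_self_0[OF star_cpow[OF f(1,2), of "Suc k"]] cpow_add[OF f(1), of "Suc k" "Suc k"]
    by (simp add: numeral_3_eq_3 mult_2 del: cpow.simps)
  ultimately have "(sqnorm (cpow f (Suc k)))\<^sup>2 \<le> sqnorm (cpow f k) * sqnorm (cpow f (Suc (Suc k)))"
    by (simp del: cpow.simps)
  moreover have "(sqnorm (cpow f (Suc k)))\<^sup>2 > 0" using Suc by (simp del: cpow.simps)
  ultimately have "sqnorm (cpow f (Suc (Suc k))) > 0"
    using Suc by (smt (verit) mult_nonneg_nonpos)
  then show ?case using Suc by blast
qed

text \<open>
  The idempotent is the uniform limit of the normalised powers \<open>f\<^sup>2\<^sup>k / \<rho>\<^sup>k\<close>, where \<open>\<rho>\<close> is the largest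
  eigenvalue of \<open>f * f\<close>. Submultiplicativity of the \<open>L\<^sup>2\<close> norm keeps the limit away from zero.
\<close>

lemma spectral_square:
  assumes f: "class_fun f" "star f = f" "f \<noteq> (\<lambda>x. 0)"
  obtains e \<rho> where "idem e" "\<rho> > 0" "conv M (conv M f f) e = (\<lambda>x. of_real \<rho> * e x)"
proof -
  define t where "t k = sqnorm (cpow f k)" for k
  have P: "class_fun (cpow f k)" for k using class_fun_cpow f by blast
  have tp: "t k > 0" for k using sqnorm_cpow_pos[OF f, of k] by (simp add: t_def del: cpow.simps)
  have t0: "cpow f (2 * k + 1) 0 = of_real (t k)" for k
    using conv_self_0[OF star_cpow[OF f(1,2), of k]] cpow_add[OF f(1), of k k]
    by (simp add: t_def mult_2 del: cpow.simps)
  have lc: "(t (Suc k))\<^sup>2 \<le> t k * t (Suc (Suc k))" for k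
  proof -
    have "(norm (cpow f (k + Suc (Suc k) + 1) 0))\<^sup>2 \<le> t k * t (Suc (Suc k))"
      using conv_sup_bound[of "cpow f k" "cpow f (Suc (Suc k))" 0] cpow_add[OF f(1), of k "Suc (Suc k)"]
        class_fun_cont[OF P] unfolding t_def by metis
    moreover have "k + Suc (Suc k) + 1 = 2 * Suc k + 1" by simp
    ultimately show ?thesis using t0[of "Suc k"] by (simp del: cpow.simps mult_Suc_right)
  qed
  have sm: "t (m + n + 1) \<le> t m * t n" for m n
    using sqnorm_conv_le[of "cpow f m" "cpow f n"] cpow_add[OF f(1), of m n]
      class_fun_cont[OF P] unfolding t_def by metis
  obtain \<rho> s where \<rho>: "\<rho> > 0" "s \<ge> 1" "(\<lambda>k. t k / \<rho> ^ (k + 1)) \<longlonglongrightarrow> s"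
    using log_convex_submultiplicative_limit[OF tp lc sm] by blast
  define c where "c k = complex_of_real (1 / \<rho> ^ (k + 1))" for k
  \<comment> \<open>This is the power of \<open>conv M f f\<close> with exponent
    \<open>k + 1\<close>, divided by \<open>\<rho> ^ (k + 1)\<close>; in this scaling
    \<open>u k\<close> times \<open>u l\<close> is \<open>u (k + l + 1)\<close>.\<close>
  define u where "u k = (\<lambda>x. c k * cpow f (2 * k + 1) x)" for k
  define S where "S k = t k / \<rho> ^ (k + 1)" for k
  have uc: "class_fun (u k)" for k unfolding u_def by (intro class_fun_scale P)
  have ustar: "star (u k) = u k" for k
    using star_cpow[OF f(1,2), of "2 * k + 1"] by (auto simp: u_def star_def c_def fun_eq_iff simp del: cpow.simps)
  have uu: "conv M (u k) (u l) = u (k + l + 1)" for k l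
  proof -
    have "c k * c l = c (k + l + 1)" using \<rho>(1) by (simp add: c_def power_add)
    moreover have "cpow f (2 * k + 1 + (2 * l + 1) + 1) = cpow f (2 * (k + l + 1) + 1)"
      by (simp add: algebra_simps del: cpow.simps)
    ultimately show ?thesis unfolding u_def
      by (simp add: conv_scale_left conv_scale_right cpow_add[OF f(1)] mult.assoc[symmetric] del: cpow.simps)
  qed
  have u0: "u k 0 = of_real (S k)" for k
    using t0[of k] by (simp add: u_def c_def S_def del: cpow.simps)
  have ff: "conv M (conv M f f) (u k) = (\<lambda>x. of_real \<rho> * u (Suc k) x)" for k
  proof -
    have "conv M (cpow f 1) (cpow f (2 * k + 1)) = cpow f (2 * Suc k + 1)"
      using cpow_add[OF f(1), of 1 "2 * k + 1"] by (simp del: cpow.simps)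
    moreover have "c k = of_real \<rho> * c (Suc k)" using \<rho>(1) by (simp add: c_def)
    ultimately show ?thesis unfolding u_def by (simp add: conv_scale_right mult.assoc)
  qed
  have du: "class_fun (\<lambda>x. u k x - u l x)" for k l by (intro class_fun_diff uc)
  \<comment> \<open>Products of the \<open>u k\<close> are again of this form, so L2 distances
    depend only on the convergent scalars \<open>S\<close>: the sequence is Cauchy in L2.\<close>
  have sq: "sqnorm (\<lambda>x. u k x - u l x) = S (2 * k + 1) + S (2 * l + 1) - 2 * S (k + l + 1)" for k l
  proof -
    let ?w = "\<lambda>x. 1 * u k x + (-1) * u l x"
    have w: "star ?w = ?w" using ustar[of k] ustar[of l] by (auto simp: star_def fun_eq_iff)
    have "complex_of_real (sqnorm ?w) = conv M ?w ?w 0" using conv_self_0[OF w] by simp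
    also have "\<dots> = u (k + k + 1) 0 - u (k + l + 1) 0 - u (l + k + 1) 0 + u (l + l + 1) 0"
      unfolding conv_lin[OF uc uc uc uc] uu by simp
    also have "\<dots> = of_real (S (2 * k + 1) + S (2 * l + 1) - 2 * S (k + l + 1))"
      unfolding u0 mult_2 add.commute[of l k] by simp
    finally show ?thesis by (simp only: of_real_eq_iff) simp
  qed
  \<comment> \<open>The shift buys one more convolution with \<open>conv M f f\<close>, through
    which Cauchy in L2 becomes uniformly Cauchy.\<close>
  define v where "v k = u (Suc k)" for k
  have "uniformly_Cauchy_on UNIV v"
  proof (rule uniformly_Cauchy_onI)
    fix e :: real assume e: "e > 0"
    \<comment> \<open>The errors of the values of \<open>S\<close> in \<open>sq\<close> add up to
      less than \<open>2 * d\<close>, and \<open>t 1 * (2 * d)\<close> is half the square of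
      \<open>\<rho> * e\<close>.\<close>
    define d where "d = (e * \<rho>)\<^sup>2 / (4 * t 1)"
    have d: "d > 0" using e \<rho>(1) tp by (simp add: d_def)
    obtain N where N: "\<And>n. n \<ge> N \<Longrightarrow> \<bar>S n - s\<bar> < d / 2"
      using LIMSEQ_D[OF \<rho>(3), of "d / 2"] d by (auto simp: S_def)
    have "dist (v k x) (v l x) < e" if "k \<ge> N" "l \<ge> N" for k l x
    proof -
      let ?d = "\<lambda>x. u k x - u l x"
      have "\<bar>S (2 * k + 1) - s\<bar> < d / 2" "\<bar>S (2 * l + 1) - s\<bar> < d / 2" "\<bar>S (k + l + 1) - s\<bar> < d / 2"
        by (rule N, use that in linarith)+
      then have sd: "sqnorm ?d < 2 * d" unfolding sq abs_less_iff by linarith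
      have "conv M (conv M f f) ?d = (\<lambda>x. of_real \<rho> * (v k x - v l x))"
        unfolding conv_diff_right[OF uc uc class_fun_conv[OF f(1) f(1)]] ff v_def
        by (simp add: right_diff_distrib)
      then have "(\<rho> * norm (v k x - v l x))\<^sup>2 = (norm (conv M (cpow f 1) ?d x))\<^sup>2"
        using \<rho>(1) by (simp add: norm_mult)
      also have "\<dots> \<le> t 1 * sqnorm ?d"
        unfolding t_def by (intro conv_sup_bound class_fun_cont P du)
      also have "\<dots> < t 1 * (2 * d)" using sd tp by (simp del: cpow.simps)
      also have "\<dots> \<le> (\<rho> * e)\<^sup>2" using tp[of 1] by (simp add: d_def field_simps)
      finally have "(\<rho> * norm (v k x - v l x))\<^sup>2 < (\<rho> * e)\<^sup>2" .
      then have "\<rho> * norm (v k x - v l x) < \<rho> * e"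
        by (rule power_less_imp_less_base) (use e \<rho>(1) in simp)
      then show ?thesis using \<rho>(1) by (simp add: dist_norm)
    qed
    then show "\<exists>N. \<forall>x\<in>UNIV. \<forall>m\<ge>N. \<forall>n\<ge>N. dist (v m x) (v n x) < e" by blast
  qed
  then obtain e where e: "uniform_limit UNIV v e sequentially"
    using Cauchy_uniformly_convergent[of UNIV v] unfolding uniformly_convergent_on_def by blast
  have vc: "class_fun (v k)" for k by (simp add: v_def uc)
  have ec: "class_fun e" by (rule class_fun_uniform_limit[OF vc e])
  have vlim: "(\<lambda>n. v n x) \<longlonglongrightarrow> e x" for x using tendsto_uniform_limitI[OF e] by simp
  have vlim': "(\<lambda>n. v (n + k) x) \<longlonglongrightarrow> e x" for x k by (rule LIMSEQ_ignore_initial_segment[OF vlim])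
  have ct: "(\<lambda>n. conv M (v n) h x) \<longlonglongrightarrow> conv M e h x" if "class_fun h" for h x
    by (rule conv_tendsto[OF _ _ _ e]) (use vc ec that class_fun_cont in auto)
  have ev: "conv M e (v m) = e" for m
  proof
    fix x
    have "conv M (v n) (v m) = v (n + (m + 2))" for n by (simp add: v_def uu)
    then have "(\<lambda>n. v (n + (m + 2)) x) \<longlonglongrightarrow> conv M e (v m) x" using ct[OF vc, of m x] by simp
    then show "conv M e (v m) x = e x" by (rule LIMSEQ_unique[OF _ vlim'])
  qed
  have ee: "conv M e e = e"
  proof
    fix x
    have "conv M (v m) e x = e x" for m using ev[of m] conv_comm[OF ec vc] by simp
    then show "conv M e e x = e x" using ct[OF ec, of x] by (simp add: LIMSEQ_const_iff)
  qed
  have es: "star e = e"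
  proof
    fix x
    have "(\<lambda>n. cnj (v n (- x))) \<longlonglongrightarrow> cnj (e (- x))" by (intro tendsto_cnj vlim)
    moreover have "cnj (v n (- x)) = v n x" for n using ustar[of "Suc n"] by (simp add: v_def star_def fun_eq_iff)
    ultimately have "(\<lambda>n. v n x) \<longlonglongrightarrow> cnj (e (- x))" by simp
    then show "star e x = e x" unfolding star_def by (rule LIMSEQ_unique[OF _ vlim])
  qed
  have "e 0 = of_real s"
  proof -
    have "(\<lambda>n. v n 0) \<longlonglongrightarrow> of_real s"
      unfolding v_def u0 S_def using LIMSEQ_Suc[OF \<rho>(3)] by (intro tendsto_of_real)
    then show ?thesis by (rule LIMSEQ_unique[OF vlim])
  qed
  then have "e 0 \<noteq> 0" using \<rho>(2) by simp
  then have "idem e" using ec es ee by (auto simp: idem_def)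
  moreover have "conv M (conv M f f) e = (\<lambda>x. of_real \<rho> * e x)"
  proof
    fix x
    have "conv M (v n) (conv M f f) = (\<lambda>x. of_real \<rho> * v (n + 1) x)" for n
      using ff[of "Suc n"] conv_comm[OF vc class_fun_conv[OF f(1) f(1)]] by (simp add: v_def)
    then have "(\<lambda>n. of_real \<rho> * v (n + 1) x) \<longlonglongrightarrow> conv M e (conv M f f) x"
      using ct[OF class_fun_conv[OF f(1) f(1)], of x] by simp
    moreover have "(\<lambda>n. of_real \<rho> * v (n + 1) x) \<longlonglongrightarrow> of_real \<rho> * e x"
      by (intro tendsto_mult tendsto_const vlim')
    ultimately have "conv M e (conv M f f) x = of_real \<rho> * e x" by (rule LIMSEQ_unique)
    then show "conv M (conv M f f) e x = of_real \<rho> * e x"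
      unfolding conv_comm[OF ec class_fun_conv[OF f(1) f(1)]] .
  qed
  ultimately show thesis using that \<rho>(1) by blast
qed

text \<open>On the idempotent \<open>e\<close> found for \<open>conv M f f\<close>, convolution with
  \<open>f\<close> squares to \<open>\<rho>\<close>. Hence half of
  \<open>e \<plusminus> conv M f e / sqrt \<rho>\<close> is an idempotent or zero, with eigenvalue
  \<open>\<plusminus> sqrt \<rho>\<close> for \<open>f\<close>. The two halves add up to
  \<open>e\<close>, so one of them is nonzero.\<close>

lemma spectral:
  assumes f: "class_fun f" "star f = f" "f \<noteq> (\<lambda>x. 0)"
  obtains e l where "idem e" "l \<noteq> 0" "conv M f e = (\<lambda>x. of_real l * e x)"
proof -
  obtain e \<rho> where e: "idem e" "\<rho> > 0" "conv M (conv M f f) e = (\<lambda>x. of_real \<rho> * e x)"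
    using spectral_square[OF f] by blast
  have ec: "class_fun e" "star e = e" "conv M e e = e" using e(1) by (auto simp: idem_def)
  define r where "r = sqrt \<rho>"
  have r: "r > 0" "r * r = \<rho>" using e(2) by (auto simp: r_def)
  define g where "g = conv M f e"
  have gc: "class_fun g" unfolding g_def by (intro class_fun_conv f ec)
  have gs: "star g = g" unfolding g_def using star_conv f ec by simp
  have fg: "conv M f g = (\<lambda>x. of_real \<rho> * e x)"
    unfolding g_def using e(3) conv_class_assoc f(1) ec(1) by simp
  have ge: "conv M g e = g" unfolding g_def using conv_class_assoc f(1) ec by simp
  have gg: "conv M g g = (\<lambda>x. of_real \<rho> * e x)"
    using conv_class_assoc[OF gc f(1) ec(1)] conv_comm[OF gc f(1)] fg g_def
    by (simp add: conv_scale_left ec)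
  define p where "p \<sigma> = (\<lambda>x. (1/2) * e x + of_real (\<sigma> / (2 * r)) * g x)" for \<sigma> :: real
  have pc: "class_fun (p \<sigma>)" for \<sigma> unfolding p_def by (intro class_fun_add class_fun_scale ec gc)
  have ps: "star (p \<sigma>) = p \<sigma>" for \<sigma> using ec(2) gs by (auto simp: p_def star_def fun_eq_iff)
  have rr: "complex_of_real r * complex_of_real r = complex_of_real \<rho>" using r(2) by (simp flip: of_real_mult)
  have pp: "conv M (p \<sigma>) (p \<sigma>) = p \<sigma>" if "\<sigma> * \<sigma> = 1" for \<sigma>
  proof -
    have "complex_of_real \<sigma> * complex_of_real \<sigma> = 1" using that by (simp flip: of_real_mult)
    then show ?thesis
      unfolding p_def using r(1) e(2) rr
      by (subst conv_lin) (auto simp: ec gc ge gg conv_comm[OF ec(1) gc] fun_eq_iff field_simps)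
  qed
  have fp: "conv M f (p \<sigma>) = (\<lambda>x. of_real (\<sigma> * r) * p \<sigma> x)" if "\<sigma> * \<sigma> = 1" for \<sigma>
  proof -
    have "\<sigma> / (2 * r) * \<rho> = \<sigma> * r * (1/2)" "\<sigma> * r * (\<sigma> / (2 * r)) = 1/2"
      using r that by (auto simp: field_simps)
    then have "complex_of_real (\<sigma> / (2 * r) * \<rho>) = of_real (\<sigma> * r * (1/2))"
      "complex_of_real (\<sigma> * r * (\<sigma> / (2 * r))) = of_real (1/2)" by (simp_all only:)
    then have "complex_of_real (\<sigma> / (2 * r)) * of_real \<rho> = of_real (\<sigma> * r) * of_real (1/2)"
      "complex_of_real (\<sigma> * r) * of_real (\<sigma> / (2 * r)) = of_real (1/2)"
      by (simp_all only: of_real_mult)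
    moreover have "complex_of_real (1/2) = 1/2" by simp
    ultimately have c: "complex_of_real (\<sigma> / (2 * r)) * of_real \<rho> = of_real (\<sigma> * r) * (1/2)"
      "complex_of_real (\<sigma> * r) * of_real (\<sigma> / (2 * r)) = 1/2"
      by (simp_all only:)
    have "conv M f (p \<sigma>) = (\<lambda>x. (1/2) * g x + of_real (\<sigma> / (2 * r)) * of_real \<rho> * e x)"
      using conv_lin[OF f(1) f(1) ec(1) gc, of 1 0 "1/2" "of_real (\<sigma> / (2 * r))"]
      by (simp add: p_def fg g_def[symmetric] mult.assoc)
    then show ?thesis
      unfolding c(1) by (simp add: p_def fun_eq_iff distrib_left mult.assoc[symmetric] c(2) del: of_real_mult of_real_divide)
  qed
  have "p 1 \<noteq> (\<lambda>x. 0) \<or> p (-1) \<noteq> (\<lambda>x. 0)"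
  proof (rule ccontr)
    assume "\<not> ?thesis"
    then have "p 1 x + p (-1) x = 0" for x by (simp add: fun_eq_iff)
    moreover have "p 1 x + p (-1) x = e x" for x by (simp add: p_def)
    ultimately have "e = (\<lambda>x. 0)" by auto
    then show False using e(1) by (auto simp: idem_def)
  qed
  then show thesis
  proof
    assume "p 1 \<noteq> (\<lambda>x. 0)"
    then have "idem (p 1)" using pc ps pp by (simp add: idem_def)
    then show thesis using that[of "p 1" r] fp[of 1] r by simp
  next
    assume "p (-1) \<noteq> (\<lambda>x. 0)"
    then have "idem (p (-1))" using pc ps pp by (simp add: idem_def)
    then show thesis using that[of "p (-1)" "- r"] fp[of "-1"] r by simp
  qed
qed

end

section \<open>Minimal idempotents\<close>

context compact_haar
begin

lemma idemD:
  assumes "idem e"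
  shows "class_fun e" "star e = e" "conv M e e = e" "e (- x) = cnj (e x)" "e 0 = of_real (sqnorm e)"
    "sqnorm e > 0"
proof -
  show e: "class_fun e" "star e = e" "conv M e e = e" using assms by (auto simp: idem_def)
  show "e (- x) = cnj (e x)" using fun_cong[OF e(2), of "- x"] by (simp add: star_def)
  show "e 0 = of_real (sqnorm e)" using conv_self_0[OF e(2)] e(3) by simp
  show "sqnorm e > 0" using sqnorm_pos e(1) assms by (auto simp: idem_def)
qed

text \<open>Submultiplicativity applied to \<open>conv M e e = e\<close>. This lower bound makes
  descent through smaller idempotents finite.\<close>

lemma idem_sqnorm_ge_1:
  assumes "idem e" shows "sqnorm e \<ge> 1"
  using sqnorm_conv_le[of e e] idemD[OF assms] class_fun_cont by force

lemma idem_bound: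
  assumes "idem e" shows "norm (e x) \<le> sqnorm e"
proof -
  have "(norm (e x))\<^sup>2 \<le> (sqnorm e)\<^sup>2"
    using conv_sup_bound[of e e x] idemD[OF assms] class_fun_cont by (simp add: power2_eq_square)
  then show ?thesis by (rule power2_le_imp_le) (simp add: sqnorm_nonneg)
qed

definition minimal :: "('g \<Rightarrow> complex) \<Rightarrow> bool" where
  "minimal e \<longleftrightarrow> idem e \<and> (\<forall>e'. idem e' \<and> conv M e e' = e' \<longrightarrow> e' = e)"

lemma minimal_idem: "minimal e \<Longrightarrow> idem e" by (simp add: minimal_def)

text \<open>If \<open>e'\<close> lies strictly below \<open>e\<close>, then \<open>e - e'\<close> is
  again an idempotent, and evaluation at 0 shows that the square norms add up. So
  \<open>sqnorm\<close> drops by at least 1 in each descent.\<close>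

lemma minimal_exists:
  assumes "idem e"
  shows "\<exists>m. minimal m \<and> conv M e m = m"
  using assms
proof (induction "nat \<lfloor>sqnorm e\<rfloor>" arbitrary: e rule: less_induct)
  case less
  note e = idemD[OF less.prems]
  show ?case
  proof (cases "minimal e")
    case True
    then show ?thesis using e by blast
  next
    case False
    then obtain e' where e': "idem e'" "conv M e e' = e'" "e' \<noteq> e"
      using less.prems by (auto simp: minimal_def)
    note e'' = idemD[OF e'(1)]
    define d where "d = (\<lambda>x. e x - e' x)"
    have "conv M e' e = e'" using e'(2) conv_comm e e'' by metis
    then have "conv M d d = d"
      unfolding d_def using e e'' e'(2)
      by (simp add: conv_diff_left conv_diff_right class_fun_diff class_fun_integrable class_fun_cont)
    moreover have "star d = d" using e(4) e''(4) by (simp add: d_def star_def)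
    moreover have "d \<noteq> (\<lambda>x. 0)"
    proof
      assume "d = (\<lambda>x. 0)"
      then have "e' x = e x" for x by (simp add: d_def fun_eq_iff)
      then show False using e'(3) by auto
    qed
    ultimately have d: "idem d" using e e'' by (simp add: idem_def d_def class_fun_diff)
    have "complex_of_real (sqnorm d) = of_real (sqnorm e - sqnorm e')"
      using idemD(5)[OF d] e(5) e''(5) by (simp add: d_def)
    then have "sqnorm e' \<le> sqnorm e - 1" using idem_sqnorm_ge_1[OF d] unfolding of_real_eq_iff by linarith
    then have "nat \<lfloor>sqnorm e'\<rfloor> < nat \<lfloor>sqnorm e\<rfloor>"
      using idem_sqnorm_ge_1[OF e'(1)] by linarith
    then obtain m where m: "minimal m" "conv M e' m = m" using less.hyps e'(1) by blast
    have "conv M e m = m"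
      using conv_class_assoc[OF e(1) e''(1) idemD(1)[OF minimal_idem[OF m(1)]]] m e'(2) by simp
    then show ?thesis using m by blast
  qed
qed

text \<open>An eigen-idempotent of \<open>g\<close> with nonzero eigenvalue lies below
  \<open>e\<close> because \<open>g\<close> does. Minimality identifies it with \<open>e\<close>,
  and then \<open>g = conv M g e\<close> is a multiple of \<open>e\<close>.\<close>

lemma minimal_selfadjoint:
  assumes e: "minimal e" and g: "class_fun g" "star g = g" "conv M g e = g"
  shows "\<exists>c. g = (\<lambda>x. c * e x)"
proof (cases "g = (\<lambda>x. 0)")
  case True
  then show ?thesis by (intro exI[of _ 0]) simp
next
  case False
  note ee = idemD[OF minimal_idem[OF e]]
  obtain e' l where e': "idem e'" "l \<noteq> 0" "conv M g e' = (\<lambda>x. of_real l * e' x)"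
    using spectral[OF g(1,2) False] by blast
  note ee' = idemD[OF e'(1)]
  have "conv M e (conv M g e') = conv M g e'"
    using conv_class_assoc[OF ee(1) g(1) ee'(1)] conv_comm[OF ee(1) g(1)] g(3) by simp
  then have "conv M e e' = e'" using e'(2,3) by (auto simp: conv_scale_right fun_eq_iff)
  then have "e' = e" using e e'(1) by (auto simp: minimal_def)
  then show ?thesis using e'(3) g(3) by metis
qed

text \<open>
  A minimal idempotent is \<open>e = d \<chi>\<close> for an irreducible character \<open>\<chi>\<close> of degree \<open>d\<close>. Thus
  \<open>sqnorm e = e 0 = d\<^sup>2\<close>, \<open>nch e = \<chi> / d\<close>, and \<open>coef _ e\<close> is a character of \<open>ZL\<^sup>1(G)\<close>.
\<close>

definition nch :: "('g \<Rightarrow> complex) \<Rightarrow> 'g \<Rightarrow> complex" where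
  "nch e = (\<lambda>x. e x / of_real (sqnorm e))"

definition coef :: "('g \<Rightarrow> complex) \<Rightarrow> ('g \<Rightarrow> complex) \<Rightarrow> complex" where
  "coef f e = (\<integral>y. f y * cnj (nch e y) \<partial>M)"

text \<open>The corner cut out by \<open>e\<close> is one-dimensional, the counterpart of Schur's
  lemma: the self-adjoint case is applied to the two hermitian parts of
  \<open>conv M f e\<close>.\<close>

lemma conv_minimal_ex:
  assumes e: "minimal e" and f: "class_fun f"
  shows "\<exists>c. conv M f e = (\<lambda>x. c * e x)"
proof -
  note ee = idemD[OF minimal_idem[OF e]]
  define g where "g = conv M f e"
  have g: "class_fun g" "conv M g e = g"
    using f ee class_fun_conv by (auto simp: g_def conv_class_assoc)
  have sg: "class_fun (star g)" "conv M (star g) e = star g"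
    using class_fun_star[OF g(1)] star_conv[OF g(1) ee(1)] ee(2) g(2) by auto
  have *: "\<exists>c. (\<lambda>x. a * g x + cnj a * star g x) = (\<lambda>x. c * e x)" for a
  proof (rule minimal_selfadjoint[OF e])
    show "class_fun (\<lambda>x. a * g x + cnj a * star g x)" by (intro class_fun_add class_fun_scale g sg)
    show "star (\<lambda>x. a * g x + cnj a * star g x) = (\<lambda>x. a * g x + cnj a * star g x)"
      by (auto simp: star_def fun_eq_iff)
    show "conv M (\<lambda>x. a * g x + cnj a * star g x) e = (\<lambda>x. a * g x + cnj a * star g x)"
      using conv_lin[OF g(1) sg(1) ee(1) ee(1), of a "cnj a" 1 0] g sg by simp
  qed
  obtain c d where c: "\<And>x. (1/2) * g x + cnj (1/2) * star g x = c * e x"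
    and d: "\<And>x. (-\<i>/2) * g x + cnj (-\<i>/2) * star g x = d * e x"
    using *[of "1/2"] *[of "-\<i>/2"] unfolding fun_eq_iff by blast
  have "g x = (c + \<i> * d) * e x" for x
  proof -
    have "g x = ((1/2) * g x + cnj (1/2) * star g x) + \<i> * ((-\<i>/2) * g x + cnj (-\<i>/2) * star g x)"
      by (simp add: algebra_simps)
    then show ?thesis unfolding c d by (simp add: algebra_simps)
  qed
  then show ?thesis unfolding g_def by auto
qed

lemma conv_minimal:
  assumes e: "minimal e" and f: "class_fun f"
  shows "conv M f e = (\<lambda>x. coef f e * e x)"
proof -
  note ee = idemD[OF minimal_idem[OF e]]
  obtain c where c: "conv M f e = (\<lambda>x. c * e x)" using conv_minimal_ex[OF assms] by blast
  have "conv M f e 0 = (\<integral>y. f y * cnj (e y) \<partial>M)"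
    using conv_star_0[of f e] ee(2) by simp
  also have "\<dots> = coef f e * of_real (sqnorm e)"
    using ee(6) by (simp add: coef_def nch_def)
  finally have "c = coef f e" using c ee(5,6) by simp
  then show ?thesis using c by simp
qed

lemma nch_0: "idem e \<Longrightarrow> nch e 0 = 1" using idemD(5,6)[of e] by (simp add: nch_def)

lemma nch_uminus: "idem e \<Longrightarrow> nch e (- x) = cnj (nch e x)" using idemD(4) by (simp add: nch_def)

lemma nch_class: "idem e \<Longrightarrow> class_fun (nch e)"
  unfolding nch_def divide_inverse using class_fun_scale[OF idemD(1), of e "inverse (of_real (sqnorm e))"]
  by (simp add: mult.commute)

lemma nch_bound: "idem e \<Longrightarrow> norm (nch e x) \<le> 1"
  using idem_bound[of e x] idemD(6)[of e] by (simp add: nch_def norm_divide)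

text \<open>For fixed \<open>y\<close> the integral is a class function of \<open>x\<close> that
  convolution with \<open>e\<close> fixes, hence a multiple of \<open>e\<close>; evaluation at 0
  determines the factor.\<close>

lemma functional_equation:
  assumes e: "minimal e"
  shows "(\<integral>t. nch e (x + t + y - t) \<partial>M) = nch e x * nch e y"
proof -
  note ee = idemD[OF minimal_idem[OF e]]
  have ec: "continuous_on UNIV e" using ee class_fun_cont by blast
  define h where "h x = (\<integral>t. e (x + t + y - t) \<partial>M)" for x
  have c2: "continuous_on UNIV (\<lambda>p::'g \<times> 'g. e (snd p + fst p + y - fst p))"
    by (intro continuous_on_comp_UNIV[OF ec] continuous_intros)
  have hc: "class_fun h" unfolding class_fun_def
  proof (intro conjI allI)
    show "continuous_on UNIV h" unfolding h_def using cont_param[OF c2] by simp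
    fix x z
    have m: "(\<lambda>t. e (x + z + t + y - t)) \<in> borel_measurable borel"
      by (intro borel_measurable_continuous_onI continuous_on_comp_UNIV[OF ec] continuous_intros)
    have "e (x + z + (- z + t) + y - (- z + t)) = e (z + x + t + y - t)" for t
    proof -
      have "x + z + (- z + t) + y - (- z + t) = (x + t + y - t) + z"
        by (simp add: group_normalise del: add_uminus_conv_diff)
      also have "e \<dots> = e (z + (x + t + y - t))" by (rule class_fun_comm[OF ee(1)])
      finally show ?thesis by (simp add: group_normalise del: add_uminus_conv_diff)
    qed
    then show "h (x + z) = h (z + x)" using integral_left[OF m, of "- z"] by (simp add: h_def)
  qed
  have "conv M e h = h"
  proof
    fix x
    have c3: "continuous_on UNIV (\<lambda>p::'g \<times> 'g. e (- fst p + x + snd p + y - snd p))"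
      by (intro continuous_on_comp_UNIV[OF ec] continuous_intros)
    have "conv M e h x = (\<integral>t. (\<integral>z. e z * e (- z + x + t + y - t) \<partial>M) \<partial>M)"
      using weighted_fubini[OF cont_integrable[OF ec] c3] by (simp add: conv_def h_def)
    also have "\<dots> = (\<integral>t. conv M e e (x + t + y - t) \<partial>M)"
      by (simp add: conv_def group_normalise del: add_uminus_conv_diff)
    also have "\<dots> = h x" using ee(3) by (simp add: h_def)
    finally show "conv M e h x = h x" .
  qed
  then obtain c where c: "h = (\<lambda>x. c * e x)"
    using conv_minimal_ex[OF e hc] conv_comm[OF ee(1) hc] by auto
  have "h 0 = e y" using class_fun_conj[OF ee(1)] by (simp add: h_def)
  then have "c * of_real (sqnorm e) = e y" using c ee(5) by simp
  then have "h x = e y / of_real (sqnorm e) * e x" using c ee(6) by (auto simp: field_simps)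
  then show ?thesis using ee(6) unfolding nch_def h_def by simp
qed

text \<open>A nonzero product would be an idempotent below both factors, hence equal to
  both.\<close>

lemma minimal_orthogonal:
  assumes "minimal e" "minimal e'" "e \<noteq> e'"
  shows "conv M e e' = (\<lambda>x. 0)"
proof (rule ccontr)
  assume n: "conv M e e' \<noteq> (\<lambda>x. 0)"
  note a = idemD[OF minimal_idem[OF assms(1)]] and b = idemD[OF minimal_idem[OF assms(2)]]
  have c: "conv M e (conv M e e') = conv M e e'"
    using conv_class_assoc[OF a(1) a(1) b(1)] a(3) by simp
  have d: "conv M e' (conv M e e') = conv M e e'"
    using conv_class_assoc[OF b(1) b(1) a(1)] b(3) conv_comm[OF a(1) b(1)] by simp
  have "conv M (conv M e e') (conv M e e') = conv M e e'"
    using conv_class_assoc[OF a(1) b(1) class_fun_conv[OF a(1) b(1)]] c d by simp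
  then have "idem (conv M e e')"
    using n a b star_conv class_fun_conv by (simp add: idem_def)
  then show False using assms c d unfolding minimal_def by metis
qed

section \<open>Bessel's inequality and Mercer's expansion\<close>

context
  fixes u :: "'g \<Rightarrow> complex"
  assumes u: "class_fun u"
begin

lemma conv_star_minimal:
  assumes "minimal m"
  shows "conv M (conv M u (star u)) m = (\<lambda>x. of_real ((norm (coef u m))\<^sup>2) * m x)"
proof -
  note mm = idemD[OF minimal_idem[OF assms]]
  have "conv M (star u) m = star (conv M u m)" using star_conv[OF u mm(1)] mm(2) by simp
  also have "\<dots> = (\<lambda>x. cnj (coef u m) * m x)"
    using conv_minimal[OF assms u] mm(4) by (simp add: star_def)
  finally have "conv M u (conv M (star u) m) = (\<lambda>x. cnj (coef u m) * (coef u m * m x))"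
    using conv_minimal[OF assms u] by (simp add: conv_scale_right)
  then show ?thesis
    unfolding complex_norm_square
    using conv_class_assoc[OF u class_fun_star[OF u] mm(1)] by (simp add: mult_ac)
qed

text \<open>\<open>w\<close> is the orthogonal projection of \<open>u\<close> to the span of
  \<open>S\<close>. The three products \<open>u\<close> with \<open>star w\<close>, \<open>w\<close>
  with \<open>star u\<close> and \<open>w\<close> with \<open>star w\<close> all equal
  \<open>z\<close>, so \<open>u - w\<close> has square norm \<open>sqnorm u - z 0\<close>.\<close>

lemma bessel:
  assumes S: "finite S" "\<And>e. e \<in> S \<Longrightarrow> minimal e"
  shows "(\<Sum>e\<in>S. (norm (coef u e))\<^sup>2 * sqnorm e) \<le> sqnorm u"
proof -
  define w where "w x = (\<Sum>e\<in>S. coef u e * e x)" for x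
  define z where "z x = (\<Sum>e\<in>S. of_real ((norm (coef u e))\<^sup>2) * e x)" for x
  have ec: "class_fun e" "star e = e" if "e \<in> S" for e using S(2)[OF that] minimal_idem idemD by blast+
  have wc: "class_fun w" unfolding w_def by (intro class_fun_sum class_fun_scale ec)
  have sw: "star w = (\<lambda>x. \<Sum>e\<in>S. cnj (coef u e) * e x)"
    using ec(2) by (auto simp: star_def w_def fun_eq_iff intro!: sum.cong)
  have g: "conv M f (star w) = (\<lambda>x. \<Sum>e\<in>S. cnj (coef u e) * conv M f e x)" if f: "class_fun f" for f
  proof -
    have "conv M f (star w) = conv M (star w) f" using conv_comm[OF f class_fun_star[OF wc]] .
    also have "\<dots> = (\<lambda>x. \<Sum>e\<in>S. conv M (\<lambda>x. cnj (coef u e) * e x) f x)"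
      unfolding sw by (intro conv_sum_left class_fun_integrable class_fun_scale ec class_fun_cont f)
    also have "\<dots> = (\<lambda>x. \<Sum>e\<in>S. cnj (coef u e) * conv M f e x)"
      using conv_comm[OF f ec(1)] by (simp add: conv_scale_left)
    finally show ?thesis .
  qed
  have uw: "conv M u (star w) = z"
    unfolding g[OF u] z_def complex_norm_square using conv_minimal[OF S(2) u]
    by (auto simp: fun_eq_iff mult_ac intro!: sum.cong)
  have ww: "conv M w (star w) = z"
  proof -
    have "conv M w e = (\<lambda>x. coef u e * e x)" if e: "e \<in> S" for e
    proof -
      have "conv M w e = (\<lambda>x. \<Sum>e'\<in>S. conv M (\<lambda>x. coef u e' * e' x) e x)"
        unfolding w_def by (intro conv_sum_left class_fun_integrable class_fun_scale ec class_fun_cont e)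
      also have "\<dots> = (\<lambda>x. \<Sum>e'\<in>S. if e' = e then coef u e * e x else 0)"
        using minimal_orthogonal S(2) e idemD(3)[OF minimal_idem[OF S(2)[OF e]]]
        by (intro ext sum.cong) (auto simp: conv_scale_left)
      finally show ?thesis using e S(1) by simp
    qed
    then show ?thesis unfolding g[OF wc] z_def complex_norm_square
      by (auto simp: fun_eq_iff mult_ac intro!: sum.cong)
  qed
  have sz: "star z = z"
    using ec(2) by (auto simp: star_def z_def fun_eq_iff intro!: sum.cong)
  have wu: "conv M w (star u) = z"
    using star_conv[OF u class_fun_star[OF wc]] uw sz conv_comm[OF class_fun_star[OF u] wc] by simp
  let ?v = "\<lambda>x. 1 * u x + (-1) * w x"
  have sv: "star ?v = (\<lambda>x. 1 * star u x + (-1) * star w x)" by (auto simp: star_def)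
  have "complex_of_real (sqnorm ?v) = conv M ?v (star ?v) 0" by (rule conv_star_self[symmetric])
  also have "\<dots> = conv M u (star u) 0 - z 0"
    unfolding sv by (subst conv_lin) (auto simp: u wc class_fun_star uw ww wu)
  also have "\<dots> = of_real (sqnorm u - (\<Sum>e\<in>S. (norm (coef u e))\<^sup>2 * sqnorm e))"
    using S(2) idemD(5) minimal_idem by (auto simp: conv_star_self z_def intro!: sum.cong)
  finally have "sqnorm ?v = sqnorm u - (\<Sum>e\<in>S. (norm (coef u e))\<^sup>2 * sqnorm e)"
    by (simp only: of_real_eq_iff)
  then show ?thesis using sqnorm_nonneg[of ?v] by linarith
qed

text \<open>
  The remainder of an exhausting sequence of partial sums converges uniformly, and a nonzero limit would
  yield, by the spectral lemma, a minimal idempotent not yet accounted for.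
\<close>

lemma mercer:
  assumes "\<epsilon> > 0"
  obtains S where "finite S" "\<And>e. e \<in> S \<Longrightarrow> minimal e"
    "\<And>x. norm (conv M u (star u) x - (\<Sum>e\<in>S. of_real ((norm (coef u e))\<^sup>2) * e x)) \<le> \<epsilon>"
proof -
  define P where "P = conv M u (star u)"
  define a where "a e = (norm (coef u e))\<^sup>2" for e
  define q where "q S = (\<Sum>e\<in>S. a e * sqnorm e)" for S
  define \<F> where "\<F> = {S. finite S \<and> (\<forall>e\<in>S. minimal e)}"
  have a0: "a e \<ge> 0" for e by (simp add: a_def)
  have bdd: "bdd_above (q ` \<F>)"
    using bessel by (intro bdd_aboveI[of _ "sqnorm u"]) (auto simp: \<F>_def q_def a_def)
  \<comment> \<open>The minimal idempotents may be uncountably many, so a supremum of finite Bessel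
    sums replaces a series; the \<open>S n\<close> nearly attain it and their unions
    \<open>T n\<close> increase.\<close>
  define \<alpha> where "\<alpha> = Sup (q ` \<F>)"
  have qle: "q S \<le> \<alpha>" if "S \<in> \<F>" for S unfolding \<alpha>_def using bdd that by (intro cSUP_upper)
  have ne: "\<F> \<noteq> {}" by (auto simp: \<F>_def)
  have "\<exists>S\<in>\<F>. q S > \<alpha> - 1 / Suc n" for n
    using less_cSUP_iff[OF ne bdd, of "\<alpha> - 1 / Suc n"] by (simp add: \<alpha>_def)
  then obtain S where S: "\<And>n. S n \<in> \<F>" "\<And>n. q (S n) > \<alpha> - 1 / Suc n" by metis
  define T where "T n = (\<Union>k\<le>n. S k)" for n :: nat
  have T: "T n \<in> \<F>" for n using S(1) by (auto simp: T_def \<F>_def)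
  have Tmono: "T k \<subseteq> T l" if "k \<le> l" for k l using that by (force simp: T_def)
  have qT: "q (T n) > \<alpha> - 1 / Suc n" for n
  proof -
    have "q (S n) \<le> q (T n)" unfolding q_def
      using T[of n] by (intro sum_mono2) (auto simp: \<F>_def T_def a0 sqnorm_nonneg)
    then show ?thesis using S(2)[of n] by linarith
  qed
  define R where "R n x = P x - (\<Sum>e\<in>T n. of_real (a e) * e x)" for n x
  have mT: "minimal e" if "e \<in> T n" for e n using T[of n] that by (auto simp: \<F>_def)
  have ec: "class_fun e" "star e = e" if "e \<in> T n" for e n using mT[OF that] minimal_idem idemD by blast+
  have Pc: "class_fun P" unfolding P_def by (intro class_fun_conv class_fun_star u)
  have Rc: "class_fun (R n)" for n
    unfolding R_def by (intro class_fun_diff class_fun_sum class_fun_scale Pc ec)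
  \<comment> \<open>As \<open>|e|\<close> is at most \<open>sqnorm e\<close>, the terms added
    between \<open>T k\<close> and \<open>T l\<close> are uniformly bounded by the gain in
    \<open>q\<close>.\<close>
  have diff: "norm (R k x - R l x) \<le> 1 / Suc k" if "k \<le> l" for k l x
  proof -
    have fT: "finite (T l)" using T[of l] by (auto simp: \<F>_def)
    have "R k x - R l x = (\<Sum>e\<in>T l - T k. of_real (a e) * e x)"
      unfolding R_def using sum_diff[OF fT Tmono[OF that], of "\<lambda>e. of_real (a e) * e x"] by simp
    also have "norm \<dots> \<le> (\<Sum>e\<in>T l - T k. a e * sqnorm e)"
      using mT by (intro sum_norm_le) (auto simp: norm_mult a0 intro!: mult_left_mono idem_bound minimal_idem)
    also have "\<dots> = q (T l) - q (T k)"
      unfolding q_def using sum_diff[OF fT Tmono[OF that]] by simp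
    also have "\<dots> \<le> 1 / Suc k" using qle[OF T[of l]] qT[of k] by linarith
    finally show ?thesis .
  qed
  have "uniformly_Cauchy_on UNIV R"
  proof (rule uniformly_Cauchy_onI)
    fix e :: real assume e: "e > 0"
    obtain N where N: "inverse (real (Suc N)) < e / 2" using reals_Archimedean[of "e/2"] e by auto
    have "dist (R m x) (R n x) < e" if "m \<ge> N" "n \<ge> N" for m n x
    proof -
      have "norm (R N x - R m x) < e / 2" "norm (R N x - R n x) < e / 2"
        using diff[OF that(1), of x] diff[OF that(2), of x] N by (auto simp: inverse_eq_divide)
      then have "norm ((R N x - R n x) - (R N x - R m x)) < e"
        using norm_triangle_ineq4[of "R N x - R n x" "R N x - R m x"] by linarith
      then show ?thesis by (simp add: dist_norm)
    qed
    then show "\<exists>N. \<forall>x\<in>UNIV. \<forall>m\<ge>N. \<forall>n\<ge>N. dist (R m x) (R n x) < e" by blast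
  qed
  then obtain Q where Q: "uniform_limit UNIV R Q sequentially"
    using Cauchy_uniformly_convergent[of UNIV R] unfolding uniformly_convergent_on_def by blast
  have Qc: "class_fun Q" by (rule class_fun_uniform_limit[OF Rc Q])
  have Ps: "star P = P" unfolding P_def using star_conv[OF u class_fun_star[OF u]] conv_comm u class_fun_star by simp
  have Rs: "star (R n) = R n" for n
    using fun_cong[OF Ps] ec(2)[of _ n]
    by (auto simp: star_def R_def fun_eq_iff intro!: sum.cong)
  have Qs: "star Q = Q"
  proof
    fix x
    have "(\<lambda>n. cnj (R n (- x))) \<longlonglongrightarrow> cnj (Q (- x))" "(\<lambda>n. R n x) \<longlonglongrightarrow> Q x"
      by (intro tendsto_cnj tendsto_uniform_limitI[OF Q]; simp)+
    moreover have "cnj (R n (- x)) = R n x" for n using fun_cong[OF Rs[of n], of x] by (simp add: star_def)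
    ultimately have "(\<lambda>n. R n x) \<longlonglongrightarrow> cnj (Q (- x))" "(\<lambda>n. R n x) \<longlonglongrightarrow> Q x" by simp_all
    then show "star Q x = Q x" unfolding star_def by (rule LIMSEQ_unique)
  qed
  have "Q = (\<lambda>x. 0)"
  proof (rule ccontr)
    assume "Q \<noteq> (\<lambda>x. 0)"
    then obtain e l where e: "idem e" "l \<noteq> 0" "conv M Q e = (\<lambda>x. of_real l * e x)"
      using spectral[OF Qc Qs] by blast
    obtain m where m: "minimal m" "conv M e m = m" using minimal_exists[OF e(1)] by blast
    note mm = idemD[OF minimal_idem[OF m(1)]]
    have "conv M Q m = conv M (conv M Q e) m"
      using conv_class_assoc[OF Qc idemD(1)[OF e(1)] mm(1)] m(2) by simp
    then have Qm: "conv M Q m 0 = of_real l * m 0" using e(3) m(2) by (simp add: conv_scale_left)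
    have lim: "(\<lambda>n. conv M (R n) m 0) \<longlonglongrightarrow> of_real l * m 0"
      using conv_tendsto[OF _ _ _ Q, of m 0] class_fun_cont Rc Qc mm(1) Qm by simp
    \<comment> \<open>Orthogonality isolates the coefficient at \<open>m\<close>: it has been
      removed if \<open>m\<close> is in \<open>T n\<close> and is \<open>a m\<close> otherwise. In
      the limit it has to be \<open>l\<close>.\<close>
    have RS: "conv M (R n) m 0 = (if m \<in> T n then 0 else of_real (a m) * m 0)" for n
    proof -
      have fT: "finite (T n)" using T[of n] by (auto simp: \<F>_def)
      have "conv M (\<lambda>x. \<Sum>e\<in>T n. of_real (a e) * e x) m = (\<lambda>x. \<Sum>e\<in>T n. conv M (\<lambda>x. of_real (a e) * e x) m x)"
        by (intro conv_sum_left class_fun_integrable class_fun_scale ec class_fun_cont mm)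
      also have "\<dots> = (\<lambda>x. \<Sum>e\<in>T n. if e = m then of_real (a m) * m x else 0)"
        using minimal_orthogonal[OF mT m(1)] mm(3)
        by (intro ext sum.cong) (auto simp: conv_scale_left)
      finally have sm: "conv M (\<lambda>x. \<Sum>e\<in>T n. of_real (a e) * e x) m 0 = (if m \<in> T n then of_real (a m) * m 0 else 0)"
        using fT by (simp add: sum.delta)
      have "conv M (R n) m = (\<lambda>x. conv M P m x - conv M (\<lambda>x. \<Sum>e\<in>T n. of_real (a e) * e x) m x)"
        unfolding R_def[abs_def]
        by (intro conv_diff_left class_fun_integrable class_fun_cont class_fun_sum class_fun_scale Pc ec mm)
      then show ?thesis using sm conv_star_minimal[OF m(1)] by (simp add: P_def a_def)
    qed
    have m0: "m 0 \<noteq> 0" using mm(5,6) by simp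
    show False
    proof (cases "\<exists>n. m \<in> T n")
      case True
      then obtain n where "m \<in> T n" by blast
      then have "conv M (R k) m 0 = 0" if "k \<ge> n" for k using RS Tmono[OF that] by auto
      then have "(\<lambda>n. conv M (R n) m 0) \<longlonglongrightarrow> 0"
        by (intro tendsto_eventually) (auto simp: eventually_sequentially)
      then have "of_real l * m 0 = 0" by (rule LIMSEQ_unique[OF lim])
      then show False using e(2) m0 by simp
    next
      case False
      then have "(\<lambda>n. conv M (R n) m 0) = (\<lambda>n. of_real (a m) * m 0)" using RS by auto
      then have "of_real l * m 0 = of_real (a m) * m 0" using lim by (auto simp: LIMSEQ_const_iff)
      then have "a m = l" using m0 by simp
      then have am: "a m > 0" using a0[of m] e(2) by simp
      \<comment> \<open>Adding the missed \<open>m\<close> to \<open>T n\<close> raises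
        \<open>q\<close> by this fixed amount, whereas \<open>q (T n)\<close> is within
        \<open>1 / Suc n\<close> of the supremum.\<close>
      have "a m * sqnorm m \<le> 1 / Suc n" for n
      proof -
        have "insert m (T n) \<in> \<F>" using T[of n] m(1) by (auto simp: \<F>_def)
        moreover have "q (insert m (T n)) = a m * sqnorm m + q (T n)"
          unfolding q_def using False T[of n] by (subst sum.insert) (auto simp: \<F>_def)
        ultimately show ?thesis using qle[of "insert m (T n)"] qT[of n] by linarith
      qed
      then have "a m * sqnorm m \<le> 0" by (rule le_zero_if_le_inverse_Suc)
      then show False using am mm(6) by (simp add: mult_le_0_iff)
    qed
  qed
  then have "uniform_limit UNIV R (\<lambda>x. 0) sequentially" using Q by simp
  then obtain n where "\<And>x. norm (R n x) < \<epsilon>"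
    using uniform_limitD[OF _ assms] by (fastforce simp: eventually_sequentially)
  then have "norm (P x - (\<Sum>e\<in>T n. of_real (a e) * e x)) \<le> \<epsilon>" for x
    by (simp add: R_def less_imp_le)
  then show thesis using that[of "T n"] T[of n] by (simp add: P_def a_def \<F>_def)
qed

end
end

section \<open>Integrality of multiplicities and the spectral gap\<close>

context compact_haar
begin

text \<open>Continuous kernels of orthogonal projections on L2; the integral over the diagonal is
  the trace, that is, the rank.\<close>

definition proj_kernel :: "('g \<times> 'g \<Rightarrow> complex) \<Rightarrow> bool" where
  "proj_kernel k \<longleftrightarrow> continuous_on UNIV k \<and> (\<forall>x y. k (y,x) = cnj (k (x,y))) \<and>
     (\<forall>x z. (\<integral>y. k (x,y) * k (y,z) \<partial>M) = k (x,z))"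

lemma proj_kernel_diag:
  assumes "proj_kernel k"
  shows "k (x,x) = of_real (\<integral>y. (norm (k (x,y)))\<^sup>2 \<partial>M)"
proof -
  have k: "k (y,x) = cnj (k (x,y))" "(\<integral>y. k (x,y) * k (y,z) \<partial>M) = k (x,z)" for x y z
    using assms unfolding proj_kernel_def by blast+
  have "k (x,y) * cnj (k (x,y)) = k (x,y) * k (y,x)" for y
    by (simp only: k(1)[symmetric])
  then show ?thesis
    unfolding integral_complex_of_real[symmetric] complex_norm_square
    using k(2)[of x x] by (simp only:)
qed

text \<open>A nonzero column \<open>f\<close> of \<open>k\<close> spans a line in the range, and its
  square norm is the diagonal value \<open>a\<close>. Subtracting the projection onto this line
  lowers the trace by exactly 1; traces stay nonnegative, so the descent ends at the zero
  kernel.\<close>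

lemma proj_kernel_trace_nat:
  assumes "proj_kernel k"
  shows "\<exists>n::nat. (\<integral>x. k (x,x) \<partial>M) = of_nat n"
  using assms
proof (induction "nat \<lfloor>Re (\<integral>x. k (x,x) \<partial>M)\<rfloor>" arbitrary: k rule: less_induct)
  case less
  have k: "continuous_on UNIV k" "\<And>x y. k (y,x) = cnj (k (x,y))"
    "\<And>x z. (\<integral>y. k (x,y) * k (y,z) \<partial>M) = k (x,z)"
    using less.prems unfolding proj_kernel_def by blast+
  have kd: "continuous_on UNIV (\<lambda>x. k (x,x))"
    by (intro continuous_on_comp_UNIV[OF k(1)] continuous_intros)
  show ?case
  proof (cases "\<forall>x y. k (x,y) = 0")
    case True
    then show ?thesis by (intro exI[of _ 0]) simp
  next
    case False
    then obtain x0 y0 where n: "k (x0,y0) \<noteq> 0" by blast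
    define f where "f x = k (x,y0)" for x
    define a where "a = (\<integral>y. (norm (k (y0,y)))\<^sup>2 \<partial>M)"
    have a: "k (y0,y0) = of_real a" unfolding a_def by (rule proj_kernel_diag[OF less.prems])
    have a0: "a \<noteq> 0"
    proof
      assume "a = 0"
      then have "(norm (k (y0,x0)))\<^sup>2 = 0"
        unfolding a_def
        by (intro cont_integral_zero[of "\<lambda>y. (norm (k (y0,y)))\<^sup>2"] continuous_intros cont_section2[OF k(1)]) auto
      then show False using n k(2)[of x0 y0] by simp
    qed
    have fc: "continuous_on UNIV f" unfolding f_def by (rule cont_section1[OF k(1)])
    define k' where "k' p = k p - f (fst p) * cnj (f (snd p)) / of_real a" for p
    have cf: "cnj (f y) = k (y0,y)" for y unfolding f_def by (rule k(2)[symmetric])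
    have tr: "(\<integral>x. k' (x,x) \<partial>M) = (\<integral>x. k (x,x) \<partial>M) - 1"
    proof -
      have "(\<integral>x. f x * cnj (f x) / of_real a \<partial>M) = (\<integral>x. k (y0,x) * k (x,y0) \<partial>M) / of_real a"
        unfolding cf by (simp add: f_def mult.commute)
      then have "(\<integral>x. f x * cnj (f x) / of_real a \<partial>M) = 1"
        unfolding k(3) a using a0 by simp
      moreover have "integrable M (\<lambda>x. f x * cnj (f x) / of_real a)"
        by (intro cont_integrable continuous_intros fc) (use a0 in auto)
      ultimately show ?thesis using cont_integrable[OF kd] by (simp add: k'_def)
    qed
    have pk: "proj_kernel k'"
      unfolding proj_kernel_def
    proof (intro conjI allI)
      show "continuous_on UNIV k'" unfolding k'_def
        by (intro continuous_intros k(1) continuous_on_comp_UNIV[OF fc]) (use a0 in auto)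
      show "k' (y,x) = cnj (k' (x,y))" for x y unfolding k'_def using k(2)[of y x] by (simp add: mult.commute)
      fix x z
      let ?A = "complex_of_real a"
      have "(\<integral>y. k' (x,y) * k' (y,z) \<partial>M) =
        (\<integral>y. k (x,y) * k (y,z) - (k (x,y) * k (y,y0)) * (cnj (f z) / ?A) - (f x / ?A) * (k (y0,y) * k (y,z))
          + (f x * cnj (f z) / (?A * ?A)) * (k (y0,y) * k (y,y0)) \<partial>M)"
        using a0 by (intro Bochner_Integration.integral_cong refl)
          (simp add: k'_def cf, simp add: f_def field_simps)
      also have "\<dots> = k (x,z) - f x * (cnj (f z) / ?A) - (f x / ?A) * cnj (f z) + (f x * cnj (f z) / (?A * ?A)) * ?A"
      proof -
        have i: "integrable M (\<lambda>y. k (p,y) * k (y,q))" for p q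
          by (intro cont_integrable continuous_intros cont_section1[OF k(1)] cont_section2[OF k(1)])
        show ?thesis using i k(3) a by (simp add: cf) (simp add: f_def)
      qed
      also have "\<dots> = k' (x,z)" using a0 by (simp add: k'_def)
      finally show "(\<integral>y. k' (x,y) * k' (y,z) \<partial>M) = k' (x,z)" .
    qed
    have "0 \<le> Re (\<integral>x. k' (x,x) \<partial>M)"
      unfolding proj_kernel_diag[OF pk] integral_complex_of_real by simp
    then have "nat \<lfloor>Re (\<integral>x. k' (x,x) \<partial>M)\<rfloor> < nat \<lfloor>Re (\<integral>x. k (x,x) \<partial>M)\<rfloor>"
      unfolding tr by simp
    then obtain n :: nat where "(\<integral>x. k' (x,x) \<partial>M) = of_nat n" using less.hyps pk by blast
    then have "(\<integral>x. k (x,x) \<partial>M) = of_nat (Suc n)" using tr by (simp add: algebra_simps)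
    then show ?thesis by blast
  qed
qed

text \<open>
  Up to conjugation, the kernel \<open>k\<close> below is the projection of the span of the translates of \<open>e\<close>, on which
  \<open>G\<close> acts by conjugation, onto its \<open>t\<close>-isotypic part.
\<close>

lemma multiplicity_nat:
  assumes e: "minimal e" and t: "minimal t"
  shows "\<exists>n::nat. of_real (sqnorm e) * (\<integral>g. t g * of_real ((norm (nch e g))\<^sup>2) \<partial>M) = of_nat n"
proof -
  note ee = idemD[OF minimal_idem[OF e]] and tt = idemD[OF minimal_idem[OF t]]
  have ec: "continuous_on UNIV e" and tc: "continuous_on UNIV t" using ee tt class_fun_cont by blast+
  note cont = continuous_intros continuous_on_comp_UNIV[OF ec] continuous_on_comp_UNIV[OF tc]
  define k where "k p = (\<integral>g. t g * e (- fst p + g + snd p - g) \<partial>M)" for p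
  have kc: "continuous_on UNIV k"
    unfolding k_def
    using weighted_param_cont[OF cont_integrable[OF tc], of "\<lambda>q. e (- fst (snd q) + fst q + snd (snd q) - fst q)"]
    by (simp add: cont)
  have "proj_kernel k"
    unfolding proj_kernel_def
  proof (intro conjI allI kc)
    fix x y
    have m: "(\<lambda>g. t (- g) * e (g - y - g + x)) \<in> borel_measurable borel"
      by (intro borel_measurable_continuous_onI cont)
    have "cnj (k (x,y)) = (\<integral>g. cnj (t g) * cnj (e (- x + g + y - g)) \<partial>M)"
      by (simp add: k_def flip: Bochner_Integration.integral_cnj)
    also have "\<dots> = (\<integral>g. t (- g) * e (g - y - g + x) \<partial>M)"
      unfolding tt(4)[symmetric] ee(4)[symmetric]
      by (simp add: group_normalise del: add_uminus_conv_diff)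
    also have "\<dots> = (\<integral>g. t g * e (- g - y + g + x) \<partial>M)"
      using integral_inverse[OF m] by simp
    also have "\<dots> = k (y,x)"
    proof -
      have "e (- g - y + g + x) = e (- y + g + x - g)" for g
        using class_fun_comm[OF ee(1), of "- g" "- y + g + x"]
        by (simp add: group_normalise del: add_uminus_conv_diff)
      then show ?thesis by (simp add: k_def)
    qed
    finally show "k (y,x) = cnj (k (x,y))" by simp
  next
    fix x z
    have m1: "(\<lambda>y. e (- g - x + g + y) * e (- y + v)) \<in> borel_measurable borel" for g v
      by (intro borel_measurable_continuous_onI cont)
    \<comment> \<open>After the class property moves the conjugation by \<open>g\<close> into a left
      translation, this is \<open>conv M e e = e\<close>.\<close>
    have i1: "(\<integral>y. e (- x + g + y - g) * e (- y + v) \<partial>M) = e (- x + g + v - g)" for g v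
    proof -
      have cl: "e (- x + g + w - g) = e (- g - x + g + w)" for w
        using class_fun_comm[OF ee(1), of "- g" "- x + g + w"]
        by (simp add: group_normalise del: add_uminus_conv_diff)
      have "(\<integral>y. e (- x + g + y - g) * e (- y + v) \<partial>M) = (\<integral>y. e y * e (- y + (- g - x + g + v)) \<partial>M)"
        unfolding cl using integral_left[OF m1[of g v], of "- (- g - x + g)"]
        by (simp add: group_normalise del: add_uminus_conv_diff)
      also have "\<dots> = e (- g - x + g + v)" using fun_cong[OF ee(3)] by (simp add: conv_def)
      finally show ?thesis by (simp add: cl)
    qed
    have i2: "(\<integral>y. e (- x + g + y - g) * k (y,z) \<partial>M) = (\<integral>h. t (- g + h) * e (- x + h + z - h) \<partial>M)" for g
    proof -
      have "(\<integral>y. e (- x + g + y - g) * k (y,z) \<partial>M)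
         = (\<integral>y. (\<integral>h. e (- x + g + y - g) * (t h * e (- y + h + z - h)) \<partial>M) \<partial>M)"
        by (simp add: k_def)
      also have "\<dots> = (\<integral>h. (\<integral>y. e (- x + g + y - g) * (t h * e (- y + h + z - h)) \<partial>M) \<partial>M)"
        using cont_fubini[of "\<lambda>p. e (- x + g + fst p - g) * (t (snd p) * e (- fst p + snd p + z - snd p))"]
        by (simp add: cont)
      also have "\<dots> = (\<integral>h. t h * (\<integral>y. e (- x + g + y - g) * e (- y + (h + z - h)) \<partial>M) \<partial>M)"
        by (simp add: mult.left_commute group_normalise del: add_uminus_conv_diff)
      also have "\<dots> = (\<integral>h. t h * e (- x + (g + h) + z - (g + h)) \<partial>M)"
        unfolding i1 by (simp add: group_normalise del: add_uminus_conv_diff)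
      also have "\<dots> = (\<integral>h. t (- g + h) * e (- x + h + z - h) \<partial>M)"
      proof -
        have "(\<lambda>h. t (- g + h) * e (- x + h + z - h)) \<in> borel_measurable borel"
          by (intro borel_measurable_continuous_onI cont)
        from integral_left[OF this, of g] show ?thesis by simp
      qed
      finally show ?thesis .
    qed
    have "(\<integral>y. k (x,y) * k (y,z) \<partial>M) = (\<integral>y. (\<integral>g. t g * e (- x + g + y - g) * k (y,z) \<partial>M) \<partial>M)"
      by (simp add: k_def[of "(x, _)"])
    also have "\<dots> = (\<integral>g. (\<integral>y. t g * e (- x + g + y - g) * k (y,z) \<partial>M) \<partial>M)"
      using cont_fubini[of "\<lambda>p. t (snd p) * e (- x + snd p + fst p - snd p) * k (fst p, z)"]
      by (simp add: cont continuous_on_comp_UNIV[OF kc])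
    also have "\<dots> = (\<integral>g. t g * (\<integral>h. t (- g + h) * e (- x + h + z - h) \<partial>M) \<partial>M)"
      by (simp add: mult.assoc i2)
    also have "\<dots> = (\<integral>g. (\<integral>h. t g * (t (- g + h) * e (- x + h + z - h)) \<partial>M) \<partial>M)"
      by simp
    also have "\<dots> = (\<integral>h. (\<integral>g. t g * (t (- g + h) * e (- x + h + z - h)) \<partial>M) \<partial>M)"
      using cont_fubini[of "\<lambda>p. t (fst p) * (t (- fst p + snd p) * e (- x + snd p + z - snd p))"]
      by (simp add: cont)
    also have "\<dots> = (\<integral>h. conv M t t h * e (- x + h + z - h) \<partial>M)"
      by (simp add: conv_def mult.assoc[symmetric])
    also have "\<dots> = k (x,z)" using tt(3) by (simp add: k_def)
    finally show "(\<integral>y. k (x,y) * k (y,z) \<partial>M) = k (x,z)" .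
  qed
  \<comment> \<open>On the diagonal the argument of \<open>e\<close> is a commutator, and the
    functional equation at \<open>- g\<close> and \<open>g\<close> evaluates the average over
    \<open>x\<close>.\<close>
  moreover have "(\<integral>x. k (x,x) \<partial>M) = of_real (sqnorm e) * (\<integral>g. t g * of_real ((norm (nch e g))\<^sup>2) \<partial>M)"
  proof -
    have "(\<integral>x. k (x,x) \<partial>M) = (\<integral>g. (\<integral>x. t g * e (- x + g + x - g) \<partial>M) \<partial>M)"
      unfolding k_def using cont_fubini[of "\<lambda>p. t (snd p) * e (- fst p + snd p + fst p - snd p)"]
      by (simp add: cont)
    also have "\<dots> = (\<integral>g. t g * (of_real (sqnorm e) * of_real ((norm (nch e g))\<^sup>2)) \<partial>M)"
    proof -
      have "(\<integral>x. e (- x + g + x - g) \<partial>M) = of_real (sqnorm e) * of_real ((norm (nch e g))\<^sup>2)" for g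
      proof -
        have m: "(\<lambda>x. e (- x + g + x - g)) \<in> borel_measurable borel"
          by (intro borel_measurable_continuous_onI cont)
        have "(\<integral>x. e (- x + g + x - g) \<partial>M) = (\<integral>x. e (x + g - x - g) \<partial>M)"
          using integral_inverse[OF m] by simp
        also have "\<dots> = (\<integral>x. e (- g + x + g - x) \<partial>M)"
        proof -
          have "e (x + g - x - g) = e (- g + x + g - x)" for x
            using class_fun_comm[OF ee(1), of "x + g - x" "- g"]
            by (simp add: group_normalise del: add_uminus_conv_diff)
          then show ?thesis by simp
        qed
        also have "\<dots> = of_real (sqnorm e) * (\<integral>x. nch e (- g + x + g - x) \<partial>M)"
          using ee(6) by (simp add: nch_def)
        finally show ?thesis
          unfolding functional_equation[OF e] nch_uminus[OF minimal_idem[OF e]] complex_norm_square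
          by (simp add: mult.commute)
      qed
      then show ?thesis by simp
    qed
    also have "\<dots> = (\<integral>g. of_real (sqnorm e) * (t g * of_real ((norm (nch e g))\<^sup>2)) \<partial>M)"
      by (simp add: mult_ac)
    finally show ?thesis by simp
  qed
  ultimately show ?thesis using proj_kernel_trace_nat by metis
qed

text \<open>Equality case of Cauchy-Schwarz: by \<open>conv M t t = t\<close>, the translate
  \<open>y \<mapsto> t (x + y)\<close> has inner product \<open>t x = sqnorm t\<close> with
  \<open>t\<close>, and both functions have square norm \<open>sqnorm t\<close>. So their difference
  \<open>d\<close> vanishes.\<close>

lemma nch_translate:
  assumes "idem t" "nch t x = 1"
  shows "nch t (x + y) = nch t y"
proof -
  note tt = idemD[OF assms(1)]
  have tc: "continuous_on UNIV t" using tt class_fun_cont by blast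
  note cont = continuous_intros continuous_on_comp_UNIV[OF tc]
  define d where "d y = t (x + y) - t y" for y
  have dc: "continuous_on UNIV d" unfolding d_def by (intro cont tc)
  have tx: "t x = of_real (sqnorm t)" using assms(2) tt(6) by (simp add: nch_def)
  have m: "(\<lambda>y. t y * t (- y + x)) \<in> borel_measurable borel"
    by (intro borel_measurable_continuous_onI cont tc)
  have 1: "(\<integral>y. t (x + y) * cnj (t y) \<partial>M) = of_real (sqnorm t)"
  proof -
    have "(\<integral>y. t (x + y) * cnj (t y) \<partial>M) = (\<integral>y. t (x + y) * t (- (x + y) + x) \<partial>M)"
      using tt(4) by (simp add: minus_add diff_conv_add_uminus add.assoc del: add_uminus_conv_diff)
    also have "\<dots> = (\<integral>y. t y * t (- y + x) \<partial>M)" by (rule integral_left[OF m])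
    also have "\<dots> = t x" using fun_cong[OF tt(3), of x] by (simp add: conv_def)
    finally show ?thesis using tx by simp
  qed
  have 2: "(\<integral>y. t y * cnj (t (x + y)) \<partial>M) = of_real (sqnorm t)"
    using arg_cong[OF 1, of cnj] by (simp add: mult.commute flip: Bochner_Integration.integral_cnj)
  have 3: "(\<integral>y. t y * cnj (t y) \<partial>M) = of_real (sqnorm t)"
    using conv_star_0[of t t] conv_star_self[of t] by simp
  have 4: "(\<integral>y. t (x + y) * cnj (t (x + y)) \<partial>M) = of_real (sqnorm t)"
  proof -
    have "(\<lambda>y. t y * cnj (t y)) \<in> borel_measurable borel"
      by (intro borel_measurable_continuous_onI cont tc)
    from integral_left[OF this, of x] 3 show ?thesis by simp
  qed
  have i: "integrable M (\<lambda>y. t (x + y) * cnj (t (x + y)))" "integrable M (\<lambda>y. t (x + y) * cnj (t y))"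
    "integrable M (\<lambda>y. t y * cnj (t (x + y)))" "integrable M (\<lambda>y. t y * cnj (t y))"
    by (intro cont_integrable cont tc)+
  have "complex_of_real (sqnorm d) = (\<integral>y. d y * cnj (d y) \<partial>M)"
    using conv_star_0[of d d] conv_star_self[of d] by simp
  also have "\<dots> = (\<integral>y. t (x + y) * cnj (t (x + y)) - t (x + y) * cnj (t y) - t y * cnj (t (x + y)) + t y * cnj (t y) \<partial>M)"
    by (simp add: d_def algebra_simps)
  also have "\<dots> = 0"
    using i 1 2 3 4 by simp
  finally have "sqnorm d = 0" by simp
  then have "d y = 0" using sqnorm_eq_0 dc by blast
  then show ?thesis by (simp add: d_def nch_def)
qed

lemma nch_sqnorm:
  assumes "idem e" shows "sqnorm e * (\<integral>g. (norm (nch e g))\<^sup>2 \<partial>M) = 1"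
proof -
  have "(\<integral>g. (norm (nch e g))\<^sup>2 \<partial>M) = sqnorm e / (sqnorm e)\<^sup>2"
    by (simp add: nch_def norm_divide power_divide sqnorm_def[symmetric])
  then show ?thesis using idemD(6)[OF assms] by (simp add: power2_eq_square)
qed

text \<open>\<open>x + U\<close> is a neighbourhood of \<open>x\<close> inside \<open>H\<close>, so
  \<open>H\<close> is clopen. This serves both for the kernel of \<open>t\<close> and for
  centralisers.\<close>

lemma connected_group_closed_subset:
  fixes H U :: "'g set"
  assumes conn: "connected (UNIV :: 'g set)" and H: "closed H"
    and U: "open U" "0 \<in> U" and HU: "\<And>x y. x \<in> H \<Longrightarrow> y \<in> U \<Longrightarrow> x + y \<in> H" and 0: "0 \<in> H"
  shows "H = UNIV"
proof -
  have "open H"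
    unfolding open_subopen[of H]
  proof
    fix x assume x: "x \<in> H"
    have "open ((\<lambda>y. - x + y) -` U)" by (rule open_vimage[OF U(1) cont_translate])
    moreover have "x \<in> (\<lambda>y. - x + y) -` U" using U by simp
    moreover have "(\<lambda>y. - x + y) -` U \<subseteq> H"
    proof
      fix z assume "z \<in> (\<lambda>y. - x + y) -` U"
      then have "x + (- x + z) \<in> H" by (intro HU x) simp
      then show "z \<in> H" by simp
    qed
    ultimately show "\<exists>T. open T \<and> x \<in> T \<and> T \<subseteq> H" by blast
  qed
  then show ?thesis using conn H 0 connected_clopen[of "UNIV::'g set"] by auto
qed

text \<open>The number in question is \<open>1 - n / D\<close> with the integer \<open>n\<close> of
  \<open>multiplicity_nat\<close>. If it were 0, \<open>nch t\<close> would be 1 wherever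
  \<open>nch e\<close> is nonzero, a neighbourhood of 0, and by connectedness everywhere. So
  \<open>n < D\<close>, and integrality turns this into a margin independent of
  \<open>e\<close>.\<close>

lemma spectral_gap:
  assumes conn: "connected (UNIV :: 'g set)" and t: "minimal t" and nt: "nch t x0 \<noteq> 1"
  obtains c where "c > 0" "\<And>e. minimal e \<Longrightarrow>
    \<exists>r. r \<ge> c \<and> of_real (sqnorm e) * (\<integral>g. of_real ((norm (nch e g))\<^sup>2) * (1 - nch t g) \<partial>M) = of_real r"
proof -
  note tt = idemD[OF minimal_idem[OF t]]
  define D where "D = sqnorm t"
  have D: "D > 0" using tt(6) by (simp add: D_def)
  \<comment> \<open>From \<open>n < D\<close> follows \<open>n \<le> \<lceil>D\<rceil> - 1\<close>,
    hence \<open>1 - n / D \<ge> c\<close>. The ceiling appears because \<open>D\<close> is handled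
    as a real number.\<close>
  define c where "c = (D - of_int \<lceil>D\<rceil> + 1) / D"
  have c: "c > 0" unfolding c_def using D by (intro divide_pos_pos) linarith+
  have ntc: "continuous_on UNIV (nch t)" using nch_class minimal_idem t class_fun_cont by blast
  have "\<exists>r. r \<ge> c \<and> of_real (sqnorm e) * (\<integral>g. of_real ((norm (nch e g))\<^sup>2) * (1 - nch t g) \<partial>M) = of_real r"
    if e: "minimal e" for e
  proof -
    note ee = idemD[OF minimal_idem[OF e]]
    have nec: "continuous_on UNIV (nch e)" using nch_class minimal_idem e class_fun_cont by blast
    obtain n :: nat where n: "of_real (sqnorm e) * (\<integral>g. t g * of_real ((norm (nch e g))\<^sup>2) \<partial>M) = of_nat n"
      using multiplicity_nat[OF e t] by blast
    have i: "integrable M (\<lambda>g. of_real ((norm (nch e g))\<^sup>2) :: complex)"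
      "integrable M (\<lambda>g. of_real ((norm (nch e g))\<^sup>2) * nch t g)"
      by (intro cont_integrable continuous_intros nec ntc)+
    have "of_real (sqnorm e) * (\<integral>g. of_real ((norm (nch e g))\<^sup>2) * nch t g \<partial>M) = complex_of_real (n / D)"
    proof -
      have "(\<integral>g. t g * of_real ((norm (nch e g))\<^sup>2) \<partial>M)
          = (\<integral>g. of_real D * (of_real ((norm (nch e g))\<^sup>2) * nch t g) \<partial>M)"
        using D by (simp add: nch_def D_def mult.commute)
      also have "\<dots> = of_real D * (\<integral>g. of_real ((norm (nch e g))\<^sup>2) * nch t g \<partial>M)" by simp
      finally have "of_real D * (of_real (sqnorm e) * (\<integral>g. of_real ((norm (nch e g))\<^sup>2) * nch t g \<partial>M)) = of_nat n"
        using n by (simp add: mult_ac)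
      then show ?thesis using D by (simp add: field_simps)
    qed
    moreover have "of_real (sqnorm e) * (\<integral>g. of_real ((norm (nch e g))\<^sup>2) \<partial>M) = (1 :: complex)"
      unfolding integral_complex_of_real of_real_mult[symmetric] nch_sqnorm[OF minimal_idem[OF e]] by simp
    ultimately have eq: "of_real (sqnorm e) * (\<integral>g. of_real ((norm (nch e g))\<^sup>2) * (1 - nch t g) \<partial>M)
        = complex_of_real (1 - n / D)"
      using i by (simp add: right_diff_distrib)
    have re: "sqnorm e * (\<integral>g. (norm (nch e g))\<^sup>2 * (1 - Re (nch t g)) \<partial>M) = 1 - n / D"
    proof -
      have "integrable M (\<lambda>g. of_real ((norm (nch e g))\<^sup>2) * (1 - nch t g))"
        by (intro cont_integrable continuous_intros nec ntc)
      then have "Re (\<integral>g. of_real ((norm (nch e g))\<^sup>2) * (1 - nch t g) \<partial>M)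
          = (\<integral>g. (norm (nch e g))\<^sup>2 * (1 - Re (nch t g)) \<partial>M)"
        by (subst integral_Re[symmetric]) (auto simp flip: of_real_power)
      then show ?thesis using arg_cong[OF eq, of Re] by simp
    qed
    have ge: "0 \<le> (norm (nch e g))\<^sup>2 * (1 - Re (nch t g))" for g
      using nch_bound[OF minimal_idem[OF t], of g] complex_Re_le_cmod[of "nch t g"] by simp
    have "1 - n / D \<noteq> 0"
    proof
      assume "1 - n / D = 0"
      then have z: "(\<integral>g. (norm (nch e g))\<^sup>2 * (1 - Re (nch t g)) \<partial>M) = 0" using re ee(6) by simp
      have all: "(norm (nch e g))\<^sup>2 * (1 - Re (nch t g)) = 0" for g
        by (rule cont_integral_zero[OF _ ge z]) (intro continuous_intros nec ntc)
      define U where "U = {g. nch e g \<noteq> 0}"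
      have U: "open U" "0 \<in> U"
        using nch_0[OF minimal_idem[OF e]] unfolding U_def
        by (auto intro!: open_Collect_neq nec continuous_intros)
      have one: "nch t g = 1" if "g \<in> U" for g
      proof -
        have "Re (nch t g) = 1" using all[of g] that by (simp add: U_def)
        moreover have "(Re (nch t g))\<^sup>2 + (Im (nch t g))\<^sup>2 \<le> 1"
          using nch_bound[OF minimal_idem[OF t], of g]
          by (metis cmod_power2 norm_ge_zero power_le_one)
        ultimately show ?thesis by (simp add: complex_eq_iff)
      qed
      define H where "H = {g. nch t g = 1}"
      have "closed H" unfolding H_def by (intro closed_Collect_eq ntc continuous_intros)
      moreover have "0 \<in> H" using nch_0[OF minimal_idem[OF t]] by (simp add: H_def)
      moreover have "x + y \<in> H" if "x \<in> H" "y \<in> U" for x y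
        using that one nch_translate[OF minimal_idem[OF t]] by (simp add: H_def)
      ultimately have "H = UNIV" using connected_group_closed_subset[OF conn _ U] by blast
      then show False using nt by (auto simp: H_def)
    qed
    moreover have "1 - n / D \<ge> 0"
      unfolding re[symmetric] using ge ee(6) by (intro mult_nonneg_nonneg integral_nonneg) auto
    ultimately have "n / D < 1" by linarith
    then have "real n < D" using D by (simp add: field_simps)
    then have "int n < \<lceil>D\<rceil>" by (simp add: less_ceiling_iff)
    then have "real n \<le> of_int \<lceil>D\<rceil> - 1" by linarith
    then have "n / D \<le> (of_int \<lceil>D\<rceil> - 1) / D" using D by (intro divide_right_mono) auto
    moreover have "c = 1 - (of_int \<lceil>D\<rceil> - 1) / D" using D by (simp add: c_def field_simps)
    ultimately have "1 - n / D \<ge> c" by linarith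
    then show ?thesis using eq by blast
  qed
  then show thesis using that c by blast
qed

end

section \<open>Averages of characters concentrating on the centre\<close>

context compact_haar
begin

lemma sqnorm_star: "class_fun u \<Longrightarrow> sqnorm (star u) = sqnorm u"
proof -
  assume u: "class_fun u"
  have "(\<lambda>x. (norm (u x))\<^sup>2) \<in> borel_measurable borel"
    by (intro borel_measurable_continuous_onI continuous_intros class_fun_cont[OF u])
  from integral_inverse[OF this] show ?thesis by (simp add: sqnorm_def star_def)
qed

lemma conj_nbhd:
  assumes "open W" "(0::'g) \<in> W"
  obtains V where "open V" "0 \<in> V" "\<And>x t. x \<in> V \<Longrightarrow> t + x - t \<in> W"
proof -
  define O' where "O' = (\<lambda>p::'g \<times> 'g. snd p + fst p - snd p) -` W"
  have "open O'" unfolding O'_def by (rule open_vimage[OF assms(1)]) (intro continuous_intros)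
  moreover have "{0} \<times> UNIV \<subseteq> O'" using assms(2) by (auto simp: O'_def)
  ultimately have "\<exists>V. 0 \<in> V \<and> open V \<and> V \<times> UNIV \<subseteq> O'"
    by (rule Elementary_Topology.tube_lemma[OF compact_group])
  then obtain V where V: "0 \<in> V" "open V" "V \<times> UNIV \<subseteq> O'" by blast
  have "t + x - t \<in> W" if "x \<in> V" for x t
  proof -
    have "(x,t) \<in> O'" using V that by blast
    then show ?thesis by (simp add: O'_def)
  qed
  then show thesis using that V by blast
qed

text \<open>Averaging a Urysohn function over conjugation gives a class function, still supported
  near 0 because \<open>conj_nbhd\<close> makes smallness stable under conjugation. Since
  \<open>A - B\<close> lies in \<open>W\<close>, so does the set where
  \<open>conv M u (star u)\<close> is nonzero.\<close>

lemma bump: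
  assumes W: "open W" "(0::'g) \<in> W"
  obtains u where "class_fun u" "sqnorm u > 0" "\<And>x. x \<notin> W \<Longrightarrow> conv M u (star u) x = 0"
proof -
  have "open ((\<lambda>p::'g \<times> 'g. fst p - snd p) -` W)"
    by (rule open_vimage[OF W(1)]) (intro continuous_intros)
  moreover have "(0,0) \<in> (\<lambda>p::'g \<times> 'g. fst p - snd p) -` W" using W by simp
  ultimately obtain A B where AB: "open A" "open B" "(0,0) \<in> A \<times> B"
    "A \<times> B \<subseteq> (\<lambda>p. fst p - snd p) -` W"
    by (rule open_prod_elim)
  then have sub: "a - b \<in> W" if "a \<in> A" "b \<in> B" for a b using that by auto
  have AB': "open (A \<inter> B)" "0 \<in> A \<inter> B" using AB by auto
  obtain V where V: "open V" "0 \<in> V" "\<And>x t. x \<in> V \<Longrightarrow> t + x - t \<in> A \<inter> B"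
    using conj_nbhd[OF AB'] by blast
  have V0: "{0} \<subseteq> V" using V by simp
  obtain \<phi> :: "'g \<Rightarrow> real" where \<phi>: "continuous_on UNIV \<phi>" "\<And>x. x \<in> {0} \<Longrightarrow> \<phi> x = 1" "\<And>x. x \<notin> V \<Longrightarrow> \<phi> x = 0"
    using urysohn[OF _ V(1) V0] by (metis closed_singleton)
  have pc: "continuous_on UNIV (\<lambda>x. complex_of_real (\<phi> x))" by (intro continuous_intros \<phi>)
  define u where "u x = (\<integral>t. complex_of_real (\<phi> (t + x - t)) \<partial>M)" for x
  have uc: "class_fun u" unfolding class_fun_def
  proof (intro conjI allI)
    show "continuous_on UNIV u"
    proof -
      have "continuous_on UNIV (\<lambda>p::'g \<times> 'g. complex_of_real (\<phi> (fst p + snd p - fst p)))"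
        by (intro continuous_on_comp_UNIV[OF pc] continuous_intros)
      from cont_param[OF this] show ?thesis unfolding u_def fst_conv snd_conv .
    qed
    fix x z
    have m: "(\<lambda>t. complex_of_real (\<phi> (t + (x + z) - t))) \<in> borel_measurable borel"
      by (intro borel_measurable_continuous_onI continuous_on_comp_UNIV[OF pc] continuous_intros)
    show "u (x + z) = u (z + x)"
      unfolding u_def using integral_right[OF m, of "- x"]
      by (simp add: group_normalise del: add_uminus_conv_diff)
  qed
  have supp: "x \<in> A \<inter> B" if "u x \<noteq> 0" for x
  proof -
    have "\<exists>t. \<phi> (t + x - t) \<noteq> 0"
    proof (rule ccontr)
      assume "\<nexists>t. \<phi> (t + x - t) \<noteq> 0"
      then show False using that by (simp add: u_def)
    qed
    then obtain t where "t + x - t \<in> V" using \<phi>(3) by blast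
    from V(3)[OF this, of "- t"] show ?thesis
      by (simp add: group_normalise del: add_uminus_conv_diff)
  qed
  have "u 0 = 1" using \<phi>(2) by (simp add: u_def)
  then have "u \<noteq> (\<lambda>x. 0)" by auto
  then have "sqnorm u > 0" using sqnorm_pos uc by blast
  moreover have "conv M u (star u) x = 0" if "x \<notin> W" for x
  proof -
    have "u y * cnj (u (- x + y)) = 0" for y
    proof (rule ccontr)
      assume "u y * cnj (u (- x + y)) \<noteq> 0"
      then have "y \<in> A" "- x + y \<in> B" using supp[of y] supp[of "- x + y"] by auto
      then have "y - (- x + y) \<in> W" by (rule sub)
      then show False using that by (simp add: group_normalise del: add_uminus_conv_diff)
    qed
    then have "(\<integral>y. u y * cnj (u (- x + y)) \<partial>M) = 0" by (simp only: Bochner_Integration.integral_zero)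
    then show ?thesis by (simp add: conv_def star_def minus_add)
  qed
  ultimately show thesis using that uc by blast
qed

lemma conv_star_bound:
  assumes "class_fun u"
  shows "norm (conv M u (star u) x) \<le> sqnorm u"
proof -
  have "(norm (conv M u (star u) x))\<^sup>2 \<le> (sqnorm u)\<^sup>2"
    using conv_sup_bound[of u "star u" x] assms class_fun_star[OF assms] class_fun_cont sqnorm_star[OF assms]
    by (simp add: power2_eq_square)
  then show ?thesis by (rule power2_le_imp_le) (simp add: sqnorm_nonneg)
qed

text \<open>\<open>h x\<close> averages \<open>P\<close> over the commutators of \<open>x\<close>,
  so it is a class function invariant under central translations; it is not constant because
  \<open>P\<close> peaks at 0 and vanishes at the commutator \<open>c\<close>. A minimal
  \<open>t\<close> occurring in \<open>h\<close> minus its mean inherits the invariance and cannot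
  be constant.\<close>

lemma separating_minimal:
  assumes nc: "(a::'g) + b \<noteq> b + a"
  obtains t x0 where "minimal t" "nch t x0 \<noteq> 1" "\<And>z. (\<forall>x. z + x = x + z) \<Longrightarrow> nch t z = 1"
proof -
  define c where "c = a + b - a - b"
  have c0: "c \<noteq> 0"
  proof
    assume "c = 0"
    then have "c + (b + a) = b + a" by simp
    moreover have "c + (b + a) = a + b" by (simp add: c_def group_normalise del: add_uminus_conv_diff)
    ultimately show False using nc by simp
  qed
  have W: "open (- {c})" "0 \<in> - {c}" using c0 by auto
  obtain u where u: "class_fun u" "sqnorm u > 0" "\<And>x. x \<notin> - {c} \<Longrightarrow> conv M u (star u) x = 0"
    using bump[OF W] by blast
  define P where "P = conv M u (star u)"
  have Pc: "class_fun P" unfolding P_def by (intro class_fun_conv class_fun_star u)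
  have Pcc: "continuous_on UNIV P" using Pc class_fun_cont by blast
  have Ps: "star P = P" unfolding P_def using star_conv[OF u(1) class_fun_star[OF u(1)]] conv_comm u(1) class_fun_star by simp
  have Pm: "P (- x) = cnj (P x)" for x using fun_cong[OF Ps, of "- x"] by (simp add: star_def)
  have P0: "P 0 = of_real (sqnorm u)" unfolding P_def by (rule conv_star_self)
  have Pb: "norm (P x) \<le> sqnorm u" for x unfolding P_def by (rule conv_star_bound[OF u(1)])
  define h where "h x = (\<integral>t. P (x + t - x - t) \<partial>M)" for x
  have cc: "continuous_on UNIV (\<lambda>t. P (x + t - x - t))" for x
    by (intro continuous_on_comp_UNIV[OF Pcc] continuous_intros)
  have hc: "class_fun h" unfolding class_fun_def
  proof (intro conjI allI)
    show "continuous_on UNIV h"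
      unfolding h_def using cont_param[of "\<lambda>p. P (snd p + fst p - snd p - fst p)"]
      by (simp add: continuous_on_comp_UNIV[OF Pcc] continuous_intros)
    have inv: "h (s + x - s) = h x" for s x
    proof -
      have m: "(\<lambda>t. P (s + x - s + t - (s + x - s) - t)) \<in> borel_measurable borel"
        by (intro borel_measurable_continuous_onI cc)
      have "h (s + x - s) = (\<integral>t. P (s + x - s + (s + t - s) - (s + x - s) - (s + t - s)) \<partial>M)"
        unfolding h_def by (rule integral_conj[OF m, symmetric])
      also have "\<dots> = (\<integral>t. P (s + (x + t - x - t) - s) \<partial>M)"
        by (simp add: group_normalise del: add_uminus_conv_diff)
      also have "\<dots> = h x" by (simp only: class_fun_conj[OF Pc] h_def)
      finally show ?thesis .
    qed
    fix x y
    show "h (x + y) = h (y + x)"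
      using inv[of x "y + x"] by (simp add: group_normalise del: add_uminus_conv_diff)
  qed
  have hs: "h (- x) = cnj (h x)" for x
  proof -
    have "P (- x + t + x - t) = cnj (P (x + t - x - t))" for t
    proof -
      have "P (- x + t + x - t) = P (t + x - t + - x)"
        using class_fun_comm[OF Pc, of "- x" "t + x - t"] by (simp add: group_normalise del: add_uminus_conv_diff)
      also have "t + x - t + - x = - (x + t - x - t)" by (simp add: group_normalise del: add_uminus_conv_diff)
      finally show ?thesis by (simp only: Pm)
    qed
    then show ?thesis by (simp add: h_def flip: Bochner_Integration.integral_cnj)
  qed
  have hz: "h (z + x) = h x" if "\<forall>x. z + x = x + z" for z x
  proof -
    have zc: "z + y = y + z" for y using that by blast
    have "z + x + t - (z + x) - t = x + t - x - t" for t
    proof -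
      have "z + x + t - (z + x) - t = z + (x + t - x) - z - t"
        by (simp add: group_normalise del: add_uminus_conv_diff)
      also have "\<dots> = (x + t - x) + z - z - t" by (simp only: zc)
      finally show ?thesis by (simp add: group_normalise del: add_uminus_conv_diff)
    qed
    then show ?thesis by (simp add: h_def)
  qed
  have h0: "h 0 = of_real (sqnorm u)" by (simp add: h_def P0)
  have ha: "h a \<noteq> h 0"
  proof
    assume "h a = h 0"
    then have "Re (h a) = sqnorm u" using h0 by simp
    then have re: "(\<integral>t. Re (P (a + t - a - t)) \<partial>M) = sqnorm u"
      using cont_integrable[OF cc] by (simp add: h_def)
    have ri: "integrable M (\<lambda>t. Re (P (a + t - a - t)))" by (intro cont_integrable continuous_intros cc)
    have z: "(\<integral>t. sqnorm u - Re (P (a + t - a - t)) \<partial>M) = 0" using re ri by simp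
    \<comment> \<open>The real part of \<open>P\<close> never exceeds \<open>sqnorm u\<close>, so
      equality on average makes it equal at every commutator of \<open>a\<close>, including
      \<open>c\<close>.\<close>
    have "sqnorm u - Re (P (a + b - a - b)) = 0"
      by (rule cont_integral_zero[OF _ _ z])
        (use Pb complex_Re_le_cmod in \<open>auto intro!: continuous_intros cc intro: order_trans\<close>)
    then show False using u(2) u(3)[of c] by (simp add: P_def c_def)
  qed
  \<comment> \<open>Removing the mean excludes the trivial character: \<open>h'\<close> convolved
    with a constant is zero.\<close>
  define m where "m = (\<integral>x. h x \<partial>M)"
  have mr: "cnj m = m"
  proof -
    have "cnj m = (\<integral>x. h (- x) \<partial>M)" by (simp add: m_def hs flip: Bochner_Integration.integral_cnj)
    also have "\<dots> = m" unfolding m_def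
      by (rule integral_inverse) (intro borel_measurable_continuous_onI class_fun_cont[OF hc])
    finally show ?thesis .
  qed
  define h' where "h' x = h x - m" for x
  have h'c: "class_fun h'" unfolding h'_def by (intro class_fun_diff class_fun_const hc)
  have h's: "star h' = h'" using hs mr by (auto simp: star_def h'_def)
  have "h' \<noteq> (\<lambda>x. 0)"
  proof
    assume "h' = (\<lambda>x. 0)"
    then have "h x = m" for x by (simp add: h'_def fun_eq_iff)
    then show False using ha by simp
  qed
  then obtain e l where e: "idem e" "l \<noteq> 0" "conv M h' e = (\<lambda>x. of_real l * e x)"
    using spectral[OF h'c h's] by blast
  obtain t where t: "minimal t" "conv M e t = t" using minimal_exists[OF e(1)] by blast
  note tt = idemD[OF minimal_idem[OF t(1)]]
  have tc: "continuous_on UNIV t" using tt class_fun_cont by blast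
  have "conv M h' t = conv M (conv M h' e) t"
    using conv_class_assoc[OF h'c idemD(1)[OF e(1)] tt(1)] t(2) by simp
  then have ht: "conv M h' t = (\<lambda>x. of_real l * t x)" using e(3) t(2) by (simp add: conv_scale_left)
  have tz: "nch t z = 1" if z: "\<forall>x. z + x = x + z" for z
  proof -
    have mm: "(\<lambda>y. h' y * t (- y + z)) \<in> borel_measurable borel"
      by (intro borel_measurable_continuous_onI continuous_intros class_fun_cont[OF h'c] continuous_on_comp_UNIV[OF tc])
    have "of_real l * t z = conv M h' t z" using ht by simp
    also have "\<dots> = (\<integral>y. h' (z + y) * t (- (z + y) + z) \<partial>M)"
      unfolding conv_def by (rule integral_left[OF mm, symmetric])
    also have "\<dots> = (\<integral>y. h' y * t (- y + 0) \<partial>M)"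
      using hz[OF z] by (simp add: h'_def minus_add diff_conv_add_uminus add.assoc del: add_uminus_conv_diff)
    also have "\<dots> = conv M h' t 0" by (simp only: conv_def)
    also have "\<dots> = of_real l * t 0" using ht by simp
    finally show ?thesis using e(2) tt(5,6) by (simp add: nch_def)
  qed
  have "\<exists>x0. nch t x0 \<noteq> 1"
  proof (rule ccontr)
    assume "\<nexists>x0. nch t x0 \<noteq> 1"
    then have "t x = of_real (sqnorm t)" for x using tt(6) by (simp add: nch_def)
    then have "conv M h' t 0 = (\<integral>y. h' y \<partial>M) * of_real (sqnorm t)" by (simp add: conv_def)
    also have "(\<integral>y. h' y \<partial>M) = 0"
      using class_fun_integrable[OF hc] by (simp add: h'_def m_def)
    finally show False using ht e(2) tt(5,6) by simp
  qed
  then show thesis using that t(1) tz by blast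
qed

text \<open>
  A closed subgroup \<open>C\<close> of positive measure is open: it has a neighbourhood of measure less than twice
  its own, which cannot contain a disjoint translate of \<open>C\<close>.
\<close>

lemma centraliser_null:
  assumes conn: "connected (UNIV :: 'g set)" and y: "\<exists>x. y + x \<noteq> x + (y::'g)"
  shows "emeasure M {t. y + t = t + y} = 0"
proof (rule ccontr)
  define C where "C = {t. y + t = t + y}"
  assume "emeasure M {t. y + t = t + y} \<noteq> 0"
  then have pos: "measure M C > 0"
    by (auto simp: C_def emeasure_eq_measure zero_less_measure_iff)
  have cl: "closed C" unfolding C_def by (intro closed_Collect_eq continuous_intros)
  then have cpt: "compact C" using compact_Int_closed[OF compact_group] by (metis Int_UNIV_left)
  have add: "s + t \<in> C" if "s \<in> C" "t \<in> C" for s t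
  proof -
    have "y + (s + t) = s + (y + t)" using that(1) by (simp add: C_def flip: add.assoc)
    then show ?thesis using that(2) by (simp add: C_def add.assoc)
  qed
  have neg: "- s \<in> C" if "s \<in> C" for s
  proof -
    have "- s + (y + s) + - s = - s + (s + y) + - s" using that by (simp add: C_def)
    then show ?thesis by (simp add: C_def group_normalise del: add_uminus_conv_diff)
  qed
  have "emeasure M C < ennreal (2 * measure M C)"
    using pos by (simp add: emeasure_eq_measure ennreal_less_iff)
  then have "(INF V \<in> {V. open V \<and> C \<subseteq> V}. emeasure M V) < ennreal (2 * measure M C)"
    using emeasure_outer[of C] cl by simp
  then have "\<exists>V\<in>{V. open V \<and> C \<subseteq> V}. emeasure M V < ennreal (2 * measure M C)"
    by (rule INF_less_iff[THEN iffD1])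
  then obtain V where V: "open V" "C \<subseteq> V" "emeasure M V < ennreal (2 * measure M C)" by blast
  have Vm: "measure M V < 2 * measure M C"
    using V(3) by (simp add: emeasure_eq_measure ennreal_less_iff)
  have "open ((\<lambda>p::'g \<times> 'g. fst p + snd p) -` V)" by (rule open_vimage[OF V(1)]) (intro continuous_intros)
  moreover have "{0} \<times> C \<subseteq> (\<lambda>p::'g \<times> 'g. fst p + snd p) -` V" using V by auto
  ultimately have "\<exists>U. 0 \<in> U \<and> open U \<and> U \<times> C \<subseteq> (\<lambda>p::'g \<times> 'g. fst p + snd p) -` V"
    by (rule Elementary_Topology.tube_lemma[OF cpt])
  then obtain U where U: "0 \<in> U" "open U" "U \<times> C \<subseteq> (\<lambda>p::'g \<times> 'g. fst p + snd p) -` V" by blast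
  have UC: "x \<in> C" if "x \<in> U" for x
  proof (rule ccontr)
    assume x: "x \<notin> C"
    define xC where "xC = (\<lambda>z. x + z) ` C"
    have xCb: "xC \<in> sets borel"
      unfolding xC_def by (intro borel_closed compact_imp_closed compact_continuous_image cont_translate cpt)
    have disj: "xC \<inter> C = {}"
    proof (rule ccontr)
      assume "xC \<inter> C \<noteq> {}"
      then obtain s where s: "s \<in> C" "x + s \<in> C" by (auto simp: xC_def)
      then have "x + s + - s \<in> C" using add neg by blast
      then show False using x by (simp add: add.assoc)
    qed
    have sub: "xC \<union> C \<subseteq> V" using U(3) that V(2) by (auto simp: xC_def)
    have "emeasure M xC = emeasure M C"
      using haar cl unfolding xC_def normalised_left_haar_def by simp
    then have "measure M xC = measure M C" by (simp add: measure_def)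
    then have "measure M (xC \<union> C) = 2 * measure M C"
      using finite_measure_Union[of xC C] xCb cl disj by simp
    moreover have "measure M (xC \<union> C) \<le> measure M V"
      using sub V by (intro finite_measure_mono) auto
    ultimately show False using Vm by simp
  qed
  have "0 \<in> C" by (simp add: C_def)
  then have "C = UNIV"
    using connected_group_closed_subset[OF conn cl U(2,1)] add UC by blast
  then show False using y by (auto simp: C_def)
qed

text \<open>The centraliser of a noncentral \<open>y\<close> is null, so it lies in an open
  \<open>V\<close> of small measure; for \<open>t\<close> outside \<open>V\<close> the commutators
  stay away from 0, uniformly for \<open>y'\<close> near \<open>y\<close>. Compactness of
  \<open>K\<close> leaves finitely many sets \<open>W y\<close> to intersect.\<close>

lemma commutators_avoid_identity:
  assumes conn: "connected (UNIV :: 'g set)" and K: "closed K"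
    and KZ: "\<And>y. y \<in> K \<Longrightarrow> \<exists>x. y + x \<noteq> x + (y::'g)" and "\<epsilon> > 0"
  obtains W where "open W" "0 \<in> W" "\<And>y. y \<in> K \<Longrightarrow> measure M {t. y + t - y - t \<in> W} \<le> \<epsilon>"
proof -
  define good where "good y N W \<longleftrightarrow> open N \<and> open W \<and> y \<in> N \<and> 0 \<in> W \<and>
    (\<forall>y'\<in>N. measure M {t. y' + t - y' - t \<in> W} \<le> \<epsilon>)" for y :: 'g and N W
  have "\<exists>p. good y (fst p) (snd p)" if y: "y \<in> K" for y
  proof -
    define C where "C = {t. y + t = t + y}"
    have Cb: "C \<in> sets borel" unfolding C_def by (intro borel_closed closed_Collect_eq continuous_intros)
    have "emeasure M C < ennreal \<epsilon>"
      using centraliser_null[OF conn KZ[OF y]] \<open>\<epsilon> > 0\<close> by (simp add: C_def)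
    then have "(INF V \<in> {V. open V \<and> C \<subseteq> V}. emeasure M V) < ennreal \<epsilon>"
      using emeasure_outer[OF Cb] by simp
    then have "\<exists>V\<in>{V. open V \<and> C \<subseteq> V}. emeasure M V < ennreal \<epsilon>"
      by (rule INF_less_iff[THEN iffD1])
    then obtain V where V: "open V" "C \<subseteq> V" "emeasure M V < ennreal \<epsilon>" by blast
    have Vm: "measure M V \<le> \<epsilon>"
      using V(3) \<open>\<epsilon> > 0\<close> by (simp add: emeasure_eq_measure ennreal_less_iff)
    have cpt: "compact (- V)" using compact_Int_closed[OF compact_group, of "- V"] V(1) by (simp add: closed_Compl)
    \<comment> \<open>The value to be avoided is a coordinate beside \<open>y'\<close>, so one use
      of the tube lemma yields both \<open>N\<close> around \<open>y\<close> and \<open>W\<close>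
      around 0.\<close>
    define O' where "O' = {p::('g \<times> 'g) \<times> 'g. fst (fst p) + snd p - fst (fst p) - snd p \<noteq> snd (fst p)}"
    have "open O'" unfolding O'_def by (intro open_Collect_neq continuous_intros)
    moreover have "{(y,0)} \<times> - V \<subseteq> O'"
    proof -
      have "y + t - y - t \<noteq> 0" if "t \<notin> V" for t
      proof
        assume "y + t - y - t = 0"
        then have "(y + t - y - t) + (t + y) = t + y" by simp
        then have "t \<in> C" by (simp add: C_def group_normalise del: add_uminus_conv_diff)
        then show False using that V(2) by blast
      qed
      then show ?thesis by (auto simp: O'_def)
    qed
    ultimately have "\<exists>X. (y,0) \<in> X \<and> open X \<and> X \<times> - V \<subseteq> O'"
      by (rule Elementary_Topology.tube_lemma[OF cpt])
    then obtain X where X: "(y,0) \<in> X" "open X" "X \<times> - V \<subseteq> O'" by blast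
    obtain N W where NW: "open N" "open W" "(y,0) \<in> N \<times> W" "N \<times> W \<subseteq> X"
      using open_prod_elim[OF X(2,1)] by blast
    have "measure M {t. y' + t - y' - t \<in> W} \<le> \<epsilon>" if "y' \<in> N" for y'
    proof -
      have "{t. y' + t - y' - t \<in> W} \<subseteq> V"
      proof (rule subsetI, rule ccontr)
        fix t assume t: "t \<in> {t. y' + t - y' - t \<in> W}" "t \<notin> V"
        then have "((y', y' + t - y' - t), t) \<in> O'" using that NW(4) X(3) by blast
        then show False by (simp add: O'_def)
      qed
      then have "measure M {t. y' + t - y' - t \<in> W} \<le> measure M V"
        using V by (intro finite_measure_mono) auto
      then show ?thesis using Vm by simp
    qed
    then have "good y (fst (N,W)) (snd (N,W))" using NW by (auto simp: good_def)
    then show ?thesis by blast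
  qed
  then have "\<forall>y\<in>K. \<exists>p. good y (fst p) (snd p)" by blast
  then obtain p where p: "\<forall>y\<in>K. good y (fst (p y)) (snd (p y))" by (rule bchoice[THEN exE])
  define N where "N y = fst (p y)" for y
  define W where "W y = snd (p y)" for y
  have NW: "open (N y)" "open (W y)" "y \<in> N y" "0 \<in> W y"
    "\<And>y'. y' \<in> N y \<Longrightarrow> measure M {t. y' + t - y' - t \<in> W y} \<le> \<epsilon>" if "y \<in> K" for y
    using p that by (auto simp: N_def W_def good_def)
  have Kc: "compact K" using compact_Int_closed[OF compact_group K] by simp
  have "K \<subseteq> (\<Union>y\<in>K. N y)" using NW by blast
  then obtain F where F: "F \<subseteq> K" "finite F" "K \<subseteq> (\<Union>y\<in>F. N y)"
    by (rule compactE_image[OF Kc, rotated]) (use NW in auto)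
  define W' where "W' = (\<Inter>y\<in>F. W y)"
  have W': "open W'" "0 \<in> W'" unfolding W'_def using F NW by (auto intro!: open_INT)
  have "measure M {t. y + t - y - t \<in> W'} \<le> \<epsilon>" if yK: "y \<in> K" for y
  proof -
    obtain y1 where y1: "y1 \<in> F" "y \<in> N y1" using subsetD[OF F(3) yK] by blast
    have y1K: "y1 \<in> K" using y1 F by blast
    have "open ((\<lambda>t. y + t - y - t) -` W y1)"
      using NW[OF y1K] by (intro open_vimage continuous_intros) auto
    then have "{t. y + t - y - t \<in> W y1} \<in> sets borel" by (simp add: vimage_def)
    then have "measure M {t. y + t - y - t \<in> W'} \<le> measure M {t. y + t - y - t \<in> W y1}"
      using y1 by (intro finite_measure_mono) (auto simp: W'_def)
    then show ?thesis using NW[OF y1K] y1 by force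
  qed
  then show thesis using that W' by blast
qed

text \<open>Off \<open>K\<close> the factor \<open>1 - nch t y\<close> is small and the weights
  total at most 1. On \<open>K\<close>, which is compact and free of central elements, most
  commutators of \<open>y\<close> miss the support of \<open>P\<close>. The total is only bounded
  below by 1/2 because the expansion of \<open>P\<close> is cut off at a finite
  \<open>S\<close>.\<close>

lemma small_average:
  assumes conn: "connected (UNIV :: 'g set)" and t: "minimal t"
    and tz: "\<And>z. (\<forall>x. z + x = x + z) \<Longrightarrow> nch t z = 1" and eta: "\<eta> > 0" "\<eta> \<le> 1"
  obtains S w where "finite S" "\<And>e. e \<in> S \<Longrightarrow> minimal e" "\<And>e. e \<in> S \<Longrightarrow> w e \<ge> (0::real)"
    "(\<Sum>e\<in>S. w e) \<ge> 1/2" "\<And>y. (\<Sum>e\<in>S. w e * norm (nch e y)) * norm (1 - nch t y) \<le> \<eta>"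
proof -
  have ntc: "continuous_on UNIV (nch t)" using nch_class minimal_idem t class_fun_cont by blast
  define K where "K = {y. norm (1 - nch t y) \<ge> \<eta>}"
  have K: "closed K" unfolding K_def by (intro closed_Collect_le continuous_intros ntc)
  have KZ: "\<exists>x. y + x \<noteq> x + y" if "y \<in> K" for y
  proof (rule ccontr)
    assume "\<nexists>x. y + x \<noteq> x + y"
    then have "nch t y = 1" by (intro tz) auto
    then show False using that eta by (simp add: K_def)
  qed
  \<comment> \<open>On \<open>K\<close> the weighted sum will be at most
    \<open>\<eta> / 4 + 2 * \<epsilon> / \<eta> = \<eta> / 2\<close>, against a factor of at most 2;
    and \<open>\<epsilon> \<le> 1/2\<close> keeps the total weight at least 1/2.\<close>
  define \<epsilon> where "\<epsilon> = \<eta>\<^sup>2 / 8"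
  have eps: "\<epsilon> > 0" "\<epsilon> \<le> 1/2"
    using eta power_le_one[of \<eta> 2] by (auto simp: \<epsilon>_def)
  obtain W where W: "open W" "0 \<in> W" "\<And>y. y \<in> K \<Longrightarrow> measure M {t. y + t - y - t \<in> W} \<le> \<epsilon>"
    using commutators_avoid_identity[OF conn K KZ eps(1)] by blast
  obtain u where u: "class_fun u" "sqnorm u > 0" "\<And>x. x \<notin> W \<Longrightarrow> conv M u (star u) x = 0"
    using bump[OF W(1,2)] by blast
  define q where "q = sqnorm u"
  have q: "q > 0" using u by (simp add: q_def)
  have "\<epsilon> * q > 0" using eps q by simp
  then obtain S where S: "finite S" "\<And>e. e \<in> S \<Longrightarrow> minimal e"
    "\<And>x. norm (conv M u (star u) x - (\<Sum>e\<in>S. of_real ((norm (coef u e))\<^sup>2) * e x)) \<le> \<epsilon> * q"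
    using mercer[OF u(1)] by blast
  define P where "P = conv M u (star u)"
  define R where "R x = (\<Sum>e\<in>S. of_real ((norm (coef u e))\<^sup>2) * e x)" for x
  have PR: "norm (P x - R x) \<le> \<epsilon> * q" for x using S(3) by (simp add: P_def R_def)
  \<comment> \<open>Mercer coefficients rescaled to the functions \<open>nch e\<close>, which are 1
    at 0, and divided by \<open>q\<close>, the value of \<open>P\<close> at 0.\<close>
  define w where "w e = (norm (coef u e))\<^sup>2 * sqnorm e / q" for e
  have w0: "w e \<ge> 0" for e using q by (simp add: w_def sqnorm_nonneg)
  have id: "idem e" if "e \<in> S" for e using S(2)[OF that] minimal_idem by blast
  have Rw: "R x = of_real q * (\<Sum>e\<in>S. of_real (w e) * nch e x)" for x
    unfolding R_def sum_distrib_left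
  proof (intro sum.cong refl)
    fix e assume "e \<in> S"
    then have "sqnorm e > 0" using idemD(6) id by blast
    then show "of_real ((norm (coef u e))\<^sup>2) * e x = of_real q * (of_real (w e) * nch e x)"
      using q by (simp add: w_def nch_def)
  qed
  have w1: "(\<Sum>e\<in>S. w e) \<le> 1"
    using bessel[OF u(1) S(1,2)] q by (simp add: w_def q_def flip: sum_divide_distrib)
  have w2: "(\<Sum>e\<in>S. w e) \<ge> 1/2"
  proof -
    have "R 0 = of_real (q * (\<Sum>e\<in>S. w e))" unfolding Rw using nch_0[OF id] by simp
    moreover have "P 0 = of_real q" unfolding P_def q_def by (rule conv_star_self)
    ultimately have "P 0 - R 0 = of_real (q * (1 - (\<Sum>e\<in>S. w e)))" by (simp add: algebra_simps)
    then have "norm (P 0 - R 0) = \<bar>q * (1 - (\<Sum>e\<in>S. w e))\<bar>" by (simp only: norm_of_real)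
    then have "q * \<bar>1 - (\<Sum>e\<in>S. w e)\<bar> \<le> q * \<epsilon>" using PR[of 0] q by (simp add: abs_mult mult.commute)
    then have "\<bar>1 - (\<Sum>e\<in>S. w e)\<bar> \<le> \<epsilon>" using q by simp
    then show ?thesis using eps by linarith
  qed
  have sq: "(\<Sum>e\<in>S. w e * (norm (nch e y))\<^sup>2) \<le> 2 * \<epsilon>" if y: "y \<in> K" for y
  proof -
    have nc: "continuous_on UNIV (\<lambda>t. nch e (y + t - y - t))" if "e \<in> S" for e
      by (intro continuous_on_comp_UNIV[OF class_fun_cont[OF nch_class[OF id[OF that]]]] continuous_intros)
    \<comment> \<open>The functional equation at \<open>y\<close> and \<open>- y\<close>; summed
      with the weights, it gives the average of \<open>R\<close> over the commutators of
      \<open>y\<close>.\<close>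
    have fe: "of_real ((norm (nch e y))\<^sup>2) = (\<integral>t. nch e (y + t - y - t) \<partial>M)" if "e \<in> S" for e
      using functional_equation[OF S(2)[OF that], of y "- y"] nch_uminus[OF id[OF that], of y]
      unfolding complex_norm_square by simp
    have "complex_of_real (q * (\<Sum>e\<in>S. w e * (norm (nch e y))\<^sup>2)) = of_real q * (\<Sum>e\<in>S. of_real (w e) * of_real ((norm (nch e y))\<^sup>2))"
      by simp
    also have "\<dots> = of_real q * (\<Sum>e\<in>S. of_real (w e) * (\<integral>t. nch e (y + t - y - t) \<partial>M))"
      using fe by simp
    also have "\<dots> = (\<integral>t. R (y + t - y - t) \<partial>M)"
      unfolding Rw using nc by (simp add: Bochner_Integration.integral_sum cont_integrable)
    finally have eq: "complex_of_real (q * (\<Sum>e\<in>S. w e * (norm (nch e y))\<^sup>2)) = (\<integral>t. R (y + t - y - t) \<partial>M)" .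
    have meas: "{t. y + t - y - t \<in> W} \<in> sets borel"
    proof -
      have "open ((\<lambda>t. y + t - y - t) -` W)"
        by (intro open_vimage[OF W(1)] continuous_intros)
      then show ?thesis by (simp add: vimage_def)
    qed
    have Rc: "continuous_on UNIV R" unfolding R_def
      by (intro continuous_intros class_fun_cont idemD(1)[OF id])
    have "q * (\<Sum>e\<in>S. w e * (norm (nch e y))\<^sup>2) \<le> norm (complex_of_real (q * (\<Sum>e\<in>S. w e * (norm (nch e y))\<^sup>2)))"
      by (simp only: norm_of_real abs_ge_self)
    also have "\<dots> \<le> (\<integral>t. norm (R (y + t - y - t)) \<partial>M)" unfolding eq by (rule integral_norm_bound)
    also have "\<dots> \<le> (\<integral>t. \<epsilon> * q + q * indicator {t. y + t - y - t \<in> W} t \<partial>M)"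
    proof (rule integral_mono)
      show "integrable M (\<lambda>t. norm (R (y + t - y - t)))"
        by (intro cont_integrable continuous_intros continuous_on_comp_UNIV[OF Rc])
      show "integrable M (\<lambda>t. \<epsilon> * q + q * indicator {t. y + t - y - t \<in> W} t)"
        using meas by (auto simp: emeasure_eq_measure)
      fix t
      have "norm (R (y + t - y - t)) \<le> norm (P (y + t - y - t)) + \<epsilon> * q"
        using PR[of "y + t - y - t"] norm_triangle_ineq3[of "P (y + t - y - t)" "R (y + t - y - t)"] by linarith
      moreover have "norm (P (y + t - y - t)) \<le> q * indicator {t. y + t - y - t \<in> W} t"
        using u(3)[of "y + t - y - t"] conv_star_bound[OF u(1)] by (auto simp: P_def q_def indicator_def)
      ultimately show "norm (R (y + t - y - t)) \<le> \<epsilon> * q + q * indicator {t. y + t - y - t \<in> W} t" by linarith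
    qed
    also have "\<dots> = \<epsilon> * q + q * measure M {t. y + t - y - t \<in> W}"
      using meas by (simp add: emeasure_eq_measure)
    also have "\<dots> \<le> \<epsilon> * q + q * \<epsilon>" using W(3)[OF y] q by simp
    finally have "q * (\<Sum>e\<in>S. w e * (norm (nch e y))\<^sup>2) \<le> q * (2 * \<epsilon>)" by (simp add: mult_ac)
    then show ?thesis using q by simp
  qed
  have "(\<Sum>e\<in>S. w e * norm (nch e y)) * norm (1 - nch t y) \<le> \<eta>" for y
  proof (cases "y \<in> K")
    case False
    have "(\<Sum>e\<in>S. w e * norm (nch e y)) \<le> (\<Sum>e\<in>S. w e * 1)"
      by (intro sum_mono mult_left_mono nch_bound id w0)
    then have "(\<Sum>e\<in>S. w e * norm (nch e y)) * norm (1 - nch t y) \<le> 1 * \<eta>"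
      using False w1 by (intro mult_mono) (auto simp: K_def)
    then show ?thesis by simp
  next
    case True
    \<comment> \<open>Linearised Cauchy-Schwarz: the square of
      \<open>norm (nch e y) - \<eta> / 2\<close> is nonnegative, which trades the modulus for its
      square.\<close>
    have "(\<Sum>e\<in>S. w e * norm (nch e y)) \<le> (\<Sum>e\<in>S. \<eta> / 4 * w e + w e * (norm (nch e y))\<^sup>2 / \<eta>)"
    proof (rule sum_mono)
      fix e assume "e \<in> S"
      have "0 \<le> (norm (nch e y) - \<eta> / 2)\<^sup>2" by simp
      then have "norm (nch e y) * \<eta> \<le> (norm (nch e y))\<^sup>2 + \<eta>\<^sup>2 / 4"
        by (simp add: power2_eq_square algebra_simps)
      then have "norm (nch e y) \<le> \<eta> / 4 + (norm (nch e y))\<^sup>2 / \<eta>"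
        using eta by (simp add: field_simps power2_eq_square)
      then have "w e * norm (nch e y) \<le> w e * (\<eta> / 4 + (norm (nch e y))\<^sup>2 / \<eta>)"
        by (rule mult_left_mono[OF _ w0])
      then show "w e * norm (nch e y) \<le> \<eta> / 4 * w e + w e * (norm (nch e y))\<^sup>2 / \<eta>"
        by (simp add: algebra_simps)
    qed
    also have "\<dots> = \<eta> / 4 * (\<Sum>e\<in>S. w e) + (\<Sum>e\<in>S. w e * (norm (nch e y))\<^sup>2) / \<eta>"
      by (simp add: sum.distrib sum_distrib_left sum_divide_distrib)
    also have "\<dots> \<le> \<eta> / 4 * 1 + (2 * \<epsilon>) / \<eta>"
      using eta w1 sq[OF True] by (intro add_mono mult_left_mono divide_right_mono) auto
    also have "\<dots> = \<eta> / 2" using eta by (simp add: \<epsilon>_def power2_eq_square)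
    finally have a: "(\<Sum>e\<in>S. w e * norm (nch e y)) \<le> \<eta> / 2" .
    have "norm (1 - nch t y) \<le> 2"
      using norm_triangle_ineq4[of 1 "nch t y"] nch_bound[OF minimal_idem[OF t], of y] by simp
    then have "(\<Sum>e\<in>S. w e * norm (nch e y)) * norm (1 - nch t y) \<le> \<eta> / 2 * 2"
      using a eta by (intro mult_mono) auto
    then show ?thesis by simp
  qed
  then show thesis using that S(1,2) w0 w2 by blast
qed

end

section \<open>Testing an approximate diagonal\<close>

lemma sums_interleave_complex:
  fixes f g :: "nat \<Rightarrow> complex"
  assumes "g sums x" "f sums y"
  shows "(\<lambda>n. if even n then f (n div 2) else g ((n - 1) div 2)) sums (x + y)"
  using assms sums_if[of "\<lambda>n. Re (g n)" "Re x" "\<lambda>n. Re (f n)" "Re y"]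
    sums_if[of "\<lambda>n. Im (g n)" "Im x" "\<lambda>n. Im (f n)" "Im y"]
  by (simp add: sums_complex_iff if_distrib[of Re] if_distrib[of Im])

context compact_haar
begin

lemma nch_cont: "minimal e \<Longrightarrow> continuous_on A (nch e)"
  using nch_class minimal_idem class_fun_cont by blast

lemma cnj_nch_cont: "minimal e \<Longrightarrow> continuous_on A (\<lambda>x. cnj (nch e x))"
  by (intro continuous_intros nch_cont)

lemma coef_bound:
  assumes "minimal e" "integrable M f"
  shows "norm (coef f e) \<le> L1norm M f"
proof -
  have "norm (coef f e) \<le> 1 * (\<integral>x. norm (f x) \<partial>M)"
    unfolding coef_def
    by (rule weighted_norm_le[OF assms(2)])
      (use cnj_nch_cont[OF assms(1)] nch_bound[OF minimal_idem[OF assms(1)]] in auto)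
  then show ?thesis by (simp add: L1norm_def)
qed

lemma coef_self: "minimal e \<Longrightarrow> coef e e = 1"
proof -
  assume e: "minimal e"
  note ee = idemD[OF minimal_idem[OF e]]
  have "conv M e e 0 = coef e e * e 0" using conv_minimal[OF e ee(1)] by simp
  then show ?thesis using ee by simp
qed

lemma integral_mult_left_commute:
  fixes f g :: "'g \<Rightarrow> complex"
  shows "(\<integral>x. f x * (a * g x) \<partial>M) = a * (\<integral>x. f x * g x \<partial>M)"
  by (simp only: mult.left_commute[of _ a] integral_mult_right_zero)

text \<open>A central \<open>f\<close> pairs equally with a test function and with its conjugation
  average, which the functional equation computes. This extends the character property of
  \<open>coef\<close> from class functions to \<open>ZL1 M\<close>.\<close>

lemma ZL1_cnj_nch_average:
  assumes e: "minimal e" and f: "f \<in> ZL1 M"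
  shows "(\<integral>x. f x * cnj (nch e (y + x)) \<partial>M) = cnj (nch e y) * coef f e"
proof -
  have c: "continuous_on UNIV (\<lambda>x. cnj (nch e (y + x)))"
    by (intro continuous_on_comp_UNIV[OF cnj_nch_cont[OF e]] continuous_intros)
  have "(\<integral>t. cnj (nch e (y + (t + x - t))) \<partial>M) = cnj (nch e y) * cnj (nch e x)" for x
    using arg_cong[OF functional_equation[OF e, of y x], of cnj]
    by (simp add: group_normalise del: add_uminus_conv_diff flip: Bochner_Integration.integral_cnj)
  then show ?thesis
    using ZL1_class_average[OF f c] by (simp add: coef_def integral_mult_left_commute)
qed

lemma conv_ZL1_minimal:
  assumes e: "minimal e" and f: "f \<in> ZL1 M"
  shows "conv M f e = (\<lambda>x. coef f e * e x)" "conv M e f = (\<lambda>x. coef f e * e x)"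
proof -
  note ee = idemD[OF minimal_idem[OF e]]
  show 1: "conv M f e = (\<lambda>x. coef f e * e x)"
  proof
    fix x
    have "e (- y + x) = of_real (sqnorm e) * cnj (nch e (- x + y))" for y
      using nch_uminus[OF minimal_idem[OF e], of "- x + y"] ee(6)
      by (simp add: nch_def minus_add)
    then have "conv M f e x = of_real (sqnorm e) * (\<integral>y. f y * cnj (nch e (- x + y)) \<partial>M)"
      by (simp add: conv_def integral_mult_left_commute)
    also have "\<dots> = of_real (sqnorm e) * (cnj (nch e (- x)) * coef f e)"
      by (simp only: ZL1_cnj_nch_average[OF e f])
    also have "\<dots> = coef f e * e x"
      using nch_uminus[OF minimal_idem[OF e], of x] ee(6) by (simp add: nch_def)
    finally show "conv M f e x = coef f e * e x" .
  qed
  show "conv M e f = (\<lambda>x. coef f e * e x)"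
    using conv_class_comm[OF ZL1_integrable[OF f] ee(1)] 1 by simp
qed

text \<open>The first factor is merely integrable because it will be \<open>mult_map M r\<close>,
  for which integrability is what gets established.\<close>

lemma coef_conv:
  assumes e: "minimal e" and c: "integrable M c" and d: "d \<in> ZL1 M"
  shows "coef (conv M c d) e = coef c e * coef d e"
proof -
  have "coef (conv M c d) e = (\<integral>y. c y * (\<integral>x. d x * cnj (nch e (y + x)) \<partial>M) \<partial>M)"
    unfolding coef_def by (rule conv_pairing[OF c ZL1_integrable[OF d] cnj_nch_cont[OF e]])
  also have "\<dots> = (\<integral>y. coef d e * (c y * cnj (nch e y)) \<partial>M)"
    by (simp add: ZL1_cnj_nch_average[OF e d] mult_ac)
  also have "\<dots> = coef d e * (\<integral>y. c y * cnj (nch e y) \<partial>M)" by (rule integral_mult_right_zero)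
  finally show ?thesis by (simp add: coef_def)
qed

lemma ZL1_scale:
  assumes "f \<in> ZL1 M" shows "(\<lambda>x. c * f x) \<in> ZL1 M"
  using assms unfolding ZL1_def by (auto simp: conv_scale_left conv_scale_right)

lemma ZL1_minimal: "minimal e \<Longrightarrow> e \<in> ZL1 M"
  using class_fun_ZL1 idemD(1) minimal_idem by blast

lemma L1norm_nonneg: "L1norm M f \<ge> 0" by (simp add: L1norm_def)

lemma L1norm_scale: "L1norm M (\<lambda>x. c * f x) = norm c * L1norm M f"
  by (simp add: L1norm_def norm_mult)

text \<open>A bounded form takes the same value on all representations of one tensor, so the
  estimate for each of them survives the infimum in \<open>proj_norm\<close>; \<open>r\<close>
  itself makes the infimum one over a nonempty set. The case \<open>B = 0\<close> is separate
  because the argument divides by \<open>B\<close>.\<close>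

lemma tensor_bound:
  assumes \<phi>: "bdd_bilinear M \<phi>" and r: "is_rep M r" and B: "B \<ge> 0"
    and bound: "\<And>f g. f \<in> ZL1 M \<Longrightarrow> g \<in> ZL1 M \<Longrightarrow> norm (\<phi> f g) \<le> B * L1norm M f * L1norm M g"
  shows "norm (\<Sum>n. \<phi> (fst r n) (snd r n)) \<le> B * proj_norm M r"
proof -
  let ?s = "norm (\<Sum>n. \<phi> (fst r n) (snd r n))"
  have le: "?s \<le> B * (\<Sum>n. L1norm M (fst s n) * L1norm M (snd s n))"
    if s: "is_rep M s" "same_tensor M r s" for s
  proof -
    have sm: "summable (\<lambda>n. B * (L1norm M (fst s n) * L1norm M (snd s n)))"
      using s(1) by (intro summable_mult) (simp add: is_rep_def)
    have nb: "norm (\<phi> (fst s n) (snd s n)) \<le> B * (L1norm M (fst s n) * L1norm M (snd s n))" for n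
      using bound[of "fst s n" "snd s n"] s(1) by (simp add: is_rep_def mult.assoc)
    have "?s = norm (\<Sum>n. \<phi> (fst s n) (snd s n))" using s(2) \<phi> by (simp add: same_tensor_def)
    also have "\<dots> \<le> (\<Sum>n. norm (\<phi> (fst s n) (snd s n)))"
      by (rule summable_norm[OF summable_comparison_test'[OF sm]]) (use nb in simp)
    also have "\<dots> \<le> (\<Sum>n. B * (L1norm M (fst s n) * L1norm M (snd s n)))"
      by (rule suminf_le[OF nb summable_comparison_test'[OF sm] sm]) (use nb in simp)
    also have "\<dots> = B * (\<Sum>n. L1norm M (fst s n) * L1norm M (snd s n))"
      using s(1) by (intro suminf_mult) (simp add: is_rep_def)
    finally show ?thesis .
  qed
  define X where "X = {(\<Sum>n. L1norm M (fst s n) * L1norm M (snd s n)) | s. is_rep M s \<and> same_tensor M r s}"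
  have "(\<Sum>n. L1norm M (fst r n) * L1norm M (snd r n)) \<in> X"
    unfolding X_def using r by (intro CollectI exI[of _ r]) (simp add: same_tensor_def)
  then have ne: "X \<noteq> {}" by blast
  show ?thesis
  proof (cases "B = 0")
    case True
    then show ?thesis using le[OF r] by (simp add: same_tensor_def)
  next
    case False
    then have B': "B > 0" using B by simp
    have "?s / B \<le> Inf X"
    proof (rule cInf_greatest[OF ne])
      fix x assume "x \<in> X"
      then show "?s / B \<le> x" using le B' by (auto simp: X_def field_simps)
    qed
    then show ?thesis using B' by (simp add: proj_norm_def X_def field_simps)
  qed
qed

lemma weighted_linear:
  fixes h :: "'g \<Rightarrow> complex"
  assumes h: "continuous_on UNIV h" and f: "integrable M f" "integrable M g"
  shows "(\<integral>x. (f x + g x) * h x \<partial>M) = (\<integral>x. f x * h x \<partial>M) + (\<integral>x. g x * h x \<partial>M)"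
  using weighted_integrable[OF f(1) h] weighted_integrable[OF f(2) h] by (simp add: distrib_right)

lemma form_bdd_bilinear:
  assumes S: "finite S" "\<And>e. e \<in> S \<Longrightarrow> minimal e" and h: "\<And>e. e \<in> S \<Longrightarrow> continuous_on UNIV (h e)"
  shows "bdd_bilinear M (\<lambda>f g. \<Sum>e\<in>S. w e * coef f e * (\<integral>y. g y * h e y \<partial>M))"
  unfolding bdd_bilinear_def
proof (intro conjI ballI allI)
  fix f f' g and c :: complex assume f: "f \<in> ZL1 M" "f' \<in> ZL1 M" and g: "g \<in> ZL1 M"
  note i = ZL1_integrable[OF f(1)] ZL1_integrable[OF f(2)]
  have add: "coef (\<lambda>x. f x + f' x) e = coef f e + coef f' e" if "e \<in> S" for e
    unfolding coef_def by (rule weighted_linear[OF cnj_nch_cont[OF S(2)[OF that]] i])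
  show "(\<Sum>e\<in>S. w e * coef (\<lambda>x. f x + f' x) e * (\<integral>y. g y * h e y \<partial>M)) =
    (\<Sum>e\<in>S. w e * coef f e * (\<integral>y. g y * h e y \<partial>M)) + (\<Sum>e\<in>S. w e * coef f' e * (\<integral>y. g y * h e y \<partial>M))"
    unfolding sum.distrib[symmetric] by (intro sum.cong refl) (simp only: add distrib_left distrib_right)
  show "(\<Sum>e\<in>S. w e * coef g e * (\<integral>y. (f y + f' y) * h e y \<partial>M)) =
    (\<Sum>e\<in>S. w e * coef g e * (\<integral>y. f y * h e y \<partial>M)) + (\<Sum>e\<in>S. w e * coef g e * (\<integral>y. f' y * h e y \<partial>M))"
    unfolding sum.distrib[symmetric] by (intro sum.cong refl) (simp only: weighted_linear[OF h i] distrib_left)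
  show "(\<Sum>e\<in>S. w e * coef (\<lambda>x. c * f x) e * (\<integral>y. g y * h e y \<partial>M)) =
    c * (\<Sum>e\<in>S. w e * coef f e * (\<integral>y. g y * h e y \<partial>M))"
    unfolding sum_distrib_left by (intro sum.cong refl) (simp add: coef_def mult_ac)
  show "(\<Sum>e\<in>S. w e * coef g e * (\<integral>y. (c * f y) * h e y \<partial>M)) =
    c * (\<Sum>e\<in>S. w e * coef g e * (\<integral>y. f y * h e y \<partial>M))"
    unfolding sum_distrib_left by (intro sum.cong refl) (simp add: mult_ac)
next
  have "\<exists>B. \<forall>y. norm (h e y) \<le> B" if "e \<in> S" for e using cont_bounded[OF h[OF that]] by metis
  then obtain B where B: "\<And>e y. e \<in> S \<Longrightarrow> norm (h e y) \<le> B e" by metis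
  have "norm (\<Sum>e\<in>S. w e * coef f e * (\<integral>y. g y * h e y \<partial>M)) \<le> (\<Sum>e\<in>S. norm (w e) * B e) * L1norm M f * L1norm M g"
    if f: "f \<in> ZL1 M" "g \<in> ZL1 M" for f g
  proof -
    have "norm (\<Sum>e\<in>S. w e * coef f e * (\<integral>y. g y * h e y \<partial>M)) \<le> (\<Sum>e\<in>S. norm (w e) * L1norm M f * (B e * L1norm M g))"
    proof (rule sum_norm_le)
      fix e assume e: "e \<in> S"
      have "norm (\<integral>y. g y * h e y \<partial>M) \<le> B e * L1norm M g"
        unfolding L1norm_def using f e by (intro weighted_norm_le ZL1_integrable h B)
      then show "norm (w e * coef f e * (\<integral>y. g y * h e y \<partial>M)) \<le> norm (w e) * L1norm M f * (B e * L1norm M g)"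
        unfolding norm_mult
        using coef_bound[OF S(2)[OF e] ZL1_integrable[OF f(1)]]
        by (intro mult_mono) (auto simp: L1norm_nonneg)
    qed
    also have "\<dots> = (\<Sum>e\<in>S. norm (w e) * B e) * L1norm M f * L1norm M g"
      unfolding sum_distrib_right by (intro sum.cong refl) (simp only: mult_ac)
    finally show ?thesis .
  qed
  then show "\<exists>C. \<forall>f\<in>ZL1 M. \<forall>g\<in>ZL1 M. norm (\<Sum>e\<in>S. w e * coef f e * (\<integral>y. g y * h e y \<partial>M)) \<le> C * L1norm M f * L1norm M g"
    by blast
qed

section \<open>Testing one tensor against one minimal idempotent\<close>

context
  fixes r :: "'g rep" and e :: "'g \<Rightarrow> complex"
  assumes r: "is_rep M r" and e: "minimal e"
begin

lemma rep_ZL1: "fst r n \<in> ZL1 M" "snd r n \<in> ZL1 M"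
  using r by (auto simp: is_rep_def)

lemma rep_summable: "summable (\<lambda>n. L1norm M (fst r n) * L1norm M (snd r n))"
  using r by (simp add: is_rep_def)

lemma form_summable:
  assumes h: "continuous_on UNIV h"
  shows "summable (\<lambda>n. coef (fst r n) e * (\<integral>y. snd r n y * h y \<partial>M))"
proof -
  obtain B where B: "B > 0" "\<And>y. norm (h y) \<le> B" using cont_bounded[OF h] by blast
  have "norm (coef (fst r n) e * (\<integral>y. snd r n y * h y \<partial>M)) \<le> B * (L1norm M (fst r n) * L1norm M (snd r n))" for n
  proof -
    have "norm (\<integral>y. snd r n y * h y \<partial>M) \<le> B * L1norm M (snd r n)"
      unfolding L1norm_def by (intro weighted_norm_le ZL1_integrable rep_ZL1 h B)
    then have "norm (coef (fst r n) e) * norm (\<integral>y. snd r n y * h y \<partial>M) \<le> L1norm M (fst r n) * (B * L1norm M (snd r n))"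
      using coef_bound[OF e ZL1_integrable[OF rep_ZL1(1)]] by (intro mult_mono) (auto simp: L1norm_nonneg)
    then show ?thesis by (simp add: norm_mult mult_ac)
  qed
  then show ?thesis
    by (intro summable_comparison_test'[OF summable_mult[OF rep_summable, of B], of 0]) auto
qed

lemma coef_summable: "summable (\<lambda>n. coef (fst r n) e * coef (snd r n) e)"
  using form_summable[OF cnj_nch_cont[OF e]] by (simp add: coef_def[of "snd r _"])

lemma commutator_is_rep: "is_rep M (commutator_rep M e r)"
proof -
  have a: "summable (\<lambda>n. L1norm M (conv M e (fst r n)) * L1norm M (snd r n))"
  proof (rule summable_comparison_test'[OF summable_mult[OF rep_summable, of "L1norm M e"]])
    fix n
    have "norm (coef (fst r n) e) * L1norm M e * L1norm M (snd r n) \<le> L1norm M (fst r n) * L1norm M e * L1norm M (snd r n)"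
      using coef_bound[OF e ZL1_integrable[OF rep_ZL1(1)]] by (intro mult_right_mono) (auto simp: L1norm_nonneg)
    then show "norm (L1norm M (conv M e (fst r n)) * L1norm M (snd r n)) \<le> L1norm M e * (L1norm M (fst r n) * L1norm M (snd r n))"
      unfolding conv_ZL1_minimal(2)[OF e rep_ZL1(1)] L1norm_scale by (simp add: L1norm_nonneg abs_mult mult_ac)
  qed
  have b: "summable (\<lambda>n. L1norm M (fst r n) * L1norm M (conv M (snd r n) e))"
  proof (rule summable_comparison_test'[OF summable_mult[OF rep_summable, of "L1norm M e"]])
    fix n
    have "norm (coef (snd r n) e) * (L1norm M e * L1norm M (fst r n)) \<le> L1norm M (snd r n) * (L1norm M e * L1norm M (fst r n))"
      using coef_bound[OF e ZL1_integrable[OF rep_ZL1(2)]] by (intro mult_right_mono) (auto simp: L1norm_nonneg)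
    then show "norm (L1norm M (fst r n) * L1norm M (conv M (snd r n) e)) \<le> L1norm M e * (L1norm M (fst r n) * L1norm M (snd r n))"
      unfolding conv_ZL1_minimal(1)[OF e rep_ZL1(2)] L1norm_scale by (simp add: L1norm_nonneg abs_mult mult_ac)
  qed
  have m: "L1norm M (\<lambda>x. - fst r n x) = L1norm M (fst r n)" for n by (simp add: L1norm_def)
  have "(\<lambda>n. if even n then L1norm M (conv M e (fst r (n div 2))) * L1norm M (snd r (n div 2))
      else L1norm M (fst r ((n - 1) div 2)) * L1norm M (conv M (snd r ((n - 1) div 2)) e))
      sums ((\<Sum>n. L1norm M (fst r n) * L1norm M (conv M (snd r n) e)) + (\<Sum>n. L1norm M (conv M e (fst r n)) * L1norm M (snd r n)))"
    by (rule sums_if[OF summable_sums[OF b] summable_sums[OF a]])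
  then have "summable (\<lambda>n. if even n then L1norm M (conv M e (fst r (n div 2))) * L1norm M (snd r (n div 2))
      else L1norm M (fst r ((n - 1) div 2)) * L1norm M (conv M (snd r ((n - 1) div 2)) e))"
    by (rule sums_summable)
  also have "(\<lambda>n. if even n then L1norm M (conv M e (fst r (n div 2))) * L1norm M (snd r (n div 2))
      else L1norm M (fst r ((n - 1) div 2)) * L1norm M (conv M (snd r ((n - 1) div 2)) e)) =
    (\<lambda>n. L1norm M (fst (commutator_rep M e r) n) * L1norm M (snd (commutator_rep M e r) n))"
    by (auto simp: fun_eq_iff commutator_rep_def m elim!: oddE)
  finally have s: "summable \<dots>" .
  have neg: "(\<lambda>x. - fst r n x) \<in> ZL1 M" for n using ZL1_scale[OF rep_ZL1(1), of "-1"] by simp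
  show ?thesis
    unfolding is_rep_def
    using s neg rep_ZL1 by (auto simp: commutator_rep_def conv_ZL1_minimal[OF e rep_ZL1(1)]
        conv_ZL1_minimal[OF e rep_ZL1(2)] ZL1_scale ZL1_minimal[OF e])
qed

text \<open>Convolving a left factor with \<open>e\<close> preserves its
  \<open>e\<close>-coefficient; convolving a right factor \<open>d\<close> gives
  \<open>coef d e\<close> times \<open>e\<close>. The two interleaved halves thus sum to the two
  terms of the difference.\<close>

lemma commutator_form:
  assumes h: "continuous_on UNIV h"
  shows "(\<Sum>n. coef (fst (commutator_rep M e r) n) e * (\<integral>y. snd (commutator_rep M e r) n y * h y \<partial>M)) =
    (\<Sum>n. coef (fst r n) e * (\<integral>y. snd r n y * h y \<partial>M)) - (\<integral>y. e y * h y \<partial>M) * (\<Sum>n. coef (fst r n) e * coef (snd r n) e)"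
proof -
  let ?E = "\<integral>y. e y * h y \<partial>M"
  have sc: "coef (\<lambda>x. c * f x) e = c * coef f e" for c f by (simp add: coef_def mult.assoc)
  have 1: "coef (conv M e (fst r n)) e = coef (fst r n) e" for n
    using coef_self[OF e] by (simp add: conv_ZL1_minimal[OF e rep_ZL1(1)] sc)
  have 2: "(\<integral>y. conv M (snd r n) e y * h y \<partial>M) = coef (snd r n) e * ?E" for n
    by (simp add: conv_ZL1_minimal[OF e rep_ZL1(2)] mult.assoc)
  have 3: "coef (\<lambda>x. - fst r n x) e = - coef (fst r n) e" for n by (simp add: coef_def)
  have s: "(\<lambda>n. if even n then coef (fst r (n div 2)) e * (\<integral>y. snd r (n div 2) y * h y \<partial>M)
       else - ?E * (coef (fst r ((n - 1) div 2)) e * coef (snd r ((n - 1) div 2)) e))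
     sums (- ?E * (\<Sum>n. coef (fst r n) e * coef (snd r n) e) + (\<Sum>n. coef (fst r n) e * (\<integral>y. snd r n y * h y \<partial>M)))"
    by (rule sums_interleave_complex[OF sums_mult[OF summable_sums[OF coef_summable]] summable_sums[OF form_summable[OF h]]])
  have eq: "(\<lambda>n. if even n then coef (fst r (n div 2)) e * (\<integral>y. snd r (n div 2) y * h y \<partial>M)
       else - ?E * (coef (fst r ((n - 1) div 2)) e * coef (snd r ((n - 1) div 2)) e)) =
    (\<lambda>n. coef (fst (commutator_rep M e r) n) e * (\<integral>y. snd (commutator_rep M e r) n y * h y \<partial>M))"
  proof
    fix n
    show "(if even n then coef (fst r (n div 2)) e * (\<integral>y. snd r (n div 2) y * h y \<partial>M)
       else - ?E * (coef (fst r ((n - 1) div 2)) e * coef (snd r ((n - 1) div 2)) e)) =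
      coef (fst (commutator_rep M e r) n) e * (\<integral>y. snd (commutator_rep M e r) n y * h y \<partial>M)"
    proof (cases "even n")
      case True
      then show ?thesis by (simp add: commutator_rep_def 1)
    next
      case False
      then show ?thesis by (auto simp: commutator_rep_def 2 3 elim!: oddE)
    qed
  qed
  from sums_unique[OF s[unfolded eq]] show ?thesis by simp
qed

lemma commutator_estimate:
  assumes h: "continuous_on UNIV h" "\<And>y. norm (h y) \<le> B"
  shows "norm ((\<Sum>n. coef (fst r n) e * (\<integral>y. snd r n y * h y \<partial>M))
      - (\<integral>y. e y * h y \<partial>M) * (\<Sum>n. coef (fst r n) e * coef (snd r n) e))
    \<le> B * proj_norm M (commutator_rep M e r)"
  unfolding commutator_form[OF h(1), symmetric]
proof (rule tensor_bound[OF _ commutator_is_rep])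
  show "bdd_bilinear M (\<lambda>f g. coef f e * (\<integral>y. g y * h y \<partial>M))"
    using form_bdd_bilinear[of "{e}" "\<lambda>_. h" "\<lambda>_. 1"] e h(1) by simp
  show "B \<ge> 0" using h(2)[of 0] norm_ge_zero order_trans by blast
  fix f g assume f: "f \<in> ZL1 M" "g \<in> ZL1 M"
  have "norm (\<integral>y. g y * h y \<partial>M) \<le> B * L1norm M g"
    unfolding L1norm_def using f by (intro weighted_norm_le ZL1_integrable h)
  then have "norm (coef f e) * norm (\<integral>y. g y * h y \<partial>M) \<le> L1norm M f * (B * L1norm M g)"
    using coef_bound[OF e ZL1_integrable[OF f(1)]] by (intro mult_mono) (auto simp: L1norm_nonneg)
  then show "norm (coef f e * (\<integral>y. g y * h y \<partial>M)) \<le> B * L1norm M f * L1norm M g"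
    by (simp add: norm_mult mult_ac)
qed

text \<open>Monotone convergence gives a.e. absolute convergence of the pointwise series in
  \<open>mult_map\<close>, so sum and integral may be exchanged, also against the bounded conjugate
  of \<open>nch e\<close>.\<close>

lemma
  shows mult_map_integrable: "integrable M (mult_map M r)"
    and coef_mult_map: "coef (mult_map M r) e = (\<Sum>n. coef (fst r n) e * coef (snd r n) e)"
proof -
  define f where "f n = conv M (fst r n) (snd r n)" for n
  have fi: "integrable M (f n)" for n
    unfolding f_def by (intro conv_integrable ZL1_integrable rep_ZL1)
  have fn: "(\<integral>x. norm (f n x) \<partial>M) \<le> L1norm M (fst r n) * L1norm M (snd r n)" for n
    using conv_norm_le[OF ZL1_integrable[OF rep_ZL1(1)] ZL1_integrable[OF rep_ZL1(2)]]
    unfolding f_def L1norm_def[symmetric] by blast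
  have fs: "summable (\<lambda>n. \<integral>x. norm (f n x) \<partial>M)"
    by (rule summable_comparison_test'[OF rep_summable, of 0]) (use fn in auto)
  have ae: "AE x in M. summable (\<lambda>n. norm (f n x))"
  proof -
    have mf: "(\<lambda>x. ennreal (norm (f n x))) \<in> borel_measurable M" for n using fi[of n] by auto
    have "(\<integral>\<^sup>+x. (\<Sum>n. ennreal (norm (f n x))) \<partial>M) = (\<Sum>n. \<integral>\<^sup>+x. ennreal (norm (f n x)) \<partial>M)"
      by (rule nn_integral_suminf[OF mf])
    also have "\<dots> = (\<Sum>n. ennreal (\<integral>x. norm (f n x) \<partial>M))"
      using fi by (intro suminf_cong nn_integral_eq_integral) auto
    also have "\<dots> = ennreal (\<Sum>n. \<integral>x. norm (f n x) \<partial>M)"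
      using fs by (intro suminf_ennreal2) auto
    finally have "(\<integral>\<^sup>+x. (\<Sum>n. ennreal (norm (f n x))) \<partial>M) \<noteq> \<infinity>" by simp
    then have "AE x in M. (\<Sum>n. ennreal (norm (f n x))) \<noteq> \<infinity>"
      by (intro nn_integral_PInf_AE) (use mf in auto)
    then show ?thesis by eventually_elim (auto intro: summable_suminf_not_top)
  qed
  show int: "integrable M (mult_map M r)"
    unfolding mult_map_def f_def[symmetric] by (rule integrable_suminf[OF fi ae fs])
  let ?h = "\<lambda>x. cnj (nch e x)"
  have hb: "norm (?h x) \<le> 1" for x using nch_bound[OF minimal_idem[OF e]] by simp
  have gi: "integrable M (\<lambda>x. f n x * ?h x)" for n by (intro weighted_integrable fi cnj_nch_cont e)
  have gle: "norm (f n x * ?h x) \<le> norm (f n x)" for n x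
    using mult_left_mono[OF hb[of x], of "norm (f n x)"] by (simp add: norm_mult)
  have gs: "summable (\<lambda>n. \<integral>x. norm (f n x * ?h x) \<partial>M)"
  proof (rule summable_comparison_test'[OF fs, of 0])
    show "norm (\<integral>x. norm (f n x * ?h x) \<partial>M) \<le> (\<integral>x. norm (f n x) \<partial>M)" for n
      using integral_mono[OF integrable_norm[OF gi[of n]] integrable_norm[OF fi[of n]] gle] by simp
  qed
  have gae: "AE x in M. summable (\<lambda>n. norm (f n x * ?h x))"
    using ae
  proof eventually_elim
    case (elim x)
    show ?case by (rule summable_comparison_test'[OF elim, of 0]) (use gle in auto)
  qed
  have "coef (mult_map M r) e = (\<integral>x. (\<Sum>n. f n x * ?h x) \<partial>M)"
    unfolding coef_def
  proof (rule integral_cong_AE)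
    show "(\<lambda>x. mult_map M r x * ?h x) \<in> borel_measurable M"
      using weighted_integrable[OF int cnj_nch_cont[OF e]] by (rule borel_measurable_integrable)
    show "(\<lambda>x. \<Sum>n. f n x * ?h x) \<in> borel_measurable M"
      using integrable_suminf[OF gi gae gs] by (rule borel_measurable_integrable)
    show "AE x in M. mult_map M r x * ?h x = (\<Sum>n. f n x * ?h x)"
      using ae
    proof eventually_elim
      case (elim x)
      then have "summable (\<lambda>n. f n x)" by (rule summable_norm_cancel)
      then show ?case by (simp add: mult_map_def f_def suminf_mult2)
    qed
  qed
  also have "\<dots> = (\<Sum>n. \<integral>x. f n x * ?h x \<partial>M)" by (rule integral_suminf[OF gi gae gs])
  also have "\<dots> = (\<Sum>n. coef (f n) e)" by (simp add: coef_def)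
  also have "\<dots> = (\<Sum>n. coef (fst r n) e * coef (snd r n) e)"
    unfolding f_def by (simp add: coef_conv[OF e ZL1_integrable[OF rep_ZL1(1)] rep_ZL1(2)])
  finally show "coef (mult_map M r) e = (\<Sum>n. coef (fst r n) e * coef (snd r n) e)" .
qed

text \<open>The contractive functional \<open>coef _ e\<close> is applied to the defect of the
  approximate unit; it is multiplicative here and sends \<open>e\<close> to 1.\<close>

lemma unit_estimate:
  "norm ((\<Sum>n. coef (fst r n) e * coef (snd r n) e) - 1) \<le> L1norm M (\<lambda>x. conv M (mult_map M r) e x - e x)"
proof -
  note ee = idemD[OF minimal_idem[OF e]]
  have ci: "integrable M (conv M (mult_map M r) e)"
    by (intro conv_integrable mult_map_integrable ZL1_integrable ZL1_minimal e)
  have "coef (\<lambda>x. conv M (mult_map M r) e x - e x) e = coef (conv M (mult_map M r) e) e - coef e e"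
    unfolding coef_def
    using weighted_integrable[OF ci cnj_nch_cont[OF e]] weighted_integrable[OF class_fun_integrable[OF ee(1)] cnj_nch_cont[OF e]]
    by (simp add: left_diff_distrib)
  also have "\<dots> = (\<Sum>n. coef (fst r n) e * coef (snd r n) e) - 1"
    by (simp add: coef_conv[OF e mult_map_integrable ZL1_minimal[OF e]] coef_self[OF e] coef_mult_map)
  finally have "(\<Sum>n. coef (fst r n) e * coef (snd r n) e) - 1 = coef (\<lambda>x. conv M (mult_map M r) e x - e x) e" by simp
  then show ?thesis
    using coef_bound[OF e Bochner_Integration.integrable_diff[OF ci class_fun_integrable[OF ee(1)]]] by simp
qed

end

text \<open>The order of choices matters: \<open>t\<close> and \<open>c\<close>, then
  \<open>\<eta>\<close> from \<open>c\<close> and the norm bound \<open>C\<close>, and only then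
  \<open>S\<close> and \<open>w\<close>. The lower bound survives because \<open>c\<close> serves
  all minimal \<open>e\<close> at once.\<close>

lemma no_bounded_approx_diagonal:
  assumes conn: "connected (UNIV :: 'g set)" and nc: "(a::'g) + b \<noteq> b + a"
  shows "\<not> bounded_approx_diagonal M (F :: 'i filter) \<mu>"
proof
  assume bad: "bounded_approx_diagonal M F \<mu>"
  then obtain C where F: "F \<noteq> bot" and rep: "\<And>i. is_rep M (\<mu> i)" and C: "\<And>i. proj_norm M (\<mu> i) \<le> C"
    and unit: "\<And>a. a \<in> ZL1 M \<Longrightarrow> ((\<lambda>i. L1norm M (\<lambda>x. conv M (mult_map M (\<mu> i)) a x - a x)) \<longlongrightarrow> 0) F"
    and comm: "\<And>a. a \<in> ZL1 M \<Longrightarrow> ((\<lambda>i. proj_norm M (commutator_rep M a (\<mu> i))) \<longlongrightarrow> 0) F"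
    unfolding bounded_approx_diagonal_def by blast
  obtain t x0 where t: "minimal t" "nch t x0 \<noteq> 1" "\<And>z. (\<forall>x. z + x = x + z) \<Longrightarrow> nch t z = 1"
    using separating_minimal[OF nc] by blast
  obtain c where c: "c > 0" "\<And>e. minimal e \<Longrightarrow>
    \<exists>r. r \<ge> c \<and> of_real (sqnorm e) * (\<integral>g. of_real ((norm (nch e g))\<^sup>2) * (1 - nch t g) \<partial>M) = of_real r"
    using spectral_gap[OF conn t(1,2)] by blast
  \<comment> \<open>This makes \<open>\<eta> * C\<close> at most \<open>c / 4\<close>, below the
    bound \<open>c / 2\<close> that comes from weights of total at least 1/2;
    \<open>\<bar>C\<bar> + 1\<close> keeps the denominator positive.\<close>
  define \<eta> where "\<eta> = min 1 (c / (4 * (\<bar>C\<bar> + 1)))"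
  have eta: "\<eta> > 0" "\<eta> \<le> 1" using c(1) by (auto simp: \<eta>_def)
  obtain S w where S: "finite S" "\<And>e. e \<in> S \<Longrightarrow> minimal e" "\<And>e. e \<in> S \<Longrightarrow> w e \<ge> (0::real)"
    "(\<Sum>e\<in>S. w e) \<ge> 1/2" "\<And>y. (\<Sum>e\<in>S. w e * norm (nch e y)) * norm (1 - nch t y) \<le> \<eta>"
    using small_average[OF conn t(1,3) eta] by blast
  \<comment> \<open>The conjugate turns \<open>e y * h e y\<close> into \<open>sqnorm e\<close>
    times the integrand of \<open>spectral_gap\<close>.\<close>
  define h where "h e y = cnj (nch e y) * (1 - nch t y)" for e y
  have hc: "continuous_on UNIV (h e)" if "e \<in> S" for e
    unfolding h_def by (intro continuous_intros nch_cont S(2)[OF that] t(1))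
  have hb: "norm (h e y) \<le> 2" if "e \<in> S" for e y
  proof -
    have "norm (1 - nch t y) \<le> 2"
      using norm_triangle_ineq4[of 1 "nch t y"] nch_bound[OF minimal_idem[OF t(1)], of y] by simp
    then have "norm (nch e y) * norm (1 - nch t y) \<le> 1 * 2"
      using nch_bound[OF minimal_idem[OF S(2)[OF that]]] by (intro mult_mono) auto
    then show ?thesis by (simp add: h_def norm_mult)
  qed
  define A where "A e i = (\<Sum>n. coef (fst (\<mu> i) n) e * (\<integral>y. snd (\<mu> i) n y * h e y \<partial>M))" for e i
  define Z where "Z e i = (\<Sum>n. coef (fst (\<mu> i) n) e * coef (snd (\<mu> i) n) e)" for e i
  define E where "E e = (\<integral>y. e y * h e y \<partial>M)" for e
  have "\<exists>r. r \<ge> c \<and> E e = of_real r" if e: "e \<in> S" for e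
  proof -
    have "e y * h e y = of_real (sqnorm e) * (of_real ((norm (nch e y))\<^sup>2) * (1 - nch t y))" for y
      unfolding complex_norm_square using idemD(6)[OF minimal_idem[OF S(2)[OF e]]]
      by (simp add: h_def nch_def)
    then have "E e = of_real (sqnorm e) * (\<integral>g. of_real ((norm (nch e g))\<^sup>2) * (1 - nch t g) \<partial>M)"
      by (simp add: E_def)
    then show ?thesis using c(2)[OF S(2)[OF e]] by simp
  qed
  then obtain R where R: "\<And>e. e \<in> S \<Longrightarrow> R e \<ge> c" "\<And>e. e \<in> S \<Longrightarrow> E e = of_real (R e)" by metis
  \<comment> \<open>Asymptotic commutation with \<open>e\<close> sends \<open>A - E * Z\<close> to
    0, and the approximate unit sends \<open>Z\<close> to 1.\<close>
  have lim: "(A e \<longlongrightarrow> E e) F" if e: "e \<in> S" for e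
  proof -
    note em = S(2)[OF e]
    have Zl: "((\<lambda>i. Z e i - 1) \<longlongrightarrow> 0) F"
      by (rule Lim_null_comparison[OF _ unit[OF ZL1_minimal[OF em]]])
        (use unit_estimate[OF rep em] in \<open>auto simp: Z_def\<close>)
    have "((\<lambda>i. 2 * proj_norm M (commutator_rep M e (\<mu> i))) \<longlongrightarrow> 0) F"
      using tendsto_mult[OF tendsto_const[of 2] comm[OF ZL1_minimal[OF em]]] by simp
    then have Al: "((\<lambda>i. A e i - E e * Z e i) \<longlongrightarrow> 0) F"
      by (rule Lim_null_comparison[rotated])
        (use commutator_estimate[OF rep em hc[OF e] hb[OF e]] in \<open>auto simp: A_def Z_def E_def\<close>)
    have "((\<lambda>i. (A e i - E e * Z e i) + E e * (Z e i - 1) + E e) \<longlongrightarrow> 0 + E e * 0 + E e) F"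
      by (intro tendsto_add tendsto_mult tendsto_const Al Zl)
    then show ?thesis by (simp add: algebra_simps)
  qed
  define \<phi> where "\<phi> f g = (\<Sum>e\<in>S. of_real (w e) * coef f e * (\<integral>y. g y * h e y \<partial>M))" for f g
  have bil: "bdd_bilinear M \<phi>"
    unfolding \<phi>_def by (rule form_bdd_bilinear[OF S(1,2) hc])
  \<comment> \<open>Bounding every \<open>coef f e\<close> by \<open>L1norm M f\<close> frees the
    sum over \<open>e\<close>, which moves inside the integral over \<open>y\<close>, where the
    pointwise bound of \<open>small_average\<close> applies.\<close>
  have bound: "norm (\<phi> f g) \<le> \<eta> * L1norm M f * L1norm M g" if f: "f \<in> ZL1 M" "g \<in> ZL1 M" for f g
  proof -
    note gi = ZL1_integrable[OF f(2)]
    have "norm (\<phi> f g) \<le> (\<Sum>e\<in>S. L1norm M f * (w e * (\<integral>y. norm (g y * h e y) \<partial>M)))"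
      unfolding \<phi>_def
    proof (rule sum_norm_le)
      fix e assume e: "e \<in> S"
      have "norm (coef f e) * (w e * norm (\<integral>y. g y * h e y \<partial>M)) \<le> L1norm M f * (w e * (\<integral>y. norm (g y * h e y) \<partial>M))"
        using coef_bound[OF S(2)[OF e] ZL1_integrable[OF f(1)]] S(3)[OF e]
        by (intro mult_mono mult_left_mono integral_norm_bound) (auto simp: L1norm_nonneg)
      then show "norm (of_real (w e) * coef f e * (\<integral>y. g y * h e y \<partial>M)) \<le> L1norm M f * (w e * (\<integral>y. norm (g y * h e y) \<partial>M))"
        using S(3)[OF e] by (simp add: norm_mult mult_ac)
    qed
    also have "\<dots> = L1norm M f * (\<integral>y. (\<Sum>e\<in>S. w e * norm (g y * h e y)) \<partial>M)"
      using weighted_integrable[OF gi hc] by (simp add: sum_distrib_left Bochner_Integration.integral_sum)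
    also have "\<dots> \<le> L1norm M f * (\<integral>y. \<eta> * norm (g y) \<partial>M)"
    proof (intro mult_left_mono L1norm_nonneg integral_mono)
      show "integrable M (\<lambda>y. \<Sum>e\<in>S. w e * norm (g y * h e y))"
        using weighted_integrable[OF gi hc] by (intro Bochner_Integration.integrable_sum) auto
      show "integrable M (\<lambda>y. \<eta> * norm (g y))" using gi by auto
      fix y
      have "(\<Sum>e\<in>S. w e * norm (g y * h e y)) = norm (g y) * ((\<Sum>e\<in>S. w e * norm (nch e y)) * norm (1 - nch t y))"
        by (simp add: h_def norm_mult sum_distrib_left sum_distrib_right mult_ac)
      also have "\<dots> \<le> norm (g y) * \<eta>" by (intro mult_left_mono S(5)) auto
      finally show "(\<Sum>e\<in>S. w e * norm (g y * h e y)) \<le> \<eta> * norm (g y)" by (simp add: mult.commute)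
    qed
    finally show ?thesis by (simp add: L1norm_def mult_ac)
  qed
  have small: "norm (\<Sum>e\<in>S. of_real (w e) * A e i) \<le> \<eta> * C" for i
  proof -
    have "(\<Sum>n. \<phi> (fst (\<mu> i) n) (snd (\<mu> i) n)) = (\<Sum>e\<in>S. \<Sum>n. of_real (w e) * (coef (fst (\<mu> i) n) e * (\<integral>y. snd (\<mu> i) n y * h e y \<partial>M)))"
      unfolding \<phi>_def mult.assoc
      by (intro suminf_sum summable_mult form_summable rep S(2) hc)
    also have "\<dots> = (\<Sum>e\<in>S. of_real (w e) * A e i)"
      unfolding A_def by (intro sum.cong refl suminf_mult form_summable rep S(2) hc)
    finally have "norm (\<Sum>e\<in>S. of_real (w e) * A e i) \<le> \<eta> * proj_norm M (\<mu> i)"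
      using tensor_bound[OF bil rep _ bound, of i] eta by simp
    also have "\<dots> \<le> \<eta> * C" using C eta by simp
    finally show ?thesis .
  qed
  have "((\<lambda>i. norm (\<Sum>e\<in>S. of_real (w e) * A e i)) \<longlongrightarrow> norm (\<Sum>e\<in>S. of_real (w e) * E e)) F"
    by (intro tendsto_norm tendsto_sum tendsto_mult tendsto_const lim)
  then have "norm (\<Sum>e\<in>S. of_real (w e) * E e) \<le> \<eta> * C"
    using small F by (intro tendsto_upperbound) auto
  moreover have "(\<Sum>e\<in>S. of_real (w e) * E e) = complex_of_real (\<Sum>e\<in>S. w e * R e)"
    using R(2) by simp
  ultimately have "(\<Sum>e\<in>S. w e * R e) \<le> \<eta> * C" by (simp only: norm_of_real)
  moreover have "(\<Sum>e\<in>S. w e * R e) \<ge> (\<Sum>e\<in>S. w e * c)"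
    using S(3) R(1) by (intro sum_mono mult_left_mono) auto
  moreover have "(\<Sum>e\<in>S. w e * c) \<ge> 1/2 * c"
    unfolding sum_distrib_right[symmetric] using S(4) c(1) by (intro mult_right_mono) auto
  moreover have "\<eta> * C < c / 2"
  proof -
    have "\<eta> * C \<le> \<eta> * (\<bar>C\<bar> + 1)" using eta by (intro mult_left_mono) auto
    also have "\<dots> \<le> c / (4 * (\<bar>C\<bar> + 1)) * (\<bar>C\<bar> + 1)"
      by (intro mult_right_mono) (auto simp: \<eta>_def)
    also have "\<dots> = c / 4" by (simp add: field_simps)
    also have "\<dots> < c / 2" using c(1) by simp
    finally show ?thesis .
  qed
  ultimately show False by linarith
qed

end

theorem theorem1p7:
  fixes M :: "'g::{topological_group_add,t2_space} measure"
  assumes "compact (UNIV :: 'g set)"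
    and "connected (UNIV :: 'g set)"
    and "\<exists>x y :: 'g. x + y \<noteq> y + x"
    and "normalised_left_haar M"
  shows "\<not> bounded_approx_diagonal M (F :: 'i filter) \<mu>"
proof -
  interpret compact_haar M by unfold_locales (use assms in auto)
  show ?thesis using assms(2,3) no_bounded_approx_diagonal by blast
qed

end
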